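(* Let $(T,\mathcal T,\lambda)$ be a complete atomless probability space, $\mathcal F$ a countably generated sub-$\sigma$-algebra of $\mathcal T$, and $X$ a separable Banach space with norm dual $X^*$. If $\mathcal T$ is nowhere equivalent to $\mathcal F$, then for every sub-$\sigma$-algebra $\mathcal G$ of $\mathcal F$ the following hold. (C1) For any $\mathcal F$-measurable and weak$^*$ compact valued correspondence $F$ from $T$ to $X^*$, $CG_F^{(\mathcal T,\mathcal G)}$ is convex. (C2) For any $1<p\le\infty$ and any $\mathcal F$-measurable, $p$-integrably bounded and weak$^*$ compact valued correspondence $F$ from $T$ to $X^*$, $CG_F^{(\mathcal T,\mathcal G)}$ is weak$^*$ compact in the dual space of $L_q^{\mathcal G}(T,X)$, where $\frac1p+\frac1q=1$. (C3) For any $1<p\le\infty$ and any $\mathcal F$-measurable, $p$-integrably bounded and weak$^*$ compact valued correspondence $F$ from $T$ to $X^*$, $CG_F^{(\mathcal T,\mathcal G)}=CG_{w^*\text{-}\overline{co}F}^{(\mathcal T,\mathcal G)}$, where $w^*\text{-}\overline{co}F(t)$ is the weak$^*$ closure of the convex hull of $F(t)$ for each $t\in T$. (C4) Let $1<p\le\infty$ and $\frac1p+\frac1q=1$, let $G$ be an $\mathcal F$-measurable, $p$-integrably bounded and weak$^*$ compact valued correspondence from $T$ to $X^*$, let $Y$ be a metric space, and let $F$ be a weak$^*$ closed valued correspondence from $T\times Y$ to $X^*$. If (a) for every $y\in Y$, $F(t,y)\subseteq G(t)$ for $\lambda$-almost all $t\in T$; (b) for every $y\in Y$, $F(\cdot,y)$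 is $\mathcal F$-measurable; (c) for every $t\in T$, $F(t,\cdot)$ is weak$^*$ upper hemicontinuous; then $H(y)=CG_{F_y}^{(\mathcal T,\mathcal G)}$, with $F_y=F(\cdot,y)$, is weak$^*$ upper hemicontinuous from $Y$ to the dual space of $L_q^{\mathcal G}(T,X)$.
   Context: Nowhere equivalence: $\mathcal T$ is nowhere equivalent to $\mathcal F$ if for every $D\in\mathcal T$ with $\lambda(D)>0$ there is a $\mathcal T$-measurable set $D_0\subseteq D$ such that $\lambda(D_0\triangle D_1)>0$ for every $D_1\in\mathcal F^D:=\{D\cap D':D'\in\mathcal F\}$. Correspondences: a correspondence from $T$ to a set $Z$ assigns to each $t\in T$ a nonempty subset of $Z$. If $Z$ is a topological space, $F$ is $\mathcal F$-measurable if $\{t\in T: F(t)\cap E\ne\emptyset\}\in\mathcal F$ for each closed $E\subseteq Z$; here $X^*$ carries its weak$^*$ topology, and measurability of mappings into $X^*$ is with respect to the weak$^*$ Borel $\sigma$-algebra. $F$ is closed (compact, ...) valued if $F(t)$ has this property for $\lambda$-almost all $t$. A selection of $F$ is a mapping $f$ with $f(t)\in F(t)$ for $\lambda$-almost all $t$. $F$ is $p$-integrably bounded if there is a measurable real function $h$ with $h^p$ integrable (for $p=\infty$: $h$ essentially bounded) and $\sup\{\|x^*\|:x^*\in F(t)\}\le h(t)$ for $\lambda$-almost all $t$. A correspondence $F$ from a topological space $Y$ to a topological space $Z$ is upper hemicontinuous if for each $y_0\in Y$ and each open $O_Z\supseteq F(y_0)$ there is an open neighborhood $O_Y$ of $y_0$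 with $F(y)\subseteq O_Z$ for all $y\in O_Y$; "weak$^*$" means that the target carries its weak$^*$ topology. Gel'fand integral and conditional expectation: $f:T\to X^*$ is Gel'fand integrable if $t\mapsto f(t)(x)$ is integrable for each $x\in X$; $\int_D f\,d\lambda\in X^*$ is the functional $x\mapsto\int_D f(t)(x)\,d\lambda(t)$. A Gel'fand conditional expectation $E(f|\mathcal G)$ of $f$ is a $\mathcal G$-measurable Gel'fand integrable $g:T\to X^*$ with $\int_D f\,d\lambda=\int_D g\,d\lambda$ for all $D\in\mathcal G$ (identified up to $\lambda$-a.e. equality). $CG_F^{(\mathcal T,\mathcal G)}=\{E(f|\mathcal G): f$ is a $\mathcal T$-measurable Gel'fand integrable selection of $F\}$. $L_q^{\mathcal G}(T,X)$ is the Banach space of $\mathcal G$-measurable Bochner integrable $\varphi:T\to X$ with $\int_T\|\varphi\|^q\,d\lambda<\infty$. When $F$ is $p$-integrably bounded, an element $g\in CG_F^{(\mathcal T,\mathcal G)}$ is regarded as the element $\varphi\mapsto\int_T g(t)(\varphi(t))\,d\lambda(t)$ of the dual of $L_q^{\mathcal G}(T,X)$. *)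

theory Defs
  imports "HOL-Probability.Probability"
begin

subsection \<open>Measure spaces and sub-sigma-algebras\<close>

text \<open>
  Sub-sigma-algebras are represented, as in \<^theory>\<open>HOL-Probability.Conditional_Expectation\<close>, by
  measures of which only the underlying space and the measurable sets are used
  (\<^const>\<open>subalgebra\<close>); every integral is taken with respect to the ambient measure.
\<close>

definition atomless :: "'t measure \<Rightarrow> bool" where
  "atomless M \<longleftrightarrow> (\<forall>A\<in>sets M. 0 < emeasure M A \<longrightarrow>
     (\<exists>B\<in>sets M. B \<subseteq> A \<and> 0 < emeasure M B \<and> emeasure M B < emeasure M A))"

definition countably_generated :: "'t measure \<Rightarrow> bool" where
  "countably_generated F \<longleftrightarrow>
     (\<exists>C. countable C \<and> C \<subseteq> Pow (space F) \<and> sets F = sigma_sets (space F) C)"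

definition trace_sets :: "'t measure \<Rightarrow> 't set \<Rightarrow> 't set set" where
  "trace_sets F D = {D \<inter> D' | D'. D' \<in> sets F}"

definition nowhere_equivalent :: "'t measure \<Rightarrow> 't measure \<Rightarrow> bool" where
  "nowhere_equivalent M F \<longleftrightarrow> (\<forall>D\<in>sets M. 0 < emeasure M D \<longrightarrow>
     (\<exists>D0\<in>sets M. D0 \<subseteq> D \<and>
        (\<forall>D1\<in>trace_sets F D. 0 < emeasure M ((D0 - D1) \<union> (D1 - D0)))))"


subsection \<open>The dual space with its weak* topology\<close>

text \<open>
  The norm dual of \<open>'x\<close> is \<open>'x \<Rightarrow>\<^sub>L real\<close>.  For real-valued operators the strong operator
  topology, i.e. the topology of pointwise convergence, is the weak* topology.
\<close>

abbreviation weak_star :: "('x::real_normed_vector \<Rightarrow>\<^sub>L real) topology" where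
  "weak_star \<equiv> strong_operator_topology"

definition weak_star_borel :: "('x::real_normed_vector \<Rightarrow>\<^sub>L real) measure" where
  "weak_star_borel = sigma UNIV {U. openin weak_star U}"


subsection \<open>Correspondences\<close>

definition correspondence :: "'a set \<Rightarrow> 'b set \<Rightarrow> ('a \<Rightarrow> 'b set) \<Rightarrow> bool" where
  "correspondence S Z F \<longleftrightarrow> (\<forall>s\<in>S. F s \<noteq> {} \<and> F s \<subseteq> Z)"

definition upper_hemicontinuous :: "'y topology \<Rightarrow> 'z topology \<Rightarrow> ('y \<Rightarrow> 'z set) \<Rightarrow> bool" where
  "upper_hemicontinuous Y Z F \<longleftrightarrow>
     correspondence (topspace Y) (topspace Z) F \<and>
     (\<forall>y0\<in>topspace Y. \<forall>V. openin Z V \<and> F y0 \<subseteq> V \<longrightarrow>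
        (\<exists>U. openin Y U \<and> y0 \<in> U \<and> (\<forall>y\<in>U. F y \<subseteq> V)))"

definition measurable_correspondence ::
    "'t measure \<Rightarrow> ('t \<Rightarrow> ('x::real_normed_vector \<Rightarrow>\<^sub>L real) set) \<Rightarrow> bool" where
  "measurable_correspondence F \<Phi> \<longleftrightarrow>
     (\<forall>E. closedin weak_star E \<longrightarrow> {t\<in>space F. \<Phi> t \<inter> E \<noteq> {}} \<in> sets F)"

definition weak_star_compact_valued ::
    "'t measure \<Rightarrow> ('t \<Rightarrow> ('x::real_normed_vector \<Rightarrow>\<^sub>L real) set) \<Rightarrow> bool" where
  "weak_star_compact_valued M \<Phi> \<longleftrightarrow> (AE t in M. compactin weak_star (\<Phi> t))"

definition weak_star_closed_valued ::
    "'t measure \<Rightarrow> ('t \<Rightarrow> ('x::real_normed_vector \<Rightarrow>\<^sub>L real) set) \<Rightarrow> bool" where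
  "weak_star_closed_valued M \<Phi> \<longleftrightarrow> (AE t in M. closedin weak_star (\<Phi> t))"

definition integrably_bounded ::
    "'t measure \<Rightarrow> ereal \<Rightarrow> ('t \<Rightarrow> ('x::real_normed_vector \<Rightarrow>\<^sub>L real) set) \<Rightarrow> bool" where
  "integrably_bounded M p \<Phi> \<longleftrightarrow>
     (\<exists>h :: 't \<Rightarrow> real. h \<in> borel_measurable M \<and>
        (if p = \<infinity> then \<exists>c. AE t in M. \<bar>h t\<bar> \<le> c
         else integrable M (\<lambda>t. h t powr real_of_ereal p)) \<and>
        (AE t in M. (SUP \<xi>\<in>\<Phi> t. ereal (norm \<xi>)) \<le> ereal (h t)))"

definition weak_star_closed_hull ::
    "('x::real_normed_vector \<Rightarrow>\<^sub>L real) set \<Rightarrow> ('x \<Rightarrow>\<^sub>L real) set" where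
  "weak_star_closed_hull A = weak_star closure_of (convex hull A)"


subsection \<open>Gel'fand integrals and conditional expectations\<close>

definition gelfand_integrable ::
    "'t measure \<Rightarrow> ('t \<Rightarrow> ('x::real_normed_vector \<Rightarrow>\<^sub>L real)) \<Rightarrow> bool" where
  "gelfand_integrable M f \<longleftrightarrow> (\<forall>x. integrable M (\<lambda>t. blinfun_apply (f t) x))"

text \<open>
  For Gel'fand integrable \<open>f\<close> on a Banach space this functional is automatically linear and bounded
  (closed graph theorem).  Elements of the dual are equal iff they agree as functions, so the
  integral is kept as a plain function here.
\<close>

definition gelfand_integral ::
    "'t measure \<Rightarrow> 't set \<Rightarrow> ('t \<Rightarrow> ('x::real_normed_vector \<Rightarrow>\<^sub>L real)) \<Rightarrow> 'x \<Rightarrow> real" where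
  "gelfand_integral M D f = (\<lambda>x. LINT t:D|M. blinfun_apply (f t) x)"

definition gelfand_cond_exp ::
    "'t measure \<Rightarrow> 't measure \<Rightarrow> ('t \<Rightarrow> ('x::real_normed_vector \<Rightarrow>\<^sub>L real)) \<Rightarrow>
     ('t \<Rightarrow> ('x \<Rightarrow>\<^sub>L real)) \<Rightarrow> bool" where
  "gelfand_cond_exp M G f g \<longleftrightarrow>
     g \<in> measurable G weak_star_borel \<and> gelfand_integrable M g \<and>
     (\<forall>D\<in>sets G. gelfand_integral M D f = gelfand_integral M D g)"

text \<open>
  The set below contains all versions of the conditional expectations of selections of \<open>\<Phi>\<close>; it is
  closed under passing to a.e. equal \<open>G\<close>-measurable functions.  Hence an equality of
  two such sets is the same as the equality of the corresponding sets of a.e.-equivalence classes,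
  and likewise for convexity.
\<close>

definition CG :: "'t measure \<Rightarrow> 't measure \<Rightarrow> ('t \<Rightarrow> ('x::real_normed_vector \<Rightarrow>\<^sub>L real) set) \<Rightarrow>
     ('t \<Rightarrow> ('x \<Rightarrow>\<^sub>L real)) set" where
  "CG M G \<Phi> = {g. \<exists>f. f \<in> measurable M weak_star_borel \<and> gelfand_integrable M f \<and>
     (AE t in M. f t \<in> \<Phi> t) \<and> gelfand_cond_exp M G f g}"

text \<open>\<^const>\<open>convex\<close> needs a type in class \<open>real_vector\<close>, which function types are not.\<close>

definition convex_function_set :: "('t \<Rightarrow> 'b::real_vector) set \<Rightarrow> bool" where
  "convex_function_set A \<longleftrightarrow> (\<forall>g1\<in>A. \<forall>g2\<in>A. \<forall>u\<ge>0. \<forall>v\<ge>0. u + v = 1 \<longrightarrow>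
     (\<lambda>t. u *\<^sub>R g1 t + v *\<^sub>R g2 t) \<in> A)"


subsection \<open>The space \<open>L_q\<close> and its dual\<close>

text \<open>
  \<open>L_q\<close> is represented by the seminormed space of its representatives.  A bounded functional on it
  takes the same value at a.e. equal functions, so the bounded linear functionals on this space are
  exactly those on the Banach space of a.e.-equivalence classes, and the weak* topologies agree.
  Functionals are made \<^const>\<open>extensional\<close>, i.e. \<^const>\<open>undefined\<close> outside \<open>L_q\<close>.
\<close>

definition Lq_space :: "'t measure \<Rightarrow> 't measure \<Rightarrow> real \<Rightarrow>
     ('t \<Rightarrow> 'x::{banach, second_countable_topology}) set" where
  "Lq_space M G q = {\<phi>. \<phi> \<in> borel_measurable G \<and> integrable M \<phi> \<and>
     integrable M (\<lambda>t. norm (\<phi> t) powr q)}"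

definition Lq_norm :: "'t measure \<Rightarrow> real \<Rightarrow> ('t \<Rightarrow> 'x::real_normed_vector) \<Rightarrow> real" where
  "Lq_norm M q \<phi> = (LINT t|M. norm (\<phi> t) powr q) powr (1 / q)"

definition Lq_dual :: "'t measure \<Rightarrow> 't measure \<Rightarrow> real \<Rightarrow>
     (('t \<Rightarrow> 'x::{banach, second_countable_topology}) \<Rightarrow> real) set" where
  "Lq_dual M G q = {\<Lambda> \<in> extensional (Lq_space M G q).
     (\<forall>\<phi>\<in>Lq_space M G q. \<forall>\<psi>\<in>Lq_space M G q. \<Lambda> (\<lambda>t. \<phi> t + \<psi> t) = \<Lambda> \<phi> + \<Lambda> \<psi>) \<and>
     (\<forall>\<phi>\<in>Lq_space M G q. \<forall>c. \<Lambda> (\<lambda>t. c *\<^sub>R \<phi> t) = c * \<Lambda> \<phi>) \<and>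
     (\<exists>K. \<forall>\<phi>\<in>Lq_space M G q. \<bar>\<Lambda> \<phi>\<bar> \<le> K * Lq_norm M q \<phi>)}"

definition Lq_dual_weak_star :: "'t measure \<Rightarrow> 't measure \<Rightarrow> real \<Rightarrow>
     (('t \<Rightarrow> 'x::{banach, second_countable_topology}) \<Rightarrow> real) topology" where
  "Lq_dual_weak_star M G q =
     subtopology (product_topology (\<lambda>_. euclideanreal) (Lq_space M G q)) (Lq_dual M G q)"

definition Lq_functional :: "'t measure \<Rightarrow> 't measure \<Rightarrow> real \<Rightarrow>
     ('t \<Rightarrow> ('x::{banach, second_countable_topology} \<Rightarrow>\<^sub>L real)) \<Rightarrow> ('t \<Rightarrow> 'x) \<Rightarrow> real" where
  "Lq_functional M G q g = (\<lambda>\<phi>\<in>Lq_space M G q. LINT t|M. blinfun_apply (g t) (\<phi> t))"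

end

theory Submission
  imports Defs
begin

text \<open>
  Cut the dual space by countably many half-spaces \<open>\<xi>(d) \<le> q\<close>, where \<open>d\<close> runs through a countable
  dense subgroup and \<open>q\<close> through the rationals.  They generate a binary tree of closed boxes, and an
  infinite branch meets a weak* compact set in at most one point.  The conditional law given \<open>F\<close> of a
  selection of \<open>\<Phi>\<close> is recorded by the masses \<open>m(s, B)\<close> it gives to the boxes \<open>s\<close>, averaged over \<open>B \<in> F\<close>.
  Conversely, since no part of the ambient \<open>\<sigma>\<close>-algebra agrees with \<open>F\<close>, Maharam's lemma splits any set
  into pieces with prescribed conditional probabilities; applied along the tree it realizes every system
  of masses carried by \<open>\<Phi>\<close> by an actual selection.  Being carried by \<open>\<Phi>\<close> is a convex condition that is
  closed in a product of unit intervals, and integrals of a selection against \<open>L_q\<close> functions depend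
  continuously on its masses.  This gives convexity, compactness and, through cluster points,
  upper hemicontinuity.  A conditional expectation from the closed convex hull that is not attained would be
  strictly separated from the compact convex set of attained ones by some \<open>\<eta> \<in> L_q\<close>, which is impossible
  as some selection of \<open>\<Phi>\<close> nearly maximizes \<open>\<xi> \<mapsto> \<xi>(\<eta>(t))\<close>.
\<close>

subsection \<open>The weak* topology\<close>

text \<open>Two families of boxes appear because neither serves both ends. The \<open>tbox\<close>
  are weak* closed, so whether a value of the correspondence misses one is an event of
  \<open>F\<close>, and compactness gives a point common to a whole branch; but siblings share a
  hyperplane and do not partition the dual space. The \<open>tcell\<close> partition it and sort the
  values of a selection into masses, but need not be closed. Hence masses determine a distribution
  function only up to mass on the threshold itself, and laws are compared by squeezing between
  nearby rational thresholds. Additivity in \<open>B\<close> is required for two sets only, so that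
  every condition on \<open>m\<close> involves finitely many coordinates and survives pointwise
  limits; domination by \<open>prob B\<close> returns countable additivity when a density is needed.
  As \<open>B\<close> ranges over all of \<open>F\<close>, a possibly uncountable family,
  compactness is Tychonoff's and cluster points are those of filters. The first claim comes without
  an integrable bound: there only one-dimensional laws at points of the dense subgroup are mixed,
  and integrability is inherited from the two given selections.\<close>

lemma weak_star_nbhd:
  assumes "openin weak_star U" "\<xi> \<in> U"
  obtains J \<epsilon> where "finite J" "0 < \<epsilon>"
    "\<And>\<eta>. (\<And>x. x \<in> J \<Longrightarrow> \<bar>blinfun_apply \<eta> x - blinfun_apply \<xi> x\<bar> < \<epsilon>) \<Longrightarrow> \<eta> \<in> U"
proof -
  obtain V where V: "open V" "U = blinfun_apply -` V"
    using assms(1) unfolding strong_operator_topology_def openin_pullback_topology by auto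
  from V assms(2) have "blinfun_apply \<xi> \<in> V" by auto
  with V(1) obtain W where W: "finite {i. W i \<noteq> UNIV}" "\<And>i. open (W i)"
      "\<And>i. blinfun_apply \<xi> i \<in> W i" "Pi\<^sub>E UNIV W \<subseteq> V"
    unfolding open_fun_def openin_product_topology_alt by (auto simp: PiE_iff)
  define J where "J = {i. W i \<noteq> UNIV}"
  have "\<exists>\<epsilon>>0. \<forall>y. \<bar>y - blinfun_apply \<xi> i\<bar> < \<epsilon> \<longrightarrow> y \<in> W i" for i
    using W(2)[of i] W(3)[of i] unfolding open_dist by (auto simp: dist_real_def)
  then obtain \<delta> where \<delta>: "\<And>i. \<delta> i > 0" "\<And>i y. \<bar>y - blinfun_apply \<xi> i\<bar> < \<delta> i \<Longrightarrow> y \<in> W i"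
    by metis
  define \<epsilon> where "\<epsilon> = Min (insert 1 (\<delta> ` J))"
  have "finite J" using W(1) J_def by simp
  then have "0 < \<epsilon>" "\<And>i. i \<in> J \<Longrightarrow> \<epsilon> \<le> \<delta> i"
    unfolding \<epsilon>_def using \<delta>(1) by auto
  moreover have "\<eta> \<in> U" if "\<And>x. x \<in> J \<Longrightarrow> \<bar>blinfun_apply \<eta> x - blinfun_apply \<xi> x\<bar> < \<epsilon>" for \<eta>
  proof -
    have "blinfun_apply \<eta> i \<in> W i" for i
    proof (cases "i \<in> J")
      case True
      then show ?thesis using that[OF True] \<open>\<And>i. i \<in> J \<Longrightarrow> \<epsilon> \<le> \<delta> i\<close>[OF True] \<delta>(2)[of "blinfun_apply \<eta> i" i] by simp
    next
      case False then show ?thesis by (simp add: J_def)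
    qed
    then have "blinfun_apply \<eta> \<in> Pi\<^sub>E UNIV W" by auto
    with W(4) V(2) show ?thesis by auto
  qed
  ultimately show ?thesis using that \<open>finite J\<close> by blast
qed

lemma closedin_weak_star_le: "closedin weak_star {\<xi>. blinfun_apply \<xi> x \<le> q}"
  using closedin_continuous_map_preimage[OF strong_operator_topology_continuous_evaluation, of "{..q}" x]
  by (simp add: strong_operator_topology_topspace)

lemma closedin_weak_star_ge: "closedin weak_star {\<xi>. q \<le> blinfun_apply \<xi> x}"
  using closedin_continuous_map_preimage[OF strong_operator_topology_continuous_evaluation, of "{q..}" x]
  by (simp add: strong_operator_topology_topspace)

lemma weak_star_borel_measurable_apply:
  "(\<lambda>\<xi>. blinfun_apply \<xi> x) \<in> borel_measurable weak_star_borel"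
proof (rule borel_measurableI)
  fix S :: "real set" assume "open S"
  then have "openin weak_star {\<xi> \<in> topspace weak_star. blinfun_apply \<xi> x \<in> S}"
    by (intro openin_continuous_map_preimage[OF strong_operator_topology_continuous_evaluation]) simp
  then show "(\<lambda>\<xi>. blinfun_apply \<xi> x) -` S \<inter> space weak_star_borel \<in> sets weak_star_borel"
    by (auto simp: weak_star_borel_def strong_operator_topology_topspace vimage_def)
qed

lemma measurable_apply_weak_star:
  assumes "f \<in> measurable N weak_star_borel"
  shows "(\<lambda>t. blinfun_apply (f t) x) \<in> borel_measurable N"
  using measurable_compose[OF assms weak_star_borel_measurable_apply] .

subsection \<open>Countable dense subgroups\<close>

text \<open>
  The enumeration \<open>e\<close> lists all pairs of a point of \<open>D\<close> and a rational threshold; each of them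
  cuts the dual space into two half-spaces.
\<close>

locale threshold_enumeration =
  fixes D :: "'x::{banach, second_countable_topology} set" and e :: "nat \<Rightarrow> 'x \<times> real"
  assumes countable_D: "countable D"
    and dense_D: "closure D = UNIV"
    and add_D: "\<And>x y. x \<in> D \<Longrightarrow> y \<in> D \<Longrightarrow> x + y \<in> D"
    and minus_D: "\<And>x. x \<in> D \<Longrightarrow> - x \<in> D"
    and range_e: "range e = D \<times> \<rat>"

text \<open>Finite sums of elements of a countable dense set and of their negatives form a countable
  subgroup. Closure under scalars is not asked for: homogeneity of an additive map will follow from
  its boundedness.\<close>

lemma ex_threshold_enumeration:
  "\<exists>(D :: 'x::{banach, second_countable_topology} set) e. threshold_enumeration D e"
proof -
  obtain S :: "'x set" where S: "countable S" "closure S = UNIV"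
  proof -
    obtain S :: "'x set" where S: "countable S" "\<And>X. open X \<Longrightarrow> X \<noteq> {} \<Longrightarrow> \<exists>d\<in>S. d \<in> X"
      using countable_dense_setE by blast
    have "x \<in> closure S" for x
      unfolding closure_approachable using S(2)[of "ball x _"] by (auto simp: dist_commute)
    then show ?thesis using S(1) that by blast
  qed
  define S' where "S' = S \<union> uminus ` S"
  define D where "D = sum_list ` lists S'"
  have "countable D" unfolding D_def S'_def using S(1) by (intro countable_image countable_lists) auto
  have "S \<subseteq> D"
  proof
    fix x assume "x \<in> S"
    then have "[x] \<in> lists S'" by (auto simp: S'_def)
    then show "x \<in> D" unfolding D_def by (rule rev_image_eqI) simp
  qed
  then have "closure D = UNIV" using S(2) closure_mono by blast
  have "x + y \<in> D" if "x \<in> D" "y \<in> D" for x y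
  proof -
    from that obtain l k where "l \<in> lists S'" "k \<in> lists S'" "x = sum_list l" "y = sum_list k"
      unfolding D_def by auto
    then show ?thesis unfolding D_def by (intro rev_image_eqI[of "l @ k"]) auto
  qed
  moreover have "- x \<in> D" if "x \<in> D" for x
  proof -
    from that obtain l where l: "l \<in> lists S'" "x = sum_list l"
      unfolding D_def by auto
    have "map uminus l \<in> lists S'" using l(1) unfolding S'_def by (auto simp: in_lists_conv_set)
    moreover have "sum_list (map uminus l) = - sum_list l" by (induction l) auto
    ultimately show ?thesis unfolding D_def using l(2) by (intro rev_image_eqI[of "map uminus l"]) auto
  qed
  moreover have "countable (D \<times> (\<rat> :: real set))" using \<open>countable D\<close> countable_rat by auto
  moreover have "D \<times> (\<rat> :: real set) \<noteq> {}" using \<open>closure D = UNIV\<close> by force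
  ultimately show ?thesis
    using \<open>countable D\<close> \<open>closure D = UNIV\<close> range_from_nat_into[of "D \<times> (\<rat> :: real set)"]
    unfolding threshold_enumeration_def by metis
qed

section \<open>Functionals and measurability read off from the countable dense subgroup\<close>

context threshold_enumeration
begin

lemma approx_D: "0 < \<epsilon> \<Longrightarrow> \<exists>d\<in>D. norm (x - d) < \<epsilon>"
  using dense_D closure_approachable[of x D] by (auto simp: dist_norm norm_minus_commute)

lemma seq_D: "\<exists>d. (\<forall>n. d n \<in> D) \<and> d \<longlonglongrightarrow> x"
  using dense_D closure_sequential[of x D] by auto

lemma ne_D: "D \<noteq> {}" using approx_D[of 1] by auto

lemma zero_D: "0 \<in> D" using ne_D add_D minus_D by (metis ex_in_conv add.right_inverse)

text \<open>Continuity lets the countable set \<open>D\<close> replace the whole space as a test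
  set, so a norm bound becomes countably many inequalities between evaluations and hence a
  measurable condition.\<close>

lemma norm_le_iff_D:
  assumes "0 \<le> c"
  shows "norm \<xi> \<le> c \<longleftrightarrow> (\<forall>d\<in>D. \<bar>blinfun_apply \<xi> d\<bar> \<le> c * norm d)"
proof
  assume "norm \<xi> \<le> c"
  then show "\<forall>d\<in>D. \<bar>blinfun_apply \<xi> d\<bar> \<le> c * norm d"
    using norm_blinfun[of \<xi>] by (metis mult_right_mono norm_ge_zero order_trans real_norm_def)
next
  assume *: "\<forall>d\<in>D. \<bar>blinfun_apply \<xi> d\<bar> \<le> c * norm d"
  have "\<bar>blinfun_apply \<xi> x\<bar> \<le> c * norm x" for x
  proof -
    obtain d where d: "\<And>n. d n \<in> D" "d \<longlonglongrightarrow> x" using seq_D[of x] by blast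
    have "(\<lambda>n. \<bar>blinfun_apply \<xi> (d n)\<bar>) \<longlonglongrightarrow> \<bar>blinfun_apply \<xi> x\<bar>"
      using d(2) by (intro tendsto_intros)
    moreover have "(\<lambda>n. c * norm (d n)) \<longlonglongrightarrow> c * norm x" using d(2) by (intro tendsto_intros)
    ultimately show ?thesis using * d(1) by (intro LIMSEQ_le) auto
  qed
  then show "norm \<xi> \<le> c" using assms by (intro norm_blinfun_bound) auto
qed

text \<open>Weak* open sets are countable unions of sets given by a norm bound and finitely many
  approximate values at points of \<open>D\<close>, so evaluations on \<open>D\<close> decide
  measurability. The norm bound is what allows a test point outside \<open>D\<close> to be moved
  into \<open>D\<close>.\<close>

lemma measurable_weak_starI:
  assumes "\<And>d. d \<in> D \<Longrightarrow> (\<lambda>t. blinfun_apply (f t) d) \<in> borel_measurable N"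
  shows "f \<in> measurable N weak_star_borel"
  unfolding weak_star_borel_def
proof (rule measurable_measure_of)
  define W where "W = (\<lambda>(n::nat, L :: ('x \<times> real) list, k::nat). {\<eta>. norm \<eta> \<le> real n \<and>
    (\<forall>(d, r)\<in>set L. \<bar>blinfun_apply \<eta> d - r\<bar> < 1 / real (Suc k))})"
  define I where "I = (UNIV :: nat set) \<times> lists (D \<times> (\<rat> :: real set)) \<times> (UNIV :: nat set)"
  have I: "countable I" unfolding I_def using countable_D countable_rat by auto
  have meas: "f -` W i \<inter> space N \<in> sets N" if "i \<in> I" for i
  proof -
    obtain n L k where i: "i = (n, L, k)" by (cases i)
    have L: "\<And>d r. (d, r) \<in> set L \<Longrightarrow> d \<in> D" using that by (auto simp: i I_def in_lists_conv_set)
    have "f -` W i \<inter> space N = {t\<in>space N. (\<forall>d\<in>D. \<bar>blinfun_apply (f t) d\<bar> \<le> real n * norm d) \<and>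
        (\<forall>p\<in>set L. \<bar>blinfun_apply (f t) (fst p) - snd p\<bar> < 1 / real (Suc k))}"
      unfolding i W_def by (auto simp: norm_le_iff_D split_beta)
    also have "\<dots> \<in> sets N"
    proof (rule sets.sets_Collect_conj)
      show "{t \<in> space N. \<forall>d\<in>D. \<bar>blinfun_apply (f t) d\<bar> \<le> real n * norm d} \<in> sets N"
        using assms countable_D by (intro sets.sets_Collect_countable_All') auto
      show "{t \<in> space N. \<forall>p\<in>set L. \<bar>blinfun_apply (f t) (fst p) - snd p\<bar> < 1 / real (Suc k)} \<in> sets N"
        using L assms by (intro sets.sets_Collect_countable_All') (auto intro: countable_finite)
    qed
    finally show ?thesis .
  qed
  show "f -` U \<inter> space N \<in> sets N" if "U \<in> {U. openin weak_star U}" for U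
  proof -
    have U: "openin weak_star U" using that by simp
    have "\<exists>i\<in>I. \<xi> \<in> W i \<and> W i \<subseteq> U" if \<xi>: "\<xi> \<in> U" for \<xi>
    proof -
      obtain J \<epsilon> where J: "finite J" "0 < \<epsilon>"
        "\<And>\<eta>. (\<And>x. x \<in> J \<Longrightarrow> \<bar>blinfun_apply \<eta> x - blinfun_apply \<xi> x\<bar> < \<epsilon>) \<Longrightarrow> \<eta> \<in> U"
        using weak_star_nbhd[OF U \<xi>] by blast
      obtain n :: nat where n: "norm \<xi> \<le> real n" using real_arch_simple by blast
      obtain k :: nat where k: "1 / real (Suc k) < \<epsilon> / 4"
        using J(2) nat_approx_posE[of "\<epsilon> / 4"] by auto
      \<comment> \<open>Four errors have to stay within \<epsilon>: moving \<open>x\<close> to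
        \<open>d x\<close> costs at most \<epsilon>/4 for each of \<open>\<xi>\<close> and
        \<open>\<eta>\<close>, and comparing each value with the rational \<open>r x\<close> costs
        less than \<epsilon>/4. The summand 1 covers the case \<open>n = 0\<close>.\<close>
      have "\<exists>d\<in>D. norm (x - d) < \<epsilon> / (4 * (real n + 1))" for x
        using J(2) by (intro approx_D) auto
      then obtain d where d: "\<And>x. d x \<in> D" "\<And>x. norm (x - d x) < \<epsilon> / (4 * (real n + 1))" by metis
      have "\<exists>r\<in>\<rat>. \<bar>blinfun_apply \<xi> (d x) - r\<bar> < 1 / real (Suc k)" for x
        using Rats_dense_in_real[of "blinfun_apply \<xi> (d x) - 1 / real (Suc k)" "blinfun_apply \<xi> (d x)"]
        by force
      then obtain r where r: "\<And>x. r x \<in> \<rat>" "\<And>x. \<bar>blinfun_apply \<xi> (d x) - r x\<bar> < 1 / real (Suc k)" by metis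
      obtain xs where xs: "set xs = J" using J(1) finite_list by blast
      define L where "L = map (\<lambda>x. (d x, r x)) xs"
      have bd: "\<bar>blinfun_apply \<eta> (x - d x)\<bar> \<le> \<epsilon> / 4" if "norm \<eta> \<le> real n" for \<eta> :: "'x \<Rightarrow>\<^sub>L real" and x
      proof -
        have "\<bar>blinfun_apply \<eta> (x - d x)\<bar> \<le> norm \<eta> * norm (x - d x)" using norm_blinfun[of \<eta>] by auto
        also have "\<dots> \<le> (real n + 1) * (\<epsilon> / (4 * (real n + 1)))"
          using that d(2)[of x] by (intro mult_mono) auto
        also have "\<dots> = \<epsilon> / 4" by (simp add: field_simps)
        finally show ?thesis .
      qed
      have "(n, L, k) \<in> I" unfolding I_def L_def using d r by auto
      moreover have "\<xi> \<in> W (n, L, k)" unfolding W_def L_def using n r by auto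
      moreover have "W (n, L, k) \<subseteq> U"
      proof
        fix \<eta> assume \<eta>: "\<eta> \<in> W (n, L, k)"
        show "\<eta> \<in> U"
        proof (rule J(3))
          fix x assume "x \<in> J"
          then have "\<bar>blinfun_apply \<eta> (d x) - r x\<bar> < 1 / real (Suc k)" and "norm \<eta> \<le> real n"
            using \<eta> xs unfolding W_def L_def by auto
          then show "\<bar>blinfun_apply \<eta> x - blinfun_apply \<xi> x\<bar> < \<epsilon>"
            using bd[of \<eta> x] bd[OF n, of x] r(2)[of x] k
            unfolding blinfun.diff_right by linarith
        qed
      qed
      ultimately show ?thesis by blast
    qed
    then have "U = (\<Union>i\<in>{i\<in>I. W i \<subseteq> U}. W i)" by blast
    then have "f -` U \<inter> space N = (\<Union>i\<in>{i\<in>I. W i \<subseteq> U}. f -` W i \<inter> space N)" by blast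
    also have "\<dots> \<in> sets N" using meas I by (intro sets.countable_UN') (auto intro: countable_subset)
    finally show ?thesis .
  qed
qed auto

text \<open>Additivity turns the bound into a Lipschitz condition, so \<open>u\<close> extends
  continuously to the closure of \<open>D\<close>, which is the whole space; the extension is
  additive by continuity. This is how values known only on \<open>D\<close> become an element of the
  dual.\<close>

lemma additive_extension:
  fixes u :: "'x \<Rightarrow> real"
  assumes add: "\<And>x y. x \<in> D \<Longrightarrow> y \<in> D \<Longrightarrow> u (x + y) = u x + u y"
    and bd: "\<And>x. x \<in> D \<Longrightarrow> \<bar>u x\<bar> \<le> c * norm x" and "0 \<le> c"
  shows "\<exists>\<xi>. norm \<xi> \<le> c \<and> (\<forall>x\<in>D. blinfun_apply \<xi> x = u x)"
proof -
  have u0: "u 0 = 0" using add[of 0 0] zero_D by simp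
  have um: "u (- x) = - u x" if "x \<in> D" for x using add[of x "- x"] minus_D[OF that] that u0 by simp
  have "c-lipschitz_on D u"
  proof (rule lipschitz_onI)
    fix x y assume "x \<in> D" "y \<in> D"
    then have "u (x - y) = u x - u y" "x - y \<in> D"
      using add[of x "- y"] um[of y] minus_D[of y] add_D[of x "- y"] by auto
    then show "dist (u x) (u y) \<le> c * dist x y" using bd[of "x - y"] by (auto simp: dist_norm)
  qed fact
  from lipschitz_extend_closure[OF this] obtain g where g: "c-lipschitz_on UNIV g" "\<And>x. x \<in> D \<Longrightarrow> g x = u x"
    unfolding dense_D by auto
  have cont: "continuous_on UNIV g" using g(1) lipschitz_on_continuous_on by blast
  have lim: "(\<lambda>n. g (a n)) \<longlonglongrightarrow> g b" if "a \<longlonglongrightarrow> b" for a b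
    using cont that by (simp add: continuous_on_eq_continuous_within isCont_tendsto_compose)
  have gadd: "g (x + y) = g x + g y" for x y
  proof -
    obtain a where a: "\<And>n. a n \<in> D" "a \<longlonglongrightarrow> x" using seq_D[of x] by blast
    obtain b where b: "\<And>n. b n \<in> D" "b \<longlonglongrightarrow> y" using seq_D[of y] by blast
    have "(\<lambda>n. g (a n + b n)) \<longlonglongrightarrow> g (x + y)" by (intro lim tendsto_add a b)
    moreover have "(\<lambda>n. g (a n + b n)) = (\<lambda>n. g (a n) + g (b n))"
      using a(1) b(1) by (auto simp: g(2) add add_D)
    moreover have "(\<lambda>n. g (a n) + g (b n)) \<longlonglongrightarrow> g x + g y" by (intro lim tendsto_add a b)
    ultimately show ?thesis using LIMSEQ_unique by metis
  qed
  interpret additive g by (rule additive.intro) (rule gadd)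
  have gbd: "\<bar>g x\<bar> \<le> c * norm x" for x
    using lipschitz_onD[OF g(1), of x 0] by (simp add: zero dist_norm)
  have gscale: "g (r *\<^sub>R x) = r * g x" for r x
  proof -
    \<comment> \<open>The defect of homogeneity is additive and vanishes at integers, so it has
      period 1 and is bounded by its values on the unit interval. A bounded additive function is
      zero because \<open>\<psi> (n * r) = n * \<psi> r\<close>.\<close>
    define \<psi> where "\<psi> = (\<lambda>r. g (r *\<^sub>R x) - r * g x)"
    interpret \<psi>: additive \<psi>
      by (rule additive.intro) (simp add: \<psi>_def scaleR_add_left gadd ring_distribs)
    have nat: "\<psi> (real n * s) = real n * \<psi> s" for n s
      by (induction n) (auto simp: \<psi>.zero \<psi>.add ring_distribs)
    have "\<psi> 1 = 0" by (simp add: \<psi>_def)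
    then have natz: "\<psi> (real n) = 0" for n using nat[of n 1] by simp
    have intz: "\<psi> (real_of_int k) = 0" for k
    proof (cases "k \<ge> 0")
      case True then show ?thesis using natz[of "nat k"] by simp
    next
      case False then show ?thesis using natz[of "nat (- k)"] \<psi>.minus[of "real_of_int (- k)"] by simp
    qed
    define B where "B = 2 * c * norm x"
    have "\<bar>\<psi> s\<bar> \<le> B" for s
    proof -
      have "\<psi> s = \<psi> (frac s)" using \<psi>.add[of "frac s" "real_of_int \<lfloor>s\<rfloor>"] intz by (simp add: frac_def)
      also have "\<bar>\<psi> (frac s)\<bar> \<le> \<bar>g (frac s *\<^sub>R x)\<bar> + \<bar>frac s * g x\<bar>" unfolding \<psi>_def by simp
      also have "\<dots> \<le> \<bar>frac s\<bar> * (c * norm x) + \<bar>frac s\<bar> * (c * norm x)"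
        using gbd[of "frac s *\<^sub>R x"] mult_left_mono[OF gbd[of x], of "\<bar>frac s\<bar>"]
        by (intro add_mono) (auto simp: abs_mult mult.left_commute)
      also have "\<dots> \<le> 1 * (c * norm x) + 1 * (c * norm x)"
        using \<open>0 \<le> c\<close> frac_lt_1[of s] by (intro add_mono mult_right_mono) (auto simp: less_imp_le)
      finally show ?thesis unfolding B_def by simp
    qed
    then have bdn: "real n * \<bar>\<psi> r\<bar> \<le> B" for n
      using nat[of n r] by (metis abs_mult abs_of_nat)
    have "\<psi> r = 0"
    proof (rule ccontr)
      assume "\<psi> r \<noteq> 0"
      then obtain n where "B < real n * \<bar>\<psi> r\<bar>" using reals_Archimedean3[of "\<bar>\<psi> r\<bar>"] by auto
      then show False using bdn[of n] by simp
    qed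
    then show ?thesis by (simp add: \<psi>_def)
  qed
  have "bounded_linear g"
    by (rule bounded_linear_intro[of _ c]) (use gadd gscale gbd in \<open>auto simp: ac_simps\<close>)
  then have "blinfun_apply (Blinfun g) = g" by (rule bounded_linear_Blinfun_apply)
  then show ?thesis using g(2) gbd \<open>0 \<le> c\<close>
    by (intro exI[of _ "Blinfun g"]) (auto intro!: norm_blinfun_bound)
qed

end

text \<open>Norm convergence of the test points gives pointwise convergence of the values, and
  Fatou's lemma passes an L_1 bound to the limit. Dominated convergence would need an integrable
  majorant, and integrability at the limit point may be just what has to be shown.\<close>

lemma nn_integral_weak_star_fatou:
  fixes f :: "'t \<Rightarrow> 'x::real_normed_vector \<Rightarrow>\<^sub>L real"
  assumes "\<And>y. (\<lambda>t. blinfun_apply (f t) y) \<in> borel_measurable M"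
    and "y \<longlonglongrightarrow> x" and "c \<longlonglongrightarrow> C"
    and "\<And>n. (\<integral>\<^sup>+t. ennreal \<bar>blinfun_apply (f t) (y n)\<bar> \<partial>M) \<le> c n"
  shows "(\<integral>\<^sup>+t. ennreal \<bar>blinfun_apply (f t) x\<bar> \<partial>M) \<le> C"
proof -
  have "(\<integral>\<^sup>+t. ennreal \<bar>blinfun_apply (f t) x\<bar> \<partial>M) = (\<integral>\<^sup>+t. liminf (\<lambda>n. ennreal \<bar>blinfun_apply (f t) (y n)\<bar>) \<partial>M)"
  proof (rule nn_integral_cong)
    fix t
    have "(\<lambda>n. ennreal \<bar>blinfun_apply (f t) (y n)\<bar>) \<longlonglongrightarrow> ennreal \<bar>blinfun_apply (f t) x\<bar>"
      by (intro tendsto_ennrealI tendsto_rabs blinfun.tendsto tendsto_const assms)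
    then show "ennreal \<bar>blinfun_apply (f t) x\<bar> = liminf (\<lambda>n. ennreal \<bar>blinfun_apply (f t) (y n)\<bar>)"
      by (intro lim_imp_Liminf[symmetric]) auto
  qed
  also have "\<dots> \<le> liminf (\<lambda>n. \<integral>\<^sup>+t. ennreal \<bar>blinfun_apply (f t) (y n)\<bar> \<partial>M)"
    using assms(1) by (intro nn_integral_liminf) auto
  also have "\<dots> \<le> liminf c" by (intro Liminf_mono always_eventually allI assms(4))
  also have "\<dots> = C" using assms(3) by (simp add: lim_imp_Liminf)
  finally show ?thesis .
qed

text \<open>The closed graph theorem for \<open>x \<mapsto> f(\<cdot>)(x) \<in> L_1\<close>, by Baire's theorem.\<close>

lemma gelfand_integrable_bound:
  fixes f :: "'t \<Rightarrow> 'x::banach \<Rightarrow>\<^sub>L real"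
  assumes "gelfand_integrable M f"
  obtains C where "0 \<le> C" "\<And>x. (\<integral>t. \<bar>blinfun_apply (f t) x\<bar> \<partial>M) \<le> C * norm x"
proof -
  have int: "integrable M (\<lambda>t. blinfun_apply (f t) x)" for x
    using assms by (auto simp: gelfand_integrable_def)
  define L where "L x = (\<integral>t. \<bar>blinfun_apply (f t) x\<bar> \<partial>M)" for x
  have nnL: "(\<integral>\<^sup>+t. ennreal \<bar>blinfun_apply (f t) x\<bar> \<partial>M) = ennreal (L x)" for x
    unfolding L_def using int[of x] by (intro nn_integral_eq_integral) auto
  have L0: "0 \<le> L x" for x unfolding L_def by simp
  define A where "A n = {x. L x \<le> real n}" for n
  have clA: "closed (A n)" for n
    unfolding closed_sequential_limits
  proof (intro allI impI, elim conjE)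
    fix y x assume y: "\<forall>k. y k \<in> A n" "y \<longlonglongrightarrow> x"
    have "(\<integral>\<^sup>+t. ennreal \<bar>blinfun_apply (f t) x\<bar> \<partial>M) \<le> ennreal (real n)"
      by (rule nn_integral_weak_star_fatou[OF _ y(2) tendsto_const])
         (use y(1) int in \<open>auto simp: nnL A_def intro: ennreal_leI\<close>)
    then show "x \<in> A n" by (simp add: nnL A_def)
  qed
  have "\<exists>n. interior (A n) \<noteq> {}"
  proof (rule ccontr)
    assume "\<not> ?thesis"
    then have "Met_TC.mtopology interior_of \<Union>(range A) = {}"
      using clA by (intro Met_TC.metric_Baire_category_alt) (auto simp: complete_UNIV)
    moreover have "\<Union>(range A) = UNIV"
      using real_arch_simple by (auto simp: A_def)
    ultimately show False by simp
  qed
  then obtain n x0 where "x0 \<in> interior (A n)" by auto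
  then obtain r where r: "0 < r" "cball x0 r \<subseteq> A n" using mem_interior_cball by blast
  \<comment> \<open>A small \<open>y\<close> is the difference of two points of the ball around
    \<open>x0\<close>, which doubles the bound; homogeneity then leads to the constant
    \<open>2 * n / r\<close>.\<close>
  have small: "L y \<le> 2 * real n" if "norm y \<le> r" for y
  proof -
    have "x0 + y \<in> A n" "x0 \<in> A n" using r that by (auto simp: dist_norm)
    moreover have "L y \<le> L (x0 + y) + L x0"
    proof -
      have "L y \<le> (\<integral>t. \<bar>blinfun_apply (f t) (x0 + y)\<bar> + \<bar>blinfun_apply (f t) x0\<bar> \<partial>M)"
        unfolding L_def using int by (intro integral_mono) (auto simp: blinfun.add_right)
      then show ?thesis unfolding L_def using int by simp
    qed
    ultimately show ?thesis by (simp add: A_def)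
  qed
  have scale: "L (s *\<^sub>R x) = \<bar>s\<bar> * L x" for s x
    unfolding L_def by (simp add: blinfun.scaleR_right abs_mult)
  have "L x \<le> (2 * real n / r) * norm x" for x
  proof (cases "x = 0")
    case False
    define s where "s = r / norm x"
    have "0 < s" "norm (s *\<^sub>R x) \<le> r" using False r(1) by (auto simp: s_def)
    then have "s * L x \<le> 2 * real n" using small[of "s *\<^sub>R x"] scale[of s x] by simp
    then show ?thesis using \<open>0 < s\<close> False r(1) by (simp add: s_def field_simps)
  qed (simp add: L_def)
  then show ?thesis using that[of "2 * real n / r"] r(1) unfolding L_def by auto
qed

subsection \<open>Sets with prescribed conditional probability\<close>

locale prob_subalgebra = prob_space M for M :: "'t measure" +
  fixes F :: "'t measure"
  assumes subalg: "subalgebra M F"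
begin

sublocale sub: finite_measure_subalgebra M F
  by unfold_locales (rule subalg)

lemma space_F [simp]: "space F = space M" using subalg by (simp add: subalgebra_def)

lemma sets_F_M: "B \<in> sets F \<Longrightarrow> B \<in> sets M" using subalg by (auto simp: subalgebra_def)

text \<open>Domination by the probability yields continuity at the empty set, which upgrades finite
  to countable additivity, and it also yields absolute continuity. Radon-Nikodym on the restriction
  to \<open>F\<close> then gives an \<open>F\<close>-measurable density.\<close>

lemma dominated_additive_density:
  fixes \<nu> :: "'t set \<Rightarrow> real"
  assumes nonneg: "\<And>B. B \<in> sets F \<Longrightarrow> 0 \<le> \<nu> B"
    and add: "\<And>A B. A \<in> sets F \<Longrightarrow> B \<in> sets F \<Longrightarrow> A \<inter> B = {} \<Longrightarrow> \<nu> (A \<union> B) = \<nu> A + \<nu> B"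
    and le: "\<And>B. B \<in> sets F \<Longrightarrow> \<nu> B \<le> prob B"
  obtains r :: "'t \<Rightarrow> ennreal" where "r \<in> borel_measurable F"
    "\<And>B. B \<in> sets F \<Longrightarrow> ennreal (\<nu> B) = (\<integral>\<^sup>+t\<in>B. r t \<partial>M)"
proof -
  have \<nu>0: "\<nu> {} = 0" using add[of "{}" "{}"] by simp
  let ?\<mu> = "\<lambda>B. ennreal (\<nu> B)"
  have pos: "positive (sets F) ?\<mu>" using \<nu>0 by (simp add: positive_def)
  have "countably_additive (sets F) ?\<mu>"
  proof (rule sets.empty_continuous_imp_countably_additive[OF pos])
    show "additive (sets F) ?\<mu>" unfolding additive_def using add nonneg by simp
    fix A :: "nat \<Rightarrow> 't set"
    assume A: "range A \<subseteq> sets F" "decseq A" "(\<Inter>i. A i) = {}"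
    have "(\<lambda>i. prob (A i)) \<longlonglongrightarrow> prob (\<Inter>i. A i)"
      using A sets_F_M by (intro finite_Lim_measure_decseq) auto
    then have "(\<lambda>i. prob (A i)) \<longlonglongrightarrow> 0" using A(3) by simp
    moreover have "0 \<le> \<nu> (A i)" "\<nu> (A i) \<le> prob (A i)" for i using A(1) nonneg le by auto
    ultimately have "(\<lambda>i. \<nu> (A i)) \<longlonglongrightarrow> 0"
      using tendsto_sandwich[of "\<lambda>_. 0" "\<lambda>i. \<nu> (A i)" sequentially "\<lambda>i. prob (A i)" 0] by simp
    from tendsto_ennrealI[OF this] show "(\<lambda>i. ?\<mu> (A i)) \<longlonglongrightarrow> 0" by simp
  qed simp
  define N where "N = measure_of (space M) (sets F) ?\<mu>"
  have sets_N: "sets N = sets F" unfolding N_def using sets.sigma_sets_eq[of F] sets.space_closed[of F] by simp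
  have eN: "emeasure N B = ?\<mu> B" if "B \<in> sets F" for B
    using that pos \<open>countably_additive (sets F) ?\<mu>\<close> sets.sigma_algebra_axioms[of F] unfolding N_def space_F
    by (intro emeasure_measure_of_sigma)
  let ?R = "restr_to_subalg M F"
  interpret R: finite_measure ?R
    by (rule finite_measure_restr_to_subalg[OF subalg]) unfold_locales
  have "absolutely_continuous ?R N"
    unfolding absolutely_continuous_def
  proof
    fix B assume "B \<in> null_sets ?R"
    then have "B \<in> sets F" "prob B = 0"
      by (auto simp: null_sets_restr_to_subalg[OF subalg] measure_def)
    then show "B \<in> null_sets N" using le[of B] nonneg[of B] by (auto simp: null_sets_def sets_N eN)
  qed
  then have d: "density ?R (RN_deriv ?R N) = N"
    by (intro R.density_RN_deriv) (auto simp: sets_N sets_restr_to_subalg[OF subalg])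
  have m: "RN_deriv ?R N \<in> borel_measurable F" by (rule measurable_in_subalg'[OF subalg]) simp
  show ?thesis
  proof (rule that[OF m])
    fix B assume B: "B \<in> sets F"
    have "?\<mu> B = emeasure (density ?R (RN_deriv ?R N)) B" using B by (simp add: d eN)
    also have "\<dots> = (\<integral>\<^sup>+t\<in>B. RN_deriv ?R N t \<partial>?R)"
      using B by (intro emeasure_density) (auto simp: sets_restr_to_subalg[OF subalg])
    also have "\<dots> = (\<integral>\<^sup>+t\<in>B. RN_deriv ?R N t \<partial>M)"
      using B m by (intro nn_integral_subalgebra2[OF subalg]) auto
    finally show "?\<mu> B = (\<integral>\<^sup>+t\<in>B. RN_deriv ?R N t \<partial>M)" .
  qed
qed

end

section \<open>Splitting sets under nowhere equivalence\<close>

locale nowhere_equivalent_space = prob_subalgebra +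
  assumes nowhere: "nowhere_equivalent M F"
begin

text \<open>
  If \<open>D0 \<subseteq> D\<close> is not a trace on \<open>D\<close> of a set in \<open>F\<close> then taking \<open>D0\<close> where its conditional
  probability is at most half that of \<open>D\<close>, and \<open>D - D0\<close> elsewhere, gives a non-null set.
\<close>

lemma halving:
  assumes D: "D \<in> sets M" "0 < prob D"
  shows "\<exists>E\<in>sets M. E \<subseteq> D \<and> 0 < prob E \<and> (\<forall>B\<in>sets F. prob (E \<inter> B) \<le> prob (D \<inter> B) / 2)"
proof -
  have "0 < emeasure M D" using D(2) by (simp add: emeasure_eq_measure)
  with D(1) nowhere obtain D0 where D0: "D0 \<in> sets M" "D0 \<subseteq> D"
    "\<And>D1. D1 \<in> trace_sets F D \<Longrightarrow> 0 < emeasure M ((D0 - D1) \<union> (D1 - D0))"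
    unfolding nowhere_equivalent_def by metis
  define a where "a = real_cond_exp M F (indicator D0)"
  define b where "b = real_cond_exp M F (indicator D)"
  have meas [measurable]: "a \<in> borel_measurable F" "b \<in> borel_measurable F" by (auto simp: a_def b_def)
  have ia: "integrable M a" "integrable M b"
    unfolding a_def b_def using D D0 by (auto intro!: sub.real_cond_exp_int integrable_real_indicator simp: emeasure_eq_measure)
  have si: "set_integrable M S a" "set_integrable M S (\<lambda>t. b t / 2)" if "S \<in> sets M" for S
    using integrable_mult_indicator[OF that ia(1)] integrable_mult_indicator[OF that, of "\<lambda>t. b t / 2"] ia(2)
    by (auto simp: set_integrable_def)
  have int: "prob (S \<inter> B) = (\<integral>t\<in>B. real_cond_exp M F (indicator S) t \<partial>M)" if "S \<in> sets M" "B \<in> sets F" for S B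
  proof -
    have "prob (S \<inter> B) = (\<integral>t\<in>B. indicator S t \<partial>M)"
      using that sets_F_M[of B]
      by (simp add: set_lebesgue_integral_def indicator_inter_arith[of B S, symmetric] Int_commute)
    then show ?thesis using sub.real_cond_exp_intA[of "indicator S" B] that
      by (simp add: integrable_real_indicator emeasure_eq_measure)
  qed
  define B0 where "B0 = {t\<in>space F. a t \<le> b t / 2}"
  have B0: "B0 \<in> sets F" unfolding B0_def by measurable
  define E where "E = (D0 \<inter> B0) \<union> ((D - D0) - B0)"
  have [measurable]: "E \<in> sets M" unfolding E_def using D D0 sets_F_M[OF B0] by auto
  \<comment> \<open>\<open>E\<close> is the symmetric difference of \<open>D0\<close> and the trace
    on \<open>D\<close> of the complement of \<open>B0\<close>, so nowhere equivalence says that it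
    is not null.\<close>
  have Eeq: "E = (D0 - (D \<inter> (space F - B0))) \<union> ((D \<inter> (space F - B0)) - D0)"
    unfolding E_def using D0(2) sets.sets_into_space[OF D(1)] by auto
  have "D \<inter> (space F - B0) \<in> trace_sets F D" unfolding trace_sets_def using B0 by blast
  from D0(3)[OF this, folded Eeq] have "0 < prob E" by (simp add: emeasure_eq_measure)
  moreover have "prob (E \<inter> B) \<le> prob (D \<inter> B) / 2" if B: "B \<in> sets F" for B
  proof -
    have 1: "prob (D0 \<inter> (B \<inter> B0)) \<le> prob (D \<inter> (B \<inter> B0)) / 2"
    proof -
      have "(\<integral>t\<in>B \<inter> B0. a t \<partial>M) \<le> (\<integral>t\<in>B \<inter> B0. b t / 2 \<partial>M)"
        using sets_F_M[OF B] sets_F_M[OF B0]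
        by (intro set_integral_mono si sets.Int) (auto simp: B0_def)
      then show ?thesis using int[OF D0(1), of "B \<inter> B0"] int[OF D(1), of "B \<inter> B0"] B B0
        by (simp add: a_def b_def)
    qed
    have 2: "prob (D0 \<inter> (B - B0)) \<ge> prob (D \<inter> (B - B0)) / 2"
    proof -
      have "(\<integral>t\<in>B - B0. b t / 2 \<partial>M) \<le> (\<integral>t\<in>B - B0. a t \<partial>M)"
        using sets_F_M[OF B] sets_F_M[OF B0] sets.sets_into_space[OF B]
        by (intro set_integral_mono si sets.Diff) (auto simp: B0_def)
      then show ?thesis using int[OF D0(1), of "B - B0"] int[OF D(1), of "B - B0"] B B0
        by (simp add: a_def b_def)
    qed
    have "prob (E \<inter> B) \<le> prob (D0 \<inter> (B \<inter> B0)) + prob ((D - D0) \<inter> (B - B0))"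
    proof -
      have "E \<inter> B = (D0 \<inter> (B \<inter> B0)) \<union> ((D - D0) \<inter> (B - B0))" unfolding E_def by auto
      then show ?thesis using D D0 sets_F_M[OF B0] sets_F_M[OF B] by (simp add: measure_subadditive)
    qed
    also have "prob ((D - D0) \<inter> (B - B0)) = prob (D \<inter> (B - B0)) - prob (D0 \<inter> (B - B0))"
    proof -
      have "(D - D0) \<inter> (B - B0) = (D \<inter> (B - B0)) - (D0 \<inter> (B - B0))" by auto
      then show ?thesis using D D0 sets_F_M[OF B0] sets_F_M[OF B]
        by (simp, intro finite_measure_Diff) auto
    qed
    also have "prob (D \<inter> B) = prob (D \<inter> (B \<inter> B0)) + prob (D \<inter> (B - B0))"
    proof -
      have "D \<inter> B = (D \<inter> (B \<inter> B0)) \<union> (D \<inter> (B - B0))" by auto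
      then show ?thesis using D sets_F_M[OF B0] sets_F_M[OF B]
        by (simp, intro finite_measure_Union) auto
    qed
    then have "prob (D0 \<inter> (B \<inter> B0)) + (prob (D \<inter> (B - B0)) - prob (D0 \<inter> (B - B0))) \<le> prob (D \<inter> B) / 2"
      using 1 2 by linarith
    finally show ?thesis .
  qed
  moreover have "E \<subseteq> D" using D0(2) by (auto simp: E_def)
  ultimately show ?thesis using \<open>E \<in> sets M\<close> by blast
qed

text \<open>The factor can be made as small as desired, which allows a non-null set to fit under an
  arbitrarily small positive density.\<close>

lemma iterated_halving:
  assumes D: "D \<in> sets M" "0 < prob D"
  shows "\<exists>E\<in>sets M. E \<subseteq> D \<and> 0 < prob E \<and> (\<forall>B\<in>sets F. prob (E \<inter> B) \<le> prob (D \<inter> B) / 2 ^ n)"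
proof (induction n)
  case 0
  then show ?case using D by (intro bexI[of _ D]) auto
next
  case (Suc n)
  then obtain E where E: "E \<in> sets M" "E \<subseteq> D" "0 < prob E" "\<And>B. B \<in> sets F \<Longrightarrow> prob (E \<inter> B) \<le> prob (D \<inter> B) / 2 ^ n"
    by auto
  obtain E' where E': "E' \<in> sets M" "E' \<subseteq> E" "0 < prob E'" "\<And>B. B \<in> sets F \<Longrightarrow> prob (E' \<inter> B) \<le> prob (E \<inter> B) / 2"
    using halving[OF E(1,3)] by auto
  have "prob (E' \<inter> B) \<le> prob (D \<inter> B) / 2 ^ Suc n" if "B \<in> sets F" for B
  proof -
    have "prob (E' \<inter> B) \<le> prob (E \<inter> B) / 2" by (rule E'(4)[OF that])
    also have "\<dots> \<le> (prob (D \<inter> B) / 2 ^ n) / 2" using E(4)[OF that] by (rule divide_right_mono) simp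
    finally show ?thesis by (simp add: mult.commute)
  qed
  then show ?case using E E' by blast
qed

text \<open>By exhaustion: an increasing sequence that at each step comes within 1/(n+1) of the best
  possible extension has a union \<open>Amax\<close> that is maximal among the sets with conditional
  mass below \<open>\<nu>\<close>. If a deficit remained, some non-null part of
  \<open>D - Amax\<close> would fit under it and could be added.\<close>

lemma maharam:
  fixes \<nu> :: "'a set \<Rightarrow> real"
  assumes D: "D \<in> sets M"
    and nonneg: "\<And>B. B \<in> sets F \<Longrightarrow> 0 \<le> \<nu> B"
    and add: "\<And>A B. A \<in> sets F \<Longrightarrow> B \<in> sets F \<Longrightarrow> A \<inter> B = {} \<Longrightarrow> \<nu> (A \<union> B) = \<nu> A + \<nu> B"
    and le: "\<And>B. B \<in> sets F \<Longrightarrow> \<nu> B \<le> prob (D \<inter> B)"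
  shows "\<exists>A\<in>sets M. A \<subseteq> D \<and> (\<forall>B\<in>sets F. prob (A \<inter> B) = \<nu> B)"
proof -
  define \<A> where "\<A> = {A \<in> sets M. A \<subseteq> D \<and> (\<forall>B\<in>sets F. prob (A \<inter> B) \<le> \<nu> B)}"
  have "\<exists>A. \<forall>n. A n \<in> \<A> \<and> (A n \<subseteq> A (Suc n) \<and>
      (\<forall>A'\<in>\<A>. A n \<subseteq> A' \<longrightarrow> prob A' \<le> prob (A (Suc n)) + 1 / real (Suc n)))"
  proof (rule dependent_nat_choice)
    show "\<exists>x. x \<in> \<A>" using nonneg by (intro exI[of _ "{}"]) (auto simp: \<A>_def)
    fix A n assume A: "A \<in> \<A>"
    let ?S = "prob ` {A'\<in>\<A>. A \<subseteq> A'}"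
    have bdd: "bdd_above ?S" by (intro bdd_aboveI[of _ 1]) auto
    have "?S \<noteq> {}" using A by auto
    then obtain s where "s \<in> ?S" "Sup ?S - 1 / real (Suc n) < s"
      using less_cSup_iff[OF _ bdd, of "Sup ?S - 1 / real (Suc n)"] by auto
    then obtain A1 where A1: "A1 \<in> \<A>" "A \<subseteq> A1" "Sup ?S - 1 / real (Suc n) < prob A1" by auto
    have "prob A' \<le> prob A1 + 1 / real (Suc n)" if "A' \<in> \<A>" "A \<subseteq> A'" for A'
    proof -
      have "prob A' \<le> Sup ?S" using that bdd by (intro cSup_upper) auto
      then show ?thesis using A1(3) by linarith
    qed
    then show "\<exists>y. y \<in> \<A> \<and> A \<subseteq> y \<and> (\<forall>A'\<in>\<A>. A \<subseteq> A' \<longrightarrow> prob A' \<le> prob y + 1 / real (Suc n))"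
      using A1 by blast
  qed
  then obtain A where A: "\<And>n. A n \<in> \<A>" "\<And>n. A n \<subseteq> A (Suc n)"
    "\<And>n A'. A' \<in> \<A> \<Longrightarrow> A n \<subseteq> A' \<Longrightarrow> prob A' \<le> prob (A (Suc n)) + 1 / real (Suc n)" by metis
  define Amax where "Amax = (\<Union>n. A n)"
  have AM: "A n \<in> sets M" "A n \<subseteq> D" for n using A(1)[of n] by (auto simp: \<A>_def)
  have AmaxM [measurable]: "Amax \<in> sets M" unfolding Amax_def using AM by auto
  have AmaxD: "Amax \<subseteq> D" unfolding Amax_def using AM by auto
  have lim: "prob (Amax \<inter> B) \<le> \<nu> B" if B: "B \<in> sets F" for B
  proof -
    have "(\<lambda>n. prob (A n \<inter> B)) \<longlonglongrightarrow> prob (\<Union>n. A n \<inter> B)"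
      using AM sets_F_M[OF B] by (intro finite_Lim_measure_incseq incseq_SucI) (auto intro: A(2)[THEN subsetD])
    moreover have "(\<Union>n. A n \<inter> B) = Amax \<inter> B" by (auto simp: Amax_def)
    moreover have "prob (A n \<inter> B) \<le> \<nu> B" for n using A(1)[of n] B by (auto simp: \<A>_def)
    ultimately show ?thesis by (auto intro: LIMSEQ_le_const2)
  qed
  have maximal: "prob A' \<le> prob Amax" if A': "A' \<in> \<A>" "Amax \<subseteq> A'" for A'
  proof -
    have "prob A' \<le> prob Amax + 1 / real (Suc n)" for n
    proof -
      have "prob A' \<le> prob (A (Suc n)) + 1 / real (Suc n)" using A' by (intro A(3)) (auto simp: Amax_def)
      moreover have "prob (A (Suc n)) \<le> prob Amax"
        by (rule finite_measure_mono) (auto simp: Amax_def intro: AmaxM[unfolded Amax_def])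
      ultimately show ?thesis by simp
    qed
    moreover have "(\<lambda>n. prob Amax + 1 / real (Suc n)) \<longlonglongrightarrow> prob Amax + 0"
      by (intro tendsto_add tendsto_const LIMSEQ_Suc lim_1_over_n)
    ultimately show ?thesis by (auto intro: LIMSEQ_le_const)
  qed
  define \<rho> where "\<rho> B = \<nu> B - prob (Amax \<inter> B)" for B
  have \<rho>D: "\<rho> B \<le> prob ((D - Amax) \<inter> B)" if B: "B \<in> sets F" for B
  proof -
    have "prob ((D - Amax) \<inter> B) = prob (D \<inter> B - Amax \<inter> B)" by (rule arg_cong[of _ _ prob]) auto
    also have "\<dots> = prob (D \<inter> B) - prob (Amax \<inter> B)"
      using D sets_F_M[OF B] AmaxD by (intro finite_measure_Diff) auto
    finally show ?thesis using le[OF B] by (simp add: \<rho>_def)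
  qed
  obtain r where r [measurable]: "r \<in> borel_measurable F"
    and \<rho>r: "\<And>B. B \<in> sets F \<Longrightarrow> ennreal (\<rho> B) = (\<integral>\<^sup>+t\<in>B. r t \<partial>M)"
  proof (rule dominated_additive_density[of \<rho>])
    show "0 \<le> \<rho> B" if "B \<in> sets F" for B using lim[OF that] by (simp add: \<rho>_def)
    show "\<rho> (B \<union> C) = \<rho> B + \<rho> C" if "B \<in> sets F" "C \<in> sets F" "B \<inter> C = {}" for B C
    proof -
      have "prob (Amax \<inter> (B \<union> C)) = prob (Amax \<inter> B) + prob (Amax \<inter> C)"
        unfolding Int_Un_distrib using that sets_F_M by (intro finite_measure_Union) auto
      then show ?thesis using add[OF that] by (simp add: \<rho>_def)
    qed
    show "\<rho> B \<le> prob B" if "B \<in> sets F" for B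
      using \<rho>D[OF that] finite_measure_mono[of "(D - Amax) \<inter> B" B] sets_F_M[OF that] by auto
  qed blast
  have rM [measurable]: "r \<in> borel_measurable M" using measurable_from_subalg[OF subalg r] .
  have "\<rho> (space M) = 0"
  proof (rule ccontr)
    assume "\<rho> (space M) \<noteq> 0"
    then have "\<rho> (space M) > 0" using lim[of "space M"] sets.top[of F] by (simp add: \<rho>_def)
    \<comment> \<open>The levels are powers of 1/2 to match the factor that \<open>n\<close>
      halvings produce.\<close>
    define B where "B n = {t\<in>space F. ennreal (1 / 2 ^ n) \<le> r t}" for n
    have BF: "B n \<in> sets F" for n unfolding B_def by measurable
    have "\<exists>n. 0 < prob (B n)"
    proof (rule ccontr)
      assume "\<not> ?thesis"
      then have "prob (B n) = 0" for n by (simp add: not_less measure_le_0_iff)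
      then have "B n \<in> null_sets M" for n using sets_F_M[OF BF, of n] by (auto simp: emeasure_eq_measure)
      then have "AE t in M. t \<notin> B n" for n by (rule AE_not_in)
      then have "AE t in M. \<forall>n. t \<notin> B n" by (simp add: AE_all_countable)
      then have "AE t in M. r t = 0"
      proof (rule AE_mp, intro AE_I2 impI)
        fix t assume t: "t \<in> space M" "\<forall>n. t \<notin> B n"
        have "r t \<le> ennreal (1 / 2 ^ n)" for n using t by (simp add: B_def not_le less_imp_le)
        moreover have "(\<lambda>n. ennreal (1 / 2 ^ n)) \<longlonglongrightarrow> ennreal 0"
          using LIMSEQ_power_zero[of "1 / 2 :: real"] by (intro tendsto_ennrealI) (simp add: power_one_over)
        ultimately have "r t \<le> ennreal 0" by (intro LIMSEQ_le_const) blast+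
        then show "r t = 0" by simp
      qed
      then have "(\<integral>\<^sup>+t\<in>space M. r t \<partial>M) = 0"
        by (subst nn_integral_0_iff_AE) (auto elim: AE_mp)
      then show False using \<rho>r[of "space M"] \<open>\<rho> (space M) > 0\<close> sets.top[of F] by simp
    qed
    then obtain n where n: "0 < prob (B n)" by blast
    have ge: "prob (C \<inter> B n) / 2 ^ n \<le> \<rho> (C \<inter> B n)" if C: "C \<in> sets F" for C
    proof -
      have *: "C \<inter> B n \<in> sets F" using C BF by auto
      have "ennreal (prob (C \<inter> B n) / 2 ^ n) = (\<integral>\<^sup>+t\<in>C \<inter> B n. ennreal (1 / 2 ^ n) \<partial>M)"
        using sets_F_M[OF *] by (simp add: nn_integral_cmult_indicator emeasure_eq_measure flip: ennreal_mult)
      also have "\<dots> \<le> (\<integral>\<^sup>+t\<in>C \<inter> B n. r t \<partial>M)"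
        by (intro nn_integral_mono) (auto simp: B_def indicator_def)
      also have "\<dots> = ennreal (\<rho> (C \<inter> B n))" using \<rho>r[OF *] by simp
      finally show ?thesis using lim[OF *] by (subst (asm) ennreal_le_iff) (auto simp: \<rho>_def)
    qed
    have "0 < prob (B n) / 2 ^ n" using n by simp
    also have "\<dots> \<le> \<rho> (B n)" using ge[of "space M"] sets.top[of F] sets.sets_into_space[OF BF, of n]
      by (simp add: Int_absorb1)
    \<comment> \<open>The deficit never exceeds the room left in \<open>D\<close>, so
      \<open>D - Amax\<close> has a non-null part inside \<open>B n\<close> that can be halved
      \<open>n\<close> times.\<close>
    also have "\<dots> \<le> prob ((D - Amax) \<inter> B n)" by (rule \<rho>D[OF BF])
    finally obtain E where E: "E \<in> sets M" "E \<subseteq> (D - Amax) \<inter> B n" "0 < prob E"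
        "\<And>C. C \<in> sets F \<Longrightarrow> prob (E \<inter> C) \<le> prob ((D - Amax) \<inter> B n \<inter> C) / 2 ^ n"
      using iterated_halving[of "(D - Amax) \<inter> B n" n] D sets_F_M[OF BF] by auto
    have disj: "prob ((Amax \<union> E) \<inter> C) = prob (Amax \<inter> C) + prob (E \<inter> C)" if "C \<in> sets M" for C
      unfolding Int_Un_distrib2 using that E by (intro finite_measure_Union) auto
    have "Amax \<union> E \<in> \<A>"
      unfolding \<A>_def
    proof (intro CollectI conjI ballI)
      fix C assume C: "C \<in> sets F"
      have "prob (E \<inter> C) \<le> prob ((D - Amax) \<inter> B n \<inter> C) / 2 ^ n" by (rule E(4)[OF C])
      also have "\<dots> \<le> prob (C \<inter> B n) / 2 ^ n"
        using sets_F_M[OF C] sets_F_M[OF BF] by (intro divide_right_mono finite_measure_mono) auto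
      also have "\<dots> \<le> \<rho> (C \<inter> B n)" by (rule ge[OF C])
      also have "ennreal \<dots> \<le> ennreal (\<rho> C)"
        using \<rho>r[OF C] \<rho>r[of "C \<inter> B n"] C BF
        by (auto intro!: nn_integral_mono simp: indicator_def)
      then have "\<rho> (C \<inter> B n) \<le> \<rho> C" using lim[OF C] by (subst (asm) ennreal_le_iff) (auto simp: \<rho>_def)
      finally show "prob ((Amax \<union> E) \<inter> C) \<le> \<nu> C" using disj[OF sets_F_M[OF C]] by (simp add: \<rho>_def)
    qed (use E AmaxD in auto)
    then have "prob (Amax \<union> E) \<le> prob Amax" by (rule maximal) auto
    moreover have "prob (Amax \<union> E) = prob Amax + prob E"
      using E by (intro finite_measure_Union) auto
    ultimately show False using E(3) by simp
  qed
  have "prob (Amax \<inter> B) = \<nu> B" if B: "B \<in> sets F" for B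
  proof -
    have "ennreal (\<rho> B) \<le> ennreal (\<rho> (space M))"
      using \<rho>r[OF B] \<rho>r[of "space M"] sets.top[of F] by (auto intro!: nn_integral_mono simp: indicator_def)
    then have "\<rho> B \<le> 0" using \<open>\<rho> (space M) = 0\<close> by (simp add: ennreal_eq_0_iff)
    then show ?thesis using lim[OF B] by (simp add: \<rho>_def)
  qed
  then show ?thesis using AmaxD AmaxM by blast
qed

end

subsection \<open>Trees of sets\<close>

text \<open>A path is stored with its latest turn at the head: \<open>b # s\<close> is a child of
  \<open>s\<close>. The sets at any fixed depth partition the space.\<close>

definition set_tree :: "'t measure \<Rightarrow> (bool list \<Rightarrow> 't set) \<Rightarrow> bool" where
  "set_tree N A \<longleftrightarrow> A [] = space N \<and> (\<forall>s. A s \<in> sets N) \<and>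
     (\<forall>s. A (True # s) \<union> A (False # s) = A s \<and> A (True # s) \<inter> A (False # s) = {})"

text \<open>The event that the test at depth \<open>n\<close> is answered \<open>True\<close>,
  whatever the earlier answers. It recovers a single half-space from the tree.\<close>

definition left_part :: "(bool list \<Rightarrow> 't set) \<Rightarrow> nat \<Rightarrow> 't set" where
  "left_part A n = (\<Union>s\<in>{s. length s = n}. A (True # s))"

lemma finite_bool_lists: "finite {s :: bool list. length s = n}"
  using finite_lists_length_eq[of "UNIV :: bool set" n] by simp

lemma set_tree_sets: "set_tree N A \<Longrightarrow> A s \<in> sets N"
  by (simp add: set_tree_def)

lemma set_tree_Cons_iff: "set_tree N A \<Longrightarrow> t \<in> A s \<longleftrightarrow> t \<in> A (True # s) \<or> t \<in> A (False # s)"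
  by (auto simp: set_tree_def)

lemma set_tree_ConsD: "set_tree N A \<Longrightarrow> t \<in> A (b # s) \<Longrightarrow> t \<in> A s"
  using set_tree_Cons_iff[of N A t s] by (cases b) auto

lemma set_tree_disjoint: "set_tree N A \<Longrightarrow> t \<in> A (b # s) \<Longrightarrow> t \<in> A (c # s) \<Longrightarrow> b = c"
  by (cases b; cases c) (auto simp: set_tree_def disjoint_iff)

lemma set_tree_unique:
  assumes "set_tree N A"
  shows "t \<in> A s \<Longrightarrow> t \<in> A s' \<Longrightarrow> length s = length s' \<Longrightarrow> s = s'"
proof (induction s arbitrary: s')
  case (Cons b s)
  then obtain c s1 where s': "s' = c # s1" by (cases s') auto
  have "s = s1"
    using Cons.prems set_tree_ConsD[OF assms] by (intro Cons.IH) (auto simp: s')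
  then show ?case using Cons.prems set_tree_disjoint[OF assms] by (auto simp: s')
qed simp

lemma set_tree_ex:
  assumes "set_tree N A" "t \<in> space N"
  shows "\<exists>s. length s = n \<and> t \<in> A s"
proof (induction n)
  case 0
  then show ?case using assms by (auto simp: set_tree_def)
next
  case (Suc n)
  then obtain s where "length s = n" "t \<in> A s" by auto
  from this(2) have "t \<in> A (True # s) \<or> t \<in> A (False # s)" using set_tree_Cons_iff[OF assms(1)] by blast
  then show ?case using \<open>length s = n\<close> by (auto intro: exI[of _ "True # s"] exI[of _ "False # s"])
qed

lemma left_part_iff:
  assumes "set_tree N A" "t \<in> A (b # s)"
  shows "t \<in> left_part A (length s) \<longleftrightarrow> b"
proof
  assume "t \<in> left_part A (length s)"
  then obtain s' where s': "length s' = length s" "t \<in> A (True # s')" by (auto simp: left_part_def)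
  then have "True # s' = b # s" using set_tree_unique[OF assms(1) s'(2) assms(2)] by simp
  then show b by simp
qed (use assms(2) in \<open>auto simp: left_part_def\<close>)

lemma left_part_sets: "set_tree N A \<Longrightarrow> left_part A n \<in> sets N"
  unfolding left_part_def using finite_bool_lists set_tree_sets by (intro sets.finite_UN) auto

lemma measure_left_part:
  assumes "set_tree N A" "finite_measure N" "B \<in> sets N"
  shows "measure N (left_part A n \<inter> B) = (\<Sum>s | length s = n. measure N (A (True # s) \<inter> B))"
proof -
  interpret finite_measure N by fact
  have "left_part A n \<inter> B = (\<Union>s\<in>{s. length s = n}. A (True # s) \<inter> B)" by (auto simp: left_part_def)
  also have "measure N \<dots> = (\<Sum>s | length s = n. measure N (A (True # s) \<inter> B))"
  proof (rule finite_measure_finite_Union[OF finite_bool_lists])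
    show "disjoint_family_on (\<lambda>s. A (True # s) \<inter> B) {s. length s = n}"
      unfolding disjoint_family_on_def using set_tree_unique[OF assms(1)] by fastforce
  qed (use assms set_tree_sets in auto)
  finally show ?thesis .
qed

context threshold_enumeration
begin

text \<open>On reaching \<open>s\<close>, \<open>length s\<close> tests have been made, so this
  number is the index of the next half-space. Both halves are closed and overlap where the value
  equals the threshold.\<close>

primrec tbox :: "bool list \<Rightarrow> ('x \<Rightarrow>\<^sub>L real) set" where
  "tbox [] = UNIV"
| "tbox (b # s) = tbox s \<inter>
     (if b then {\<xi>. blinfun_apply \<xi> (fst (e (length s))) \<le> snd (e (length s))}
      else {\<xi>. snd (e (length s)) \<le> blinfun_apply \<xi> (fst (e (length s)))})"

text \<open>Here ties go to the \<open>True\<close> side, so siblings are disjoint.\<close>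

primrec tcell :: "bool list \<Rightarrow> ('x \<Rightarrow>\<^sub>L real) set" where
  "tcell [] = UNIV"
| "tcell (b # s) = tcell s \<inter>
     (if b then {\<xi>. blinfun_apply \<xi> (fst (e (length s))) \<le> snd (e (length s))}
      else {\<xi>. snd (e (length s)) < blinfun_apply \<xi> (fst (e (length s)))})"

lemma closedin_tbox: "closedin weak_star (tbox s)"
proof (induction s)
  case Nil
  then show ?case using closedin_topspace[of weak_star] by (simp add: strong_operator_topology_topspace)
next
  case (Cons b s)
  then show ?case by (auto intro!: closedin_Int closedin_weak_star_le closedin_weak_star_ge)
qed

lemma tcell_subset_tbox: "tcell s \<subseteq> tbox s"
  by (induction s) (auto split: if_splits)

lemma tbox_Cons_Un: "tbox s = tbox (True # s) \<union> tbox (False # s)"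
  by auto

lemma threshold_index:
  assumes "d \<in> D" "q \<in> \<rat>"
  obtains n where "e n = (d, q)"
  using range_e assms by (metis (no_types, lifting) SigmaI imageE)

lemma tcell_set_tree:
  assumes f: "f \<in> measurable N weak_star_borel"
  shows "set_tree N (\<lambda>s. f -` tcell s \<inter> space N)"
proof -
  have [measurable]: "(\<lambda>t. blinfun_apply (f t) x) \<in> borel_measurable N" for x
    by (rule measurable_apply_weak_star[OF f])
  have "f -` tcell s \<inter> space N \<in> sets N" for s
  proof (induction s)
    case (Cons b s)
    have "f -` tcell (b # s) \<inter> space N = (f -` tcell s \<inter> space N) \<inter>
       (if b then {t\<in>space N. blinfun_apply (f t) (fst (e (length s))) \<le> snd (e (length s))}
        else {t\<in>space N. snd (e (length s)) < blinfun_apply (f t) (fst (e (length s)))})"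
      by auto
    also have "\<dots> \<in> sets N" by (rule sets.Int[OF Cons.IH]) auto
    finally show ?case .
  qed simp
  then show ?thesis unfolding set_tree_def by (auto simp: not_le)
qed

text \<open>The weak and the strict inequality cannot be merged into an equivalence: a value equal
  to the threshold lies in both sibling boxes, and the tree may send it either way.\<close>

lemma tbox_left_part:
  assumes A: "set_tree N A" and t: "t \<in> space N" and \<xi>: "\<And>s. t \<in> A s \<Longrightarrow> \<xi> \<in> tbox s"
    and n: "e n = (d, q)"
  shows "t \<in> left_part A n \<Longrightarrow> blinfun_apply \<xi> d \<le> q"
    and "blinfun_apply \<xi> d < q \<Longrightarrow> t \<in> left_part A n"
proof -
  obtain s' where "length s' = Suc n" "t \<in> A s'" using set_tree_ex[OF A t] by blast
  then obtain b s where s: "length s = n" "t \<in> A (b # s)" by (cases s') auto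
  have "t \<in> left_part A n \<longleftrightarrow> b" using left_part_iff[OF A s(2)] s(1) by simp
  moreover have "\<xi> \<in> tbox (b # s)" using \<xi> s(2) .
  ultimately show "t \<in> left_part A n \<Longrightarrow> blinfun_apply \<xi> d \<le> q"
    "blinfun_apply \<xi> d < q \<Longrightarrow> t \<in> left_part A n" using s(1) n by (auto split: if_splits)
qed

text \<open>The boxes along the branch of \<open>t\<close> decrease and each meets the weak* compact
  value, so some point lies in all of them. Choosing that point pointwise causes no measurability
  problem: its values on \<open>D\<close> are read off from the tree through
  \<open>left_part\<close>.\<close>

lemma tree_selection:
  fixes \<Phi> :: "'t \<Rightarrow> ('x \<Rightarrow>\<^sub>L real) set"
  assumes A: "set_tree N A"
    and ne: "AE t in N. \<forall>s. t \<in> A s \<longrightarrow> \<Phi> t \<inter> tbox s \<noteq> {}"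
    and cpt: "AE t in N. compactin weak_star (\<Phi> t)"
  shows "\<exists>f\<in>measurable N weak_star_borel. (AE t in N. f t \<in> \<Phi> t) \<and> (AE t in N. \<forall>s. t \<in> A s \<longrightarrow> f t \<in> tbox s)"
proof -
  have ptw: "\<exists>\<xi>\<in>\<Phi> t. \<forall>s. t \<in> A s \<longrightarrow> \<xi> \<in> tbox s"
    if ne: "\<forall>s. t \<in> A s \<longrightarrow> \<Phi> t \<inter> tbox s \<noteq> {}" and cpt: "compactin weak_star (\<Phi> t)" and t: "t \<in> space N" for t
  proof -
    have mono: "tbox s \<subseteq> tbox s'" if "t \<in> A s" "t \<in> A s'" "length s' \<le> length s" for s s'
      using that
    proof (induction s)
      case (Cons b s)
      show ?case
      proof (cases "length s' = length (b # s)")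
        case True
        then have "s' = b # s" using Cons.prems by (intro set_tree_unique[OF A, of t]) auto
        then show ?thesis by simp
      next
        case False
        then have "tbox s \<subseteq> tbox s'" using Cons.prems set_tree_ConsD[OF A, of t b s] by (intro Cons.IH) auto
        then show ?thesis by auto
      qed
    qed auto
    \<comment> \<open>The finite intersection property is reduced to a single box: among finitely
      many nodes on one branch the deepest has the smallest box.\<close>
    have fin: "\<exists>s0. t \<in> A s0 \<and> (\<forall>X\<in>\<F>. tbox s0 \<subseteq> X)" if "finite \<F>" "\<F> \<subseteq> {tbox s | s. t \<in> A s}" for \<F>
      using that
    proof (induction rule: finite_induct)
      case empty
      then show ?case using A t by (auto simp: set_tree_def intro!: exI[of _ "[]"])
    next
      case (insert X \<F>)
      then obtain s0 where s0: "t \<in> A s0" "\<forall>X\<in>\<F>. tbox s0 \<subseteq> X" by auto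
      from insert obtain s1 where s1: "t \<in> A s1" "X = tbox s1" by auto
      show ?case
      proof (cases "length s0 \<le> length s1")
        case True
        then show ?thesis using s0 s1 mono[of s1 s0] by (intro exI[of _ s1]) auto
      next
        case False
        then show ?thesis using s0 s1 mono[of s0 s1] by (intro exI[of _ s0]) auto
      qed
    qed
    have "\<Phi> t \<inter> \<Inter>{tbox s | s. t \<in> A s} \<noteq> {}"
    proof -
      have "\<Phi> t \<inter> \<Inter>\<F> \<noteq> {}" if F: "finite \<F>" "\<F> \<subseteq> {tbox s | s. t \<in> A s}" for \<F>
      proof -
        obtain s0 where "t \<in> A s0" "\<forall>X\<in>\<F>. tbox s0 \<subseteq> X" using fin[OF F] by auto
        then show ?thesis using ne by blast
      qed
      moreover have "\<forall>C\<in>{tbox s | s. t \<in> A s}. closedin weak_star C" using closedin_tbox by blast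
      ultimately show ?thesis
        using cpt[unfolded compactin_fip, THEN conjunct2, rule_format, of "{tbox s | s. t \<in> A s}"] by blast
    qed
    then show ?thesis by blast
  qed
  have "AE t in N. \<exists>\<xi>\<in>\<Phi> t. \<forall>s. t \<in> A s \<longrightarrow> \<xi> \<in> tbox s"
    using ne cpt AE_space by eventually_elim (rule ptw)
  then obtain Z where Z: "\<And>t. t \<in> space N - Z \<Longrightarrow> \<exists>\<xi>\<in>\<Phi> t. \<forall>s. t \<in> A s \<longrightarrow> \<xi> \<in> tbox s"
    "Z \<in> null_sets N"
    by (rule AE_E3) (rule that)
  define f where "f t = (if t \<in> Z then 0 else SOME \<xi>. \<xi> \<in> \<Phi> t \<and> (\<forall>s. t \<in> A s \<longrightarrow> \<xi> \<in> tbox s))" for t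
  have f: "f t \<in> \<Phi> t" "\<And>s. t \<in> A s \<Longrightarrow> f t \<in> tbox s" if "t \<in> space N - Z" for t
  proof -
    have "\<exists>\<xi>. \<xi> \<in> \<Phi> t \<and> (\<forall>s. t \<in> A s \<longrightarrow> \<xi> \<in> tbox s)" using Z(1)[OF that] by blast
    from someI_ex[OF this] that show "f t \<in> \<Phi> t" "\<And>s. t \<in> A s \<Longrightarrow> f t \<in> tbox s"
      by (auto simp: f_def)
  qed
  have "f \<in> measurable N weak_star_borel"
  proof (rule measurable_weak_starI)
    fix d assume d: "d \<in> D"
    show "(\<lambda>t. blinfun_apply (f t) d) \<in> borel_measurable N"
      unfolding borel_measurable_iff_less
    proof
      fix a :: real
      let ?I = "{n. fst (e n) = d \<and> snd (e n) < a}"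
      \<comment> \<open>On the null set \<open>Z\<close> the value is 0, which lies below
        \<open>a\<close> exactly if \<open>0 < a\<close>. Elsewhere a rational threshold strictly
        between the value and \<open>a\<close> makes ties harmless.\<close>
      have "{t\<in>space N. blinfun_apply (f t) d < a} =
          ((\<Union>n\<in>?I. left_part A n) - Z) \<union> (if 0 < a then Z \<inter> space N else {})"
      proof (intro set_eqI)
        fix t
        show "t \<in> {t\<in>space N. blinfun_apply (f t) d < a} \<longleftrightarrow>
            t \<in> ((\<Union>n\<in>?I. left_part A n) - Z) \<union> (if 0 < a then Z \<inter> space N else {})"
        proof (cases "t \<in> space N - Z")
          case True
          then have "t \<in> space N" by simp
          note L = tbox_left_part[OF A this f(2)[OF True]]
          have "blinfun_apply (f t) d < a" if "n \<in> ?I" "t \<in> left_part A n" for n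
            using L(1)[of n d "snd (e n)"] that True by (force simp: prod_eq_iff)
          moreover have "\<exists>n\<in>?I. t \<in> left_part A n" if a: "blinfun_apply (f t) d < a"
          proof -
            obtain q where q: "q \<in> \<rat>" "blinfun_apply (f t) d < q" "q < a" using Rats_dense_in_real[OF a] by blast
            obtain n where "e n = (d, q)" by (rule threshold_index[OF d q(1)])
            then show ?thesis using L(2)[of n d q] q True by (intro bexI[of _ n]) auto
          qed
          ultimately show ?thesis using True by auto
        next
          case False
          moreover have "left_part A n \<subseteq> space N" for n using sets.sets_into_space[OF left_part_sets[OF A]] .
          ultimately show ?thesis by (auto simp: f_def)
        qed
      qed
      also have "\<dots> \<in> sets N" using Z(2) left_part_sets[OF A] by auto
      finally show "{t\<in>space N. blinfun_apply (f t) d < a} \<in> sets N" .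
    qed
  qed
  moreover have "AE t in N. f t \<in> \<Phi> t" "AE t in N. \<forall>s. t \<in> A s \<longrightarrow> f t \<in> tbox s"
    using AE_not_in[OF Z(2)] AE_space by (eventually_elim, use f in blast)+
  ultimately show ?thesis by blast
qed

end

subsection \<open>Weights on the tree of boxes\<close>

locale weighted_tree = prob_subalgebra M F + threshold_enumeration D e
  for M F :: "'t measure" and D :: "'x::{banach, second_countable_topology} set" and e
begin

text \<open>
  \<open>m (s, B)\<close> is the mass that a conditional law given \<open>F\<close>, integrated over \<open>B \<in> F\<close>, gives to
  the box \<open>s\<close>; it plays the role of a Young measure carried by the correspondence.
\<close>

definition weights :: "('t \<Rightarrow> ('x \<Rightarrow>\<^sub>L real) set) \<Rightarrow> (bool list \<times> 't set \<Rightarrow> real) set" where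
  "weights \<Phi> = {m.
     (\<forall>s B. 0 \<le> m (s, B)) \<and>
     (\<forall>s B. B \<notin> sets F \<longrightarrow> m (s, B) = 0) \<and>
     (\<forall>B. B \<in> sets F \<longrightarrow> m ([], B) = prob B) \<and>
     (\<forall>s B. m (s, B) = m (True # s, B) + m (False # s, B)) \<and>
     (\<forall>s A B. A \<in> sets F \<longrightarrow> B \<in> sets F \<longrightarrow> A \<inter> B = {} \<longrightarrow> m (s, A \<union> B) = m (s, A) + m (s, B)) \<and>
     (\<forall>s B. B \<in> sets F \<longrightarrow> B \<subseteq> {t. \<Phi> t \<inter> tbox s = {}} \<longrightarrow> m (s, B) = 0)}"

text \<open>Any tree with the right masses is accepted, not only the one cut out by
  \<open>tcell\<close>: splitting by conditional probabilities controls masses and closed boxes but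
  not the treatment of ties.\<close>

definition realizes :: "('t \<Rightarrow> 'x \<Rightarrow>\<^sub>L real) \<Rightarrow> (bool list \<times> 't set \<Rightarrow> real) \<Rightarrow> bool" where
  "realizes f m \<longleftrightarrow> (\<exists>A. set_tree M A \<and> (AE t in M. \<forall>s. t \<in> A s \<longrightarrow> f t \<in> tbox s) \<and>
     (\<forall>s B. B \<in> sets F \<longrightarrow> m (s, B) = prob (A s \<inter> B)))"

lemma weightsD:
  assumes "m \<in> weights \<Phi>"
  shows "0 \<le> m (s, B)" "B \<notin> sets F \<Longrightarrow> m (s, B) = 0" "B \<in> sets F \<Longrightarrow> m ([], B) = prob B"
    "m (s, B) = m (True # s, B) + m (False # s, B)"
    "A \<in> sets F \<Longrightarrow> B \<in> sets F \<Longrightarrow> A \<inter> B = {} \<Longrightarrow> m (s, A \<union> B) = m (s, A) + m (s, B)"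
    "B \<in> sets F \<Longrightarrow> B \<subseteq> {t. \<Phi> t \<inter> tbox s = {}} \<Longrightarrow> m (s, B) = 0"
proof -
  note h1 = assms[unfolded weights_def mem_Collect_eq]
  note h2 = conjunct2[OF h1] note h3 = conjunct2[OF h2] note h4 = conjunct2[OF h3]
  note h5 = conjunct2[OF h4] note h6 = conjunct2[OF h5]
  show "0 \<le> m (s, B)" by (rule conjunct1[OF h1, rule_format])
  show "B \<notin> sets F \<Longrightarrow> m (s, B) = 0" by (rule conjunct1[OF h2, rule_format])
  show "B \<in> sets F \<Longrightarrow> m ([], B) = prob B" by (rule conjunct1[OF h3, rule_format])
  show "m (s, B) = m (True # s, B) + m (False # s, B)" by (rule conjunct1[OF h4, rule_format])
  show "A \<in> sets F \<Longrightarrow> B \<in> sets F \<Longrightarrow> A \<inter> B = {} \<Longrightarrow> m (s, A \<union> B) = m (s, A) + m (s, B)"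
    by (rule conjunct1[OF h5, rule_format])
  show "B \<in> sets F \<Longrightarrow> B \<subseteq> {t. \<Phi> t \<inter> tbox s = {}} \<Longrightarrow> m (s, B) = 0"
    by (rule h6[rule_format])
qed

lemma weightsI:
  assumes "\<And>s B. 0 \<le> m (s, B)" "\<And>s B. B \<notin> sets F \<Longrightarrow> m (s, B) = 0" "\<And>B. B \<in> sets F \<Longrightarrow> m ([], B) = prob B"
    "\<And>s B. m (s, B) = m (True # s, B) + m (False # s, B)"
    "\<And>s A B. A \<in> sets F \<Longrightarrow> B \<in> sets F \<Longrightarrow> A \<inter> B = {} \<Longrightarrow> m (s, A \<union> B) = m (s, A) + m (s, B)"
    "\<And>s B. B \<in> sets F \<Longrightarrow> B \<subseteq> {t. \<Phi> t \<inter> tbox s = {}} \<Longrightarrow> m (s, B) = 0"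
  shows "m \<in> weights \<Phi>"
  unfolding weights_def mem_Collect_eq by (intro conjI allI impI; fact assms)

lemma weights_Cons_le:
  assumes "m \<in> weights \<Phi>"
  shows "m (b # s, B) \<le> m (s, B)"
  using weightsD(4)[OF assms, of s B] weightsD(1)[OF assms, of "True # s" B]
    weightsD(1)[OF assms, of "False # s" B] by (cases b) auto

lemma weights_le_prob:
  assumes "m \<in> weights \<Phi>" "B \<in> sets F"
  shows "m (s, B) \<le> prob B"
proof (induction s)
  case Nil
  then show ?case using weightsD(3)[OF assms] by simp
next
  case (Cons b s)
  then show ?case using weights_Cons_le[OF assms(1), of b s B] by simp
qed

lemma convex_weights:
  assumes "m1 \<in> weights \<Phi>" "m2 \<in> weights \<Phi>" "0 \<le> u" "0 \<le> v" "u + v = 1"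
  shows "(\<lambda>p. u * m1 p + v * m2 p) \<in> weights \<Phi>"
proof -
  note D1 = weightsD[OF assms(1)] and D2 = weightsD[OF assms(2)]
  show ?thesis
  proof (rule weightsI)
    show "u * m1 ([], B) + v * m2 ([], B) = prob B" if "B \<in> sets F" for B
      using D1(3)[OF that] D2(3)[OF that] assms(5) by (simp flip: ring_distribs)
    show "u * m1 (s, B) + v * m2 (s, B) =
      (u * m1 (True # s, B) + v * m2 (True # s, B)) + (u * m1 (False # s, B) + v * m2 (False # s, B))" for s B
      unfolding D1(4)[of s B] D2(4)[of s B] by (simp add: ring_distribs)
    show "u * m1 (s, A \<union> B) + v * m2 (s, A \<union> B) = (u * m1 (s, A) + v * m2 (s, A)) + (u * m1 (s, B) + v * m2 (s, B))"
      if "A \<in> sets F" "B \<in> sets F" "A \<inter> B = {}" for s A B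
      unfolding D1(5)[OF that] D2(5)[OF that] by (simp add: ring_distribs)
  qed (use assms(3,4) D1(1,2,6) D2(1,2,6) in auto)
qed

text \<open>Each clause is an equation or inequality between finitely many coordinates, under side
  conditions that do not involve \<open>m\<close>.\<close>

lemma closed_weights: "closed (weights \<Phi>)"
proof -
  have [continuous_intros]: "continuous_on UNIV (\<lambda>m :: bool list \<times> 't set \<Rightarrow> real. m p)" for p
    by (rule continuous_on_product_coordinates)
  show ?thesis
    unfolding weights_def
    by (intro closed_Collect_conj closed_Collect_all closed_Collect_imp open_Collect_const
        closed_Collect_eq closed_Collect_le continuous_intros)
qed

lemma compact_weights: "compact (weights \<Phi>)"
proof -
  have "compactin (product_topology (\<lambda>_. euclideanreal) UNIV) (PiE (UNIV :: (bool list \<times> 't set) set) (\<lambda>_. {0..1}))"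
    by (subst compactin_PiE) auto
  then have "compact (PiE (UNIV :: (bool list \<times> 't set) set) (\<lambda>_. {0..1::real}))"
    by (simp add: euclidean_product_topology)
  moreover have "weights \<Phi> \<subseteq> PiE UNIV (\<lambda>_. {0..1})"
  proof
    fix m assume m: "m \<in> weights \<Phi>"
    have "m p \<in> {0..1}" for p
    proof -
      obtain s B where p: "p = (s, B)" by (cases p)
      show ?thesis
      proof (cases "B \<in> sets F")
        case True
        then show ?thesis using weightsD(1)[OF m, of s B] weights_le_prob[OF m True, of s] prob_le_1[of B] p
          by (auto intro: order_trans)
      next
        case False
        then show ?thesis using weightsD(2)[OF m False] p by simp
      qed
    qed
    then show "m \<in> PiE UNIV (\<lambda>_. {0..1})" by auto
  qed
  ultimately show ?thesis using compact_Int_closed[OF _ closed_weights] by (metis Int_absorb1)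
qed

lemma measurable_correspondence_box:
  assumes "measurable_correspondence F \<Phi>"
  shows "{t\<in>space M. \<Phi> t \<inter> tbox s \<noteq> {}} \<in> sets F" "{t\<in>space M. \<Phi> t \<inter> tbox s = {}} \<in> sets F"
proof -
  show 1: "{t\<in>space M. \<Phi> t \<inter> tbox s \<noteq> {}} \<in> sets F"
    by (rule assms[unfolded measurable_correspondence_def space_F, rule_format, OF closedin_tbox])
  have "{t\<in>space M. \<Phi> t \<inter> tbox s = {}} = space F - {t\<in>space M. \<Phi> t \<inter> tbox s \<noteq> {}}" by auto
  then show "{t\<in>space M. \<Phi> t \<inter> tbox s = {}} \<in> sets F" using sets.compl_sets[OF 1] by (simp only:)
qed

text \<open>\<open>B\<close> is split by the event that \<open>\<Phi>\<close> misses the box. On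
  that event the mass vanishes by the support clause for \<open>\<Phi>\<close>; on the rest
  \<open>\<Phi>\<close> meets the box while \<open>\<Gamma>\<close> does not, which has probability
  0.\<close>

lemma weights_mono:
  assumes sub: "AE t in M. \<Phi> t \<subseteq> \<Gamma> t" and meas: "measurable_correspondence F \<Phi>"
  shows "weights \<Phi> \<subseteq> weights \<Gamma>"
proof
  fix m assume m: "m \<in> weights \<Phi>"
  have "m (s, B) = 0" if B: "B \<in> sets F" "B \<subseteq> {t. \<Gamma> t \<inter> tbox s = {}}" for s B
  proof -
    let ?N = "{t\<in>space M. \<Phi> t \<inter> tbox s = {}}"
    have N: "?N \<in> sets F" by (rule measurable_correspondence_box[OF meas])
    have "m (s, B) = m (s, (B \<inter> ?N) \<union> (B - ?N))" by (rule arg_cong[of _ _ "\<lambda>B. m (s, B)"]) auto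
    also have "\<dots> = m (s, B \<inter> ?N) + m (s, B - ?N)"
      by (rule weightsD(5)[OF m]) (use B N in auto)
    also have "m (s, B \<inter> ?N) = 0"
      by (rule weightsD(6)[OF m]) (use B N in auto)
    also have "m (s, B - ?N) = 0"
    proof -
      have "B - ?N \<in> sets F" using B N by auto
      have "AE t in M. t \<notin> B - ?N"
        using sub AE_space by eventually_elim (use B(2) in blast)
      then have "prob (B - ?N) = 0"
        using prob_eq_0[OF sets_F_M[OF \<open>B - ?N \<in> sets F\<close>]] by blast
      then show ?thesis
        using weights_le_prob[OF m \<open>B - ?N \<in> sets F\<close>, of s] weightsD(1)[OF m, of s "B - ?N"] by simp
    qed
    finally show ?thesis by simp
  qed
  then show "m \<in> weights \<Gamma>" using weightsD[OF m] by (intro weightsI)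
qed

section \<open>Masses of selections and measurable choice\<close>

lemma weights_of_selection:
  assumes f: "f \<in> measurable M weak_star_borel" and sel: "AE t in M. f t \<in> \<Phi> t"
  shows "\<exists>m\<in>weights \<Phi>. realizes f m"
proof -
  define A where "A s = f -` tcell s \<inter> space M" for s
  have A: "set_tree M A" unfolding A_def by (rule tcell_set_tree[OF f])
  note As = set_tree_sets[OF A]
  \<comment> \<open>The default 0 is the value that \<open>weights\<close> prescribes outside
    \<open>F\<close>; it pins down the coordinates that carry no meaning.\<close>
  define m where "m = (\<lambda>(s, B). if B \<in> sets F then prob (A s \<inter> B) else 0)"
  have split: "prob (A s \<inter> B) = prob (A (True # s) \<inter> B) + prob (A (False # s) \<inter> B)" if "B \<in> sets F" for s B
  proof -
    have "A s \<inter> B = (A (True # s) \<inter> B) \<union> (A (False # s) \<inter> B)"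
      "(A (True # s) \<inter> B) \<inter> (A (False # s) \<inter> B) = {}" using A unfolding set_tree_def by blast+
    then show ?thesis using As sets_F_M[OF that] by (simp add: finite_measure_Union)
  qed
  have nil: "prob (A [] \<inter> B) = prob B" if "B \<in> sets F" for B
    using A sets.sets_into_space[OF that] by (simp add: set_tree_def Int_absorb1)
  have add: "prob (A s \<inter> (B \<union> C)) = prob (A s \<inter> B) + prob (A s \<inter> C)"
    if "B \<in> sets F" "C \<in> sets F" "B \<inter> C = {}" for s B C
    unfolding Int_Un_distrib using that As sets_F_M by (intro finite_measure_Union) auto
  have null: "prob (A s \<inter> B) = 0" if "B \<in> sets F" "B \<subseteq> {t. \<Phi> t \<inter> tbox s = {}}" for s B
  proof -
    have "A s \<inter> B \<in> sets M" using As sets_F_M[OF that(1)] by auto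
    moreover have "AE t in M. t \<notin> A s \<inter> B"
      using sel by eventually_elim (use that(2) tcell_subset_tbox[of s] in \<open>auto simp: A_def\<close>)
    ultimately show ?thesis using prob_eq_0 by blast
  qed
  have "m \<in> weights \<Phi>"
  proof (rule weightsI)
    show "m (s, B) = m (True # s, B) + m (False # s, B)" for s B using split[of B s] by (simp add: m_def)
    show "m (s, B \<union> C) = m (s, B) + m (s, C)" if "B \<in> sets F" "C \<in> sets F" "B \<inter> C = {}" for s B C
      using add[OF that] that by (simp add: m_def)
  qed (use nil null in \<open>simp_all add: m_def\<close>)
  moreover have "realizes f m"
    unfolding realizes_def
  proof (intro exI[of _ A] conjI A)
    show "AE t in M. \<forall>s. t \<in> A s \<longrightarrow> f t \<in> tbox s" using tcell_subset_tbox by (auto simp: A_def)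
  qed (simp add: m_def)
  ultimately show ?thesis by blast
qed

text \<open>The branch prefers the \<open>True\<close> child whenever \<open>\<Phi> t\<close> meets
  its box. Otherwise the sibling is met, because the two boxes cover that of the parent; so every
  node reached is met and \<open>tree_selection\<close> applies.\<close>

lemma ex_selection:
  fixes \<Phi> :: "'t \<Rightarrow> ('x \<Rightarrow>\<^sub>L real) set"
  assumes meas: "measurable_correspondence F \<Phi>" and cpt: "AE t in M. compactin weak_star (\<Phi> t)"
    and ne: "\<And>t. t \<in> space M \<Longrightarrow> \<Phi> t \<noteq> {}"
  shows "\<exists>f\<in>measurable M weak_star_borel. (AE t in M. f t \<in> \<Phi> t)"
proof -
  let ?K = "\<lambda>s. {t\<in>space M. \<Phi> t \<inter> tbox s \<noteq> {}}"
  define A where "A = rec_list (space M) (\<lambda>b s As. if b then As \<inter> ?K (True # s) else As - ?K (True # s))"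
  have A_simps: "A [] = space M" "A (True # s) = A s \<inter> ?K (True # s)" "A (False # s) = A s - ?K (True # s)" for s
    by (simp_all add: A_def)
  have AF: "A s \<in> sets F" for s
  proof (induction s)
    case Nil
    then show ?case using sets.top[of F] by (simp add: A_simps)
  next
    case (Cons b s)
    then show ?case using measurable_correspondence_box(1)[OF meas, of "True # s"]
      by (cases b) (auto simp only: A_simps sets.Int sets.Diff)
  qed
  have "set_tree M A" unfolding set_tree_def using sets_F_M[OF AF] A_simps by auto
  moreover have "t \<in> A s \<Longrightarrow> \<Phi> t \<inter> tbox s \<noteq> {}" for t s
  proof (induction s)
    case Nil
    then show ?case using ne by (simp add: A_simps)
  next
    case (Cons b s)
    show ?case
    proof (cases b)
      case True
      then show ?thesis using Cons.prems by (simp only: A_simps) blast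
    next
      case False
      then have t: "t \<in> A s" "t \<notin> ?K (True # s)" using Cons.prems by (simp_all only: A_simps) blast+
      moreover have "t \<in> space M" using t(1) sets.sets_into_space[OF sets_F_M[OF AF]] by blast
      ultimately have "\<Phi> t \<inter> tbox (True # s) = {}" "\<Phi> t \<inter> tbox s \<noteq> {}" using Cons.IH by blast+
      moreover have "\<Phi> t \<inter> tbox s = (\<Phi> t \<inter> tbox (True # s)) \<union> (\<Phi> t \<inter> tbox (False # s))"
        by (subst tbox_Cons_Un) (rule Int_Un_distrib)
      ultimately have "\<Phi> t \<inter> tbox (False # s) \<noteq> {}" by (metis sup_bot_left)
      then show ?thesis using False by simp
    qed
  qed
  ultimately show ?thesis using tree_selection[of M A \<Phi>] cpt by blast
qed

text \<open>\<open>\<Phi>\<close> is replaced by its part in the box wherever that part is nonempty,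
  which keeps measurability and compactness. As \<open>s\<close> runs through the countably many
  paths, the resulting selections play the role of a Castaing representation.\<close>

lemma dense_selections:
  assumes meas: "measurable_correspondence F \<Phi>" and cpt: "AE t in M. compactin weak_star (\<Phi> t)"
    and ne: "\<And>t. t \<in> space M \<Longrightarrow> \<Phi> t \<noteq> {}"
  shows "\<exists>f\<in>measurable M weak_star_borel. (AE t in M. f t \<in> \<Phi> t) \<and> (AE t in M. \<Phi> t \<inter> tbox s \<noteq> {} \<longrightarrow> f t \<in> tbox s)"
proof -
  define \<Psi> where "\<Psi> t = (if \<Phi> t \<inter> tbox s \<noteq> {} then tbox s \<inter> \<Phi> t else \<Phi> t)" for t
  have "measurable_correspondence F \<Psi>"
    unfolding measurable_correspondence_def space_F
  proof (intro allI impI)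
    fix E :: "('x \<Rightarrow>\<^sub>L real) set" assume E: "closedin weak_star E"
    have *: "{t\<in>space M. \<Phi> t \<inter> E \<noteq> {}} \<in> sets F" if "closedin weak_star E" for E
      by (rule meas[unfolded measurable_correspondence_def space_F, rule_format, OF that])
    have "{t\<in>space M. \<Psi> t \<inter> E \<noteq> {}} = {t\<in>space M. \<Phi> t \<inter> (tbox s \<inter> E) \<noteq> {}} \<union>
        ({t\<in>space M. \<Phi> t \<inter> tbox s = {}} \<inter> {t\<in>space M. \<Phi> t \<inter> E \<noteq> {}})"
      unfolding \<Psi>_def by auto
    also have "\<dots> \<in> sets F"
      by (intro sets.Un sets.Int * measurable_correspondence_box[OF meas] closedin_Int closedin_tbox E)
    finally show "{t\<in>space M. \<Psi> t \<inter> E \<noteq> {}} \<in> sets F" .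
  qed
  moreover have "AE t in M. compactin weak_star (\<Psi> t)"
    using cpt by eventually_elim (auto simp: \<Psi>_def intro: closed_Int_compactin[OF closedin_tbox])
  moreover have "\<Psi> t \<noteq> {}" if "t \<in> space M" for t using ne[OF that] by (auto simp: \<Psi>_def)
  ultimately obtain f where f: "f \<in> measurable M weak_star_borel" "AE t in M. f t \<in> \<Psi> t"
    using ex_selection by blast
  have "AE t in M. f t \<in> \<Phi> t" using f(2) by eventually_elim (auto simp: \<Psi>_def split: if_splits)
  moreover have "AE t in M. \<Phi> t \<inter> tbox s \<noteq> {} \<longrightarrow> f t \<in> tbox s"
    using f(2) by eventually_elim (auto simp: \<Psi>_def split: if_splits)
  ultimately show ?thesis using f(1) by blast
qed

end

locale nowhere_equivalent_tree = nowhere_equivalent_space M F + threshold_enumeration D e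
  for M F :: "'t measure" and D :: "'x::{banach, second_countable_topology} set" and e
begin

sublocale weighted_tree M F D e ..

text \<open>Converse of \<open>weights_of_selection\<close>. Each node is split by
  \<open>maharam\<close>, and additivity over siblings hands the right remainder to the
  \<open>False\<close> child. The support clause ensures that almost every \<open>t\<close> visits
  only nodes whose boxes meet \<open>\<Phi> t\<close>, so \<open>tree_selection\<close>
  applies.\<close>

lemma realization:
  assumes m: "m \<in> weights \<Phi>" and meas: "measurable_correspondence F \<Phi>"
    and cpt: "AE t in M. compactin weak_star (\<Phi> t)"
  shows "\<exists>f\<in>measurable M weak_star_borel. (AE t in M. f t \<in> \<Phi> t) \<and> realizes f m"
proof -
  \<comment> \<open>In \<open>P\<close> and \<open>S\<close> the letter \<open>D\<close> stands for
    the set being split and shadows the dense subgroup. The choice in \<open>S\<close> is made for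
    every set, so that the recursion can be written down before its invariant is known.\<close>
  define P where "P s D A \<longleftrightarrow> A \<in> sets M \<and> A \<subseteq> D \<and> (\<forall>B\<in>sets F. prob (A \<inter> B) = m (True # s, B))" for s D A
  define S where "S s D = (SOME A. P s D A)" for s D
  define A where "A = rec_list (space M) (\<lambda>b s As. if b then S s As else As - S s As)"
  have A_simps: "A [] = space M" "A (True # s) = S s (A s)" "A (False # s) = A s - S s (A s)" for s
    by (simp_all add: A_def)
  have S: "P s (A s) (S s (A s))" if "A s \<in> sets M" "\<And>B. B \<in> sets F \<Longrightarrow> prob (A s \<inter> B) = m (s, B)" for s
  proof -
    have "\<exists>A'\<in>sets M. A' \<subseteq> A s \<and> (\<forall>B\<in>sets F. prob (A' \<inter> B) = m (True # s, B))"
    proof (rule maharam[OF that(1)])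
      show "m (True # s, B) \<le> prob (A s \<inter> B)" if "B \<in> sets F" for B
        using weights_Cons_le[OF m, of True s B] \<open>\<And>B. B \<in> sets F \<Longrightarrow> prob (A s \<inter> B) = m (s, B)\<close>[OF that] by simp
    qed (use weightsD(1,5)[OF m] in auto)
    then have "\<exists>A'. P s (A s) A'" unfolding P_def by blast
    then show ?thesis unfolding S_def by (rule someI_ex)
  qed
  have inv: "A s \<in> sets M \<and> (\<forall>B\<in>sets F. prob (A s \<inter> B) = m (s, B))" for s
  proof (induction s)
    case Nil
    have "prob (space M \<inter> B) = m ([], B)" if "B \<in> sets F" for B
      using weightsD(3)[OF m that] sets.sets_into_space[OF that] by (simp add: Int_absorb1)
    then show ?case by (simp add: A_simps)
  next
    case (Cons b s)
    have PS: "P s (A s) (S s (A s))" by (rule S) (use Cons in auto)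
    show ?case
    proof (cases b)
      case True
      then show ?thesis using PS by (simp add: P_def A_simps)
    next
      case False
      have "prob ((A s - S s (A s)) \<inter> B) = m (False # s, B)" if B: "B \<in> sets F" for B
      proof -
        have "(A s - S s (A s)) \<inter> B = (A s \<inter> B) - (S s (A s) \<inter> B)" by auto
        also have "prob \<dots> = prob (A s \<inter> B) - prob (S s (A s) \<inter> B)"
          using PS Cons sets_F_M[OF B] unfolding P_def by (intro finite_measure_Diff) auto
        also have "\<dots> = m (s, B) - m (True # s, B)" using PS Cons B unfolding P_def by simp
        finally show ?thesis using weightsD(4)[OF m, of s B] by simp
      qed
      then show ?thesis using False PS Cons by (simp add: P_def A_simps sets.Diff)
    qed
  qed
  have "S s (A s) \<subseteq> A s" for s using S[of s] inv[of s] by (simp add: P_def)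
  then have A: "set_tree M A" unfolding set_tree_def using inv by (auto simp: A_simps)
  have "AE t in M. \<forall>s. t \<in> A s \<longrightarrow> \<Phi> t \<inter> tbox s \<noteq> {}"
    unfolding AE_all_countable
  proof
    fix s
    let ?N = "{t\<in>space M. \<Phi> t \<inter> tbox s = {}}"
    have N: "?N \<in> sets F" by (rule measurable_correspondence_box[OF meas])
    have "?N \<subseteq> {t. \<Phi> t \<inter> tbox s = {}}" by blast
    then have "prob (A s \<inter> ?N) = 0" using inv[of s] N weightsD(6)[OF m N, of s] by simp
    moreover have "A s \<inter> ?N \<in> sets M" using inv[of s] sets_F_M[OF N] by auto
    ultimately have "AE t in M. t \<notin> A s \<inter> ?N" using prob_eq_0 by blast
    then show "AE t in M. t \<in> A s \<longrightarrow> \<Phi> t \<inter> tbox s \<noteq> {}"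
      using AE_space by eventually_elim blast
  qed
  from tree_selection[OF A this cpt] obtain f where f: "f \<in> measurable M weak_star_borel" "AE t in M. f t \<in> \<Phi> t"
    "AE t in M. \<forall>s. t \<in> A s \<longrightarrow> f t \<in> tbox s" by blast
  have "realizes f m" unfolding realizes_def using A f(3) inv by (intro exI[of _ A]) simp
  then show ?thesis using f(1,2) by blast
qed

end

subsection \<open>Mixtures of laws\<close>

text \<open>Half-lines are stable under intersection and generate the Borel sets, so a mixture
  identity for distribution functions extends by the \<pi>-\<lambda> argument. The complement step
  rests on \<open>u + v = 1\<close>.\<close>

lemma (in prob_space) mixture_measure:
  fixes X X1 X2 :: "'a \<Rightarrow> real"
  assumes [measurable]: "X \<in> borel_measurable M" "X1 \<in> borel_measurable M" "X2 \<in> borel_measurable M" "B \<in> sets M"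
    and uv: "u + v = 1"
    and cdf: "\<And>a. prob (B \<inter> {t\<in>space M. X t \<le> a}) = u * prob (B \<inter> {t\<in>space M. X1 t \<le> a}) + v * prob (B \<inter> {t\<in>space M. X2 t \<le> a})"
    and S: "S \<in> sets borel"
  shows "prob (B \<inter> {t\<in>space M. X t \<in> S}) = u * prob (B \<inter> {t\<in>space M. X1 t \<in> S}) + v * prob (B \<inter> {t\<in>space M. X2 t \<in> S})"
proof -
  let ?E = "range (\<lambda>a::real. {..a})"
  have E: "Int_stable ?E" by (auto simp: Int_stable_def)
  have E': "?E \<subseteq> Pow UNIV" by simp
  have sb: "sets borel = sigma_sets UNIV ?E" by (simp add: borel_eq_atMost)
  have meas: "{t\<in>space M. Y t \<in> A} \<in> sets M" if "A \<in> sigma_sets UNIV ?E" "Y \<in> borel_measurable M" for A and Y :: "'a \<Rightarrow> real"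
    using measurable_sets[OF that(2), of A] that(1) sb by (simp add: vimage_def Int_def conj_commute)
  from S have "S \<in> sigma_sets UNIV ?E" by (simp add: sb)
  then show ?thesis
  proof (induction S rule: sigma_sets_induct_disjoint[OF E E', consumes 1, case_names basic empty compl union])
    case (basic A)
    then show ?case using cdf by auto
  next
    case empty
    then show ?case by simp
  next
    case (compl A)
    have c: "prob (B \<inter> {t\<in>space M. Y t \<in> UNIV - A}) = prob B - prob (B \<inter> {t\<in>space M. Y t \<in> A})"
      if Y: "Y \<in> borel_measurable M" for Y :: "'a \<Rightarrow> real"
    proof -
      have "B \<inter> {t\<in>space M. Y t \<in> UNIV - A} = B - (B \<inter> {t\<in>space M. Y t \<in> A})"
        using sets.sets_into_space[OF assms(4)] by auto
      then show ?thesis using meas[OF compl(1) Y] by (simp add: finite_measure_Diff)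
    qed
    have "prob B = u * prob B + v * prob B" using uv by (simp flip: ring_distribs)
    then show ?case using compl(2) by (simp only: c assms) (simp add: algebra_simps)
  next
    case (union A)
    have c: "(\<lambda>i. prob (B \<inter> {t\<in>space M. Y t \<in> A i})) sums prob (B \<inter> {t\<in>space M. Y t \<in> \<Union>(range A)})"
      if Y: "Y \<in> borel_measurable M" for Y :: "'a \<Rightarrow> real"
    proof -
      have "(\<Union>i. B \<inter> {t\<in>space M. Y t \<in> A i}) = B \<inter> {t\<in>space M. Y t \<in> \<Union>(range A)}" by auto
      moreover have "(\<lambda>i. prob (B \<inter> {t\<in>space M. Y t \<in> A i})) sums prob (\<Union>i. B \<inter> {t\<in>space M. Y t \<in> A i})"
        using meas[OF _ Y] union(1,2) by (intro finite_measure_UNION) (auto simp: disjoint_family_on_def)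
      ultimately show ?thesis by simp
    qed
    have "(\<lambda>i. prob (B \<inter> {t\<in>space M. X t \<in> A i})) sums
        (u * prob (B \<inter> {t\<in>space M. X1 t \<in> \<Union>(range A)}) + v * prob (B \<inter> {t\<in>space M. X2 t \<in> \<Union>(range A)}))"
      unfolding union(3) by (intro sums_add sums_mult c) auto
    with c[of X] show ?case using sums_unique2 by auto
  qed
qed

text \<open>No integrability is presupposed, so the identity can serve to prove that a function
  realizing a mixture is integrable.\<close>

lemma (in prob_space) mixture_nn_integral:
  fixes X X1 X2 :: "'a \<Rightarrow> real" and g :: "real \<Rightarrow> ennreal"
  assumes [measurable]: "X \<in> borel_measurable M" "X1 \<in> borel_measurable M" "X2 \<in> borel_measurable M" "B \<in> sets M"
    and uv: "0 \<le> u" "0 \<le> v" "u + v = 1"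
    and cdf: "\<And>a. prob (B \<inter> {t\<in>space M. X t \<le> a}) = u * prob (B \<inter> {t\<in>space M. X1 t \<le> a}) + v * prob (B \<inter> {t\<in>space M. X2 t \<le> a})"
    and g: "g \<in> borel_measurable borel"
  shows "(\<integral>\<^sup>+t\<in>B. g (X t) \<partial>M) = ennreal u * (\<integral>\<^sup>+t\<in>B. g (X1 t) \<partial>M) + ennreal v * (\<integral>\<^sup>+t\<in>B. g (X2 t) \<partial>M)"
  using g
proof (induction g rule: borel_measurable_induct)
  case (cong f g)
  then show ?case by simp
next
  case (set S)
  have *: "(\<integral>\<^sup>+t\<in>B. indicator S (Y t) \<partial>M) = ennreal (prob (B \<inter> {t\<in>space M. Y t \<in> S}))"
    if [measurable]: "Y \<in> borel_measurable M" for Y :: "'a \<Rightarrow> real"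
  proof -
    have [measurable]: "{t\<in>space M. Y t \<in> S} \<in> sets M"
      using measurable_sets[OF that set] by (simp add: vimage_def Int_def conj_commute)
    have "(\<integral>\<^sup>+t\<in>B. indicator S (Y t) \<partial>M) = (\<integral>\<^sup>+t. indicator (B \<inter> {t\<in>space M. Y t \<in> S}) t \<partial>M)"
      by (intro nn_integral_cong) (auto simp: indicator_def)
    then show ?thesis by (simp add: emeasure_eq_measure)
  qed
  show ?case using mixture_measure[OF assms(1-4) uv(3) cdf set] uv
    by (simp add: * ennreal_plus ennreal_mult)
next
  case (mult g c)
  have "(\<integral>\<^sup>+t\<in>B. c * g (Y t) \<partial>M) = c * (\<integral>\<^sup>+t\<in>B. g (Y t) \<partial>M)" if [measurable]: "Y \<in> borel_measurable M" for Y :: "'a \<Rightarrow> real"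
    using mult(2) by (simp add: nn_integral_cmult mult.assoc)
  then show ?case using mult.IH by (simp add: distrib_left mult.left_commute)
next
  case (add g h)
  have "(\<integral>\<^sup>+t\<in>B. h (Y t) + g (Y t) \<partial>M) = (\<integral>\<^sup>+t\<in>B. h (Y t) \<partial>M) + (\<integral>\<^sup>+t\<in>B. g (Y t) \<partial>M)"
    if [measurable]: "Y \<in> borel_measurable M" for Y :: "'a \<Rightarrow> real"
    using add.hyps by (simp add: nn_integral_add distrib_right)
  then show ?case using add.IH by (simp add: distrib_left ac_simps)
next
  case (seq U)
  have m: "(\<integral>\<^sup>+t\<in>B. (SUP i. U i) (Y t) \<partial>M) = (SUP i. \<integral>\<^sup>+t\<in>B. U i (Y t) \<partial>M)" if [measurable]: "Y \<in> borel_measurable M" for Y :: "'a \<Rightarrow> real"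
  proof -
    have "(\<integral>\<^sup>+t\<in>B. (SUP i. U i) (Y t) \<partial>M) = (\<integral>\<^sup>+t. (SUP i. U i (Y t) * indicator B t) \<partial>M)"
      by (intro nn_integral_cong) (auto simp: indicator_def image_comp)
    also have "\<dots> = (SUP i. \<integral>\<^sup>+t\<in>B. U i (Y t) \<partial>M)"
      using seq(1) \<open>incseq U\<close> by (intro nn_integral_monotone_convergence_SUP)
        (auto simp: incseq_def le_fun_def intro!: mult_right_mono)
    finally show ?thesis .
  qed
  have inc: "incseq (\<lambda>i. \<integral>\<^sup>+t\<in>B. U i (Y t) \<partial>M)" for Y :: "'a \<Rightarrow> real"
    using \<open>incseq U\<close> by (auto simp: incseq_def le_fun_def intro!: nn_integral_mono mult_right_mono)
  have incm: "incseq (\<lambda>i. c * (\<integral>\<^sup>+t\<in>B. U i (Y t) \<partial>M))" for Y :: "'a \<Rightarrow> real" and c :: ennreal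
    using inc[of Y] by (auto simp: incseq_def intro!: mult_left_mono)
  show ?case
    unfolding m[OF assms(1)] m[OF assms(2)] m[OF assms(3)] seq.IH
    by (simp add: SUP_mult_left_ennreal ennreal_SUP_add[OF incm incm])
qed

lemma (in prob_space) mixture_integral:
  fixes X X1 X2 :: "'a \<Rightarrow> real"
  assumes X: "X \<in> borel_measurable M" and X12: "integrable M X1" "integrable M X2" and B: "B \<in> sets M"
    and uv: "0 \<le> u" "0 \<le> v" "u + v = 1"
    and iX: "integrable M X"
    and cdf: "\<And>a. prob (B \<inter> {t\<in>space M. X t \<le> a}) = u * prob (B \<inter> {t\<in>space M. X1 t \<le> a}) + v * prob (B \<inter> {t\<in>space M. X2 t \<le> a})"
  shows "(\<integral>t\<in>B. X t \<partial>M) = u * (\<integral>t\<in>B. X1 t \<partial>M) + v * (\<integral>t\<in>B. X2 t \<partial>M)"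
proof -
  have part: "(\<integral>t\<in>B. k (X t) \<partial>M) = u * (\<integral>t\<in>B. k (X1 t) \<partial>M) + v * (\<integral>t\<in>B. k (X2 t) \<partial>M)"
    if k: "\<And>r. 0 \<le> k r" "k \<in> borel_measurable borel" "\<And>Y. integrable M Y \<Longrightarrow> integrable M (\<lambda>t. k (Y t))" for k :: "real \<Rightarrow> real"
  proof -
    have nn: "(\<integral>\<^sup>+t\<in>B. ennreal (k (Y t)) \<partial>M) = ennreal (\<integral>t\<in>B. k (Y t) \<partial>M)" if "integrable M Y" for Y
    proof -
      have "integrable M (\<lambda>t. k (Y t) * indicator B t)" by (rule integrable_real_mult_indicator[OF B k(3)[OF that]])
      then have "(\<integral>\<^sup>+t. ennreal (k (Y t) * indicator B t) \<partial>M) = ennreal (\<integral>t. k (Y t) * indicator B t \<partial>M)"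
        by (rule nn_integral_eq_integral) (use k(1) in auto)
      moreover have "(\<integral>\<^sup>+t. ennreal (k (Y t) * indicator B t) \<partial>M) = (\<integral>\<^sup>+t\<in>B. ennreal (k (Y t)) \<partial>M)"
        by (intro nn_integral_cong) (auto simp: indicator_def)
      ultimately show ?thesis by (simp add: set_lebesgue_integral_def mult.commute)
    qed
    have pos: "0 \<le> (\<integral>t\<in>B. k (Y t) \<partial>M)" for Y
      unfolding set_lebesgue_integral_def using k(1) by (intro Bochner_Integration.integral_nonneg) simp
    have "(\<lambda>r. ennreal (k r)) \<in> borel_measurable borel" using k(2) by simp
    from mixture_nn_integral[OF X borel_measurable_integrable[OF X12(1)] borel_measurable_integrable[OF X12(2)] B uv cdf this]
    have "ennreal (\<integral>t\<in>B. k (X t) \<partial>M) = ennreal (u * (\<integral>t\<in>B. k (X1 t) \<partial>M) + v * (\<integral>t\<in>B. k (X2 t) \<partial>M))"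
      using uv pos X12 iX by (simp add: nn ennreal_plus ennreal_mult)
    then show ?thesis using pos uv by (subst (asm) ennreal_inj) auto
  qed
  have split: "(\<integral>t\<in>B. Y t \<partial>M) = (\<integral>t\<in>B. max 0 (Y t) \<partial>M) - (\<integral>t\<in>B. max 0 (- Y t) \<partial>M)" if Y: "integrable M Y" for Y :: "'a \<Rightarrow> real"
  proof -
    have "integrable M (\<lambda>t. max 0 (Y t))" "integrable M (\<lambda>t. max 0 (- Y t))" using Y by auto
    note si = this[THEN integrable_mult_indicator[OF B], folded set_integrable_def]
    have "(\<integral>t\<in>B. Y t \<partial>M) = (\<integral>t\<in>B. max 0 (Y t) - max 0 (- Y t) \<partial>M)"
      by (rule arg_cong[where f = "set_lebesgue_integral M B"]) auto
    then show ?thesis using si by simp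
  qed
  have "(\<integral>t\<in>B. max 0 (X t) \<partial>M) = u * (\<integral>t\<in>B. max 0 (X1 t) \<partial>M) + v * (\<integral>t\<in>B. max 0 (X2 t) \<partial>M)"
    by (rule part) auto
  moreover have "(\<integral>t\<in>B. max 0 (- X t) \<partial>M) = u * (\<integral>t\<in>B. max 0 (- X1 t) \<partial>M) + v * (\<integral>t\<in>B. max 0 (- X2 t) \<partial>M)"
    by (rule part[of "\<lambda>r. max 0 (- r)"]) auto
  ultimately show ?thesis unfolding split[OF iX] split[OF X12(1)] split[OF X12(2)] by (simp add: algebra_simps)
qed

text \<open>The L_1 bound makes the integral over \<open>B\<close> a Lipschitz function of the test
  point. This carries identities from \<open>D\<close> to the whole space.\<close>

lemma gelfand_tendsto_set_integral:
  fixes f :: "'t \<Rightarrow> 'x::real_normed_vector \<Rightarrow>\<^sub>L real"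
  assumes int: "\<And>x. integrable M (\<lambda>t. blinfun_apply (f t) x)"
    and C: "\<And>x. (\<integral>t. \<bar>blinfun_apply (f t) x\<bar> \<partial>M) \<le> C * norm x"
    and B: "B \<in> sets M" and lim: "d \<longlonglongrightarrow> x"
  shows "(\<lambda>k. \<integral>t\<in>B. blinfun_apply (f t) (d k) \<partial>M) \<longlonglongrightarrow> (\<integral>t\<in>B. blinfun_apply (f t) x \<partial>M)"
proof (rule Lim_null_comparison[THEN LIM_zero_cancel])
  show "\<forall>\<^sub>F k in sequentially. norm ((\<integral>t\<in>B. blinfun_apply (f t) (d k) \<partial>M) - (\<integral>t\<in>B. blinfun_apply (f t) x \<partial>M)) \<le> C * norm (d k - x)"
  proof (intro always_eventually allI)
    fix k
    have si: "set_integrable M B (\<lambda>t. blinfun_apply (f t) y)" for y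
      using integrable_mult_indicator[OF B int[of y]] by (simp add: set_integrable_def)
    have "(\<integral>t\<in>B. blinfun_apply (f t) (d k) \<partial>M) - (\<integral>t\<in>B. blinfun_apply (f t) x \<partial>M) = (\<integral>t\<in>B. blinfun_apply (f t) (d k - x) \<partial>M)"
      using si by (simp add: blinfun.diff_right)
    also have "norm \<dots> \<le> (\<integral>t. \<bar>blinfun_apply (f t) (d k - x)\<bar> \<partial>M)"
      unfolding set_lebesgue_integral_def
      using int[of "d k - x"] si[of "d k - x", unfolded set_integrable_def]
      by (intro order_trans[OF integral_norm_bound] integral_mono) (auto simp: indicator_def)
    also have "\<dots> \<le> C * norm (d k - x)" by (rule C)
    finally show "norm ((\<integral>t\<in>B. blinfun_apply (f t) (d k) \<partial>M) - (\<integral>t\<in>B. blinfun_apply (f t) x \<partial>M)) \<le> C * norm (d k - x)" .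
  qed
  have "(\<lambda>k. C * norm (d k - x)) \<longlonglongrightarrow> C * norm (x - x)" by (intro tendsto_intros lim)
  then show "(\<lambda>k. C * norm (d k - x)) \<longlonglongrightarrow> 0" by simp
qed

context weighted_tree
begin

text \<open>For \<open>e n = (d, q)\<close> this is, up to ties, the mass of the half-space of
  functionals with value at most \<open>q\<close> at \<open>d\<close>: the counterpart of
  \<open>left_part\<close> in terms of masses.\<close>

definition level :: "(bool list \<times> 't set \<Rightarrow> real) \<Rightarrow> nat \<Rightarrow> 't set \<Rightarrow> real" where
  "level m n B = (\<Sum>s | length s = n. m (True # s, B))"

lemma realizes_level:
  assumes "realizes f m"
  shows "\<exists>L. (\<forall>n. L n \<in> sets M) \<and>
    (AE t in M. \<forall>n. (blinfun_apply (f t) (fst (e n)) < snd (e n) \<longrightarrow> t \<in> L n) \<and>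
        (t \<in> L n \<longrightarrow> blinfun_apply (f t) (fst (e n)) \<le> snd (e n))) \<and>
    (\<forall>n B. B \<in> sets F \<longrightarrow> prob (L n \<inter> B) = level m n B)"
proof -
  obtain A where A: "set_tree M A" "AE t in M. \<forall>s. t \<in> A s \<longrightarrow> f t \<in> tbox s"
    "\<And>s B. B \<in> sets F \<Longrightarrow> m (s, B) = prob (A s \<inter> B)"
    using assms unfolding realizes_def by blast
  have "AE t in M. \<forall>n. (blinfun_apply (f t) (fst (e n)) < snd (e n) \<longrightarrow> t \<in> left_part A n) \<and>
        (t \<in> left_part A n \<longrightarrow> blinfun_apply (f t) (fst (e n)) \<le> snd (e n))"
    using A(2) AE_space
  proof eventually_elim
    case (elim t)
    then have "\<And>s. t \<in> A s \<Longrightarrow> f t \<in> tbox s" by blast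
    note L = tbox_left_part[OF A(1) elim(2) this prod.collapse[symmetric]]
    show ?case using L by blast
  qed
  moreover have "prob (left_part A n \<inter> B) = level m n B" if "B \<in> sets F" for n B
    unfolding level_def using measure_left_part[OF A(1) _ sets_F_M[OF that], of n] A(3)[OF that]
    by (simp add: finite_measure_axioms)
  ultimately show ?thesis using left_part_sets[OF A(1)] by (intro exI[of _ "left_part A"]) blast
qed

text \<open>The mixed law is determined by its distribution function at rational thresholds.\<close>

lemma realizes_mixture_cdf:
  assumes f: "realizes f m" "realizes f1 m1" "realizes f2 m2"
    and meas: "f \<in> measurable M weak_star_borel" "f1 \<in> measurable M weak_star_borel" "f2 \<in> measurable M weak_star_borel"
    and m: "\<And>p. m p = u * m1 p + v * m2 p" and uv: "0 \<le> u" "0 \<le> v"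
    and B: "B \<in> sets F" and d: "d \<in> D"
  shows "prob (B \<inter> {t\<in>space M. blinfun_apply (f t) d \<le> a}) =
    u * prob (B \<inter> {t\<in>space M. blinfun_apply (f1 t) d \<le> a}) + v * prob (B \<inter> {t\<in>space M. blinfun_apply (f2 t) d \<le> a})"
proof -
  define G where "G h a = prob (B \<inter> {t\<in>space M. blinfun_apply (h t) d \<le> a})" for h :: "'t \<Rightarrow> 'x \<Rightarrow>\<^sub>L real" and a
  note BM = sets_F_M[OF B]
  \<comment> \<open>Because of ties, \<open>level\<close> is only known to lie between the values of
    the distribution function to the left of \<open>q\<close> and its value at
    \<open>q\<close>.\<close>
  have sand: "level k n B \<le> G h q \<and> (\<forall>a<q. G h a \<le> level k n B)"
    if h: "realizes h k" "h \<in> measurable M weak_star_borel" and n: "e n = (d, q)" for h k n q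
  proof -
    have [measurable]: "(\<lambda>t. blinfun_apply (h t) d) \<in> borel_measurable M"
      by (rule measurable_apply_weak_star[OF h(2)])
    obtain L where L0: "\<forall>n. L n \<in> sets M"
      "AE t in M. \<forall>n. (blinfun_apply (h t) (fst (e n)) < snd (e n) \<longrightarrow> t \<in> L n) \<and>
        (t \<in> L n \<longrightarrow> blinfun_apply (h t) (fst (e n)) \<le> snd (e n))"
      "\<forall>n B. B \<in> sets F \<longrightarrow> prob (L n \<inter> B) = level k n B"
      using realizes_level[OF h(1)] by blast
    have "AE t in M. (blinfun_apply (h t) d < q \<longrightarrow> t \<in> L n) \<and> (t \<in> L n \<longrightarrow> blinfun_apply (h t) d \<le> q)"
      using L0(2)
    proof eventually_elim
      case (elim t)
      then show ?case using spec[OF elim, of n] n by simp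
    qed
    note L = L0(1)[rule_format, of n] this L0(3)[rule_format, OF B, of n]
    have "prob (L n \<inter> B) \<le> G h q"
      unfolding G_def using L(2) AE_space BM by (intro finite_measure_mono_AE) (auto elim!: eventually_elim2)
    moreover have "G h a \<le> prob (L n \<inter> B)" if "a < q" for a
      unfolding G_def using L(2) that BM L(1) by (intro finite_measure_mono_AE) (auto elim!: eventually_mono)
    ultimately show ?thesis using L(3) by simp
  qed
  \<comment> \<open>Right continuity of distribution functions; it closes the gap left by comparing
    at nearby thresholds.\<close>
  have cont: "(\<lambda>k. G h (a + 1 / real (Suc k))) \<longlonglongrightarrow> G h a" if h: "h \<in> measurable M weak_star_borel" for h a
  proof -
    have [measurable]: "(\<lambda>t. blinfun_apply (h t) d) \<in> borel_measurable M"
      by (rule measurable_apply_weak_star[OF h])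
    let ?S = "\<lambda>k. B \<inter> {t\<in>space M. blinfun_apply (h t) d \<le> a + 1 / real (Suc k)}"
    have "(\<lambda>k. prob (?S k)) \<longlonglongrightarrow> prob (\<Inter>k. ?S k)"
    proof (rule finite_Lim_measure_decseq)
      show "range ?S \<subseteq> sets M" using BM by auto
      have "1 / real (Suc l) \<le> 1 / real (Suc k)" if "k \<le> l" for k l using that by (simp add: frac_le)
      then show "decseq ?S" unfolding decseq_def by fastforce
    qed
    moreover have "(\<Inter>k. ?S k) = B \<inter> {t\<in>space M. blinfun_apply (h t) d \<le> a}"
    proof -
      have "x \<le> a" if "\<And>k. x \<le> a + 1 / real (Suc k)" for x
      proof (rule field_le_epsilon)
        fix r :: real assume "0 < r"
        then obtain k where "1 / real (Suc k) < r" using nat_approx_posE by blast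
        then show "x \<le> a + r" using that[of k] by linarith
      qed
      moreover have "x \<le> a + 1 / real (Suc k)" if "x \<le> a" for x k using that by (simp add: add_increasing2)
      ultimately show ?thesis by auto
    qed
    ultimately show ?thesis by (simp add: G_def)
  qed
  have lev: "level m n B = u * level m1 n B + v * level m2 n B" for n
    unfolding level_def by (simp add: m sum.distrib sum_distrib_left)
  define H where "H a = u * G f1 a + v * G f2 a" for a
  \<comment> \<open>A rational \<open>q\<close> strictly between \<open>a\<close> and
    \<open>a + r\<close> has an index, and at that index the levels mix exactly.\<close>
  have cmp: "G f a \<le> H (a + r) \<and> H a \<le> G f (a + r)" if "0 < r" for r a
  proof -
    have "\<exists>q\<in>\<rat>. a < q \<and> q < a + r" using that by (intro Rats_dense_in_real) simp
    then obtain q where q: "q \<in> \<rat>" "a < q" "q < a + r" by blast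
    obtain n where n: "e n = (d, q)" by (rule threshold_index[OF d q(1)])
    have mono: "G h q \<le> G h (a + r)" if "h \<in> measurable M weak_star_borel" for h
    proof -
      have [measurable]: "(\<lambda>t. blinfun_apply (h t) d) \<in> borel_measurable M"
        by (rule measurable_apply_weak_star[OF that])
      show ?thesis unfolding G_def using q BM by (intro finite_measure_mono) auto
    qed
    note s = sand[OF f(1) meas(1) n] sand[OF f(2) meas(2) n] sand[OF f(3) meas(3) n]
    have "G f a \<le> level m n B" using s(1) q(2) by blast
    also have "\<dots> \<le> H (a + r)" unfolding lev H_def
      using s(2,3) mono[OF meas(2)] mono[OF meas(3)] uv by (intro add_mono mult_left_mono) auto
    finally have 1: "G f a \<le> H (a + r)" .
    have "H a \<le> level m n B" unfolding lev H_def
      using s(2,3) q(2) uv by (intro add_mono mult_left_mono) auto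
    also have "\<dots> \<le> G f (a + r)" using s(1) mono[OF meas(1)] by linarith
    finally show ?thesis using 1 by simp
  qed
  have "G f a \<le> H a"
  proof (rule LIMSEQ_le_const)
    show "(\<lambda>k. H (a + 1 / real (Suc k))) \<longlonglongrightarrow> H a"
      unfolding H_def by (intro tendsto_intros cont meas)
    show "\<exists>N. \<forall>n\<ge>N. G f a \<le> H (a + 1 / real (Suc n))" using cmp by simp
  qed
  moreover have "H a \<le> G f a"
  proof (rule LIMSEQ_le_const)
    show "(\<lambda>k. G f (a + 1 / real (Suc k))) \<longlonglongrightarrow> G f a" by (intro cont meas)
    show "\<exists>N. \<forall>n\<ge>N. H a \<le> G f (a + 1 / real (Suc n))" using cmp by simp
  qed
  ultimately show ?thesis by (simp add: H_def G_def)
qed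

end

section \<open>Convexity of the set of conditional expectations\<close>

context nowhere_equivalent_tree
begin

text \<open>The mixed weights are realized by some selection \<open>f\<close>. Over each set of
  \<open>F\<close> its laws at points of \<open>D\<close> are mixtures, hence so are its integrals.
  The same combination of \<open>g1\<close> and \<open>g2\<close> is then a conditional expectation
  of \<open>f\<close>, and none has to be constructed.\<close>

lemma convex_CG:
  fixes \<Phi> :: "'t \<Rightarrow> ('x \<Rightarrow>\<^sub>L real) set"
  assumes G: "subalgebra F G" and meas: "measurable_correspondence F \<Phi>"
    and cpt: "AE t in M. compactin weak_star (\<Phi> t)"
  shows "convex_function_set (CG M G \<Phi>)"
  unfolding convex_function_set_def
proof (intro ballI allI impI)
  fix g1 g2 u v
  assume g: "g1 \<in> CG M G \<Phi>" "g2 \<in> CG M G \<Phi>" and uv: "0 \<le> u" "0 \<le> v" "u + v = (1::real)"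
  obtain f1 where f1: "f1 \<in> measurable M weak_star_borel" "gelfand_integrable M f1" "AE t in M. f1 t \<in> \<Phi> t" "gelfand_cond_exp M G f1 g1"
    using g(1) unfolding CG_def by blast
  obtain f2 where f2: "f2 \<in> measurable M weak_star_borel" "gelfand_integrable M f2" "AE t in M. f2 t \<in> \<Phi> t" "gelfand_cond_exp M G f2 g2"
    using g(2) unfolding CG_def by blast
  obtain m1 where m1: "m1 \<in> weights \<Phi>" "realizes f1 m1" using weights_of_selection[OF f1(1,3)] by blast
  obtain m2 where m2: "m2 \<in> weights \<Phi>" "realizes f2 m2" using weights_of_selection[OF f2(1,3)] by blast
  define m where "m p = u * m1 p + v * m2 p" for p
  have "m \<in> weights \<Phi>" unfolding m_def by (rule convex_weights[OF m1(1) m2(1) uv])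
  then obtain f where f: "f \<in> measurable M weak_star_borel" "AE t in M. f t \<in> \<Phi> t" "realizes f m"
    using realization[OF _ meas cpt] by blast
  have GF: "B \<in> sets F" if "B \<in> sets G" for B using that G by (auto simp: subalgebra_def)
  have [measurable]: "(\<lambda>t. blinfun_apply (f t) x) \<in> borel_measurable M" "(\<lambda>t. blinfun_apply (f1 t) x) \<in> borel_measurable M"
    "(\<lambda>t. blinfun_apply (f2 t) x) \<in> borel_measurable M" for x
    using f(1) f1(1) f2(1) by (auto intro: measurable_apply_weak_star)
  have i1: "integrable M (\<lambda>t. blinfun_apply (f1 t) x)" and i2: "integrable M (\<lambda>t. blinfun_apply (f2 t) x)" for x
    using f1(2) f2(2) by (auto simp: gelfand_integrable_def)
  note cdf = realizes_mixture_cdf[OF f(3) m1(2) m2(2) f(1) f1(1) f2(1) m_def uv(1,2)]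
  obtain C1 where C1: "0 \<le> C1" "\<And>x. (\<integral>t. \<bar>blinfun_apply (f1 t) x\<bar> \<partial>M) \<le> C1 * norm x"
    using gelfand_integrable_bound[OF f1(2)] by blast
  obtain C2 where C2: "0 \<le> C2" "\<And>x. (\<integral>t. \<bar>blinfun_apply (f2 t) x\<bar> \<partial>M) \<le> C2 * norm x"
    using gelfand_integrable_bound[OF f2(2)] by blast
  define C where "C = u * C1 + v * C2"
  have C0: "0 \<le> C" using C1 C2 uv by (simp add: C_def)
  have bdD: "(\<integral>\<^sup>+t. ennreal \<bar>blinfun_apply (f t) d\<bar> \<partial>M) \<le> ennreal (C * norm d)" if d: "d \<in> D" for d
  proof -
    have nn: "(\<integral>\<^sup>+t. ennreal \<bar>Y t\<bar> \<partial>M) = ennreal (\<integral>t. \<bar>Y t\<bar> \<partial>M)" if "integrable M Y" for Y :: "'t \<Rightarrow> real"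
      using that by (intro nn_integral_eq_integral) auto
    have sp: "(\<integral>\<^sup>+t\<in>space M. g t \<partial>M) = (\<integral>\<^sup>+t. g t \<partial>M)" for g :: "'t \<Rightarrow> ennreal"
      by (intro nn_integral_cong) auto
    have "space M \<in> sets F" using sets.top[of F] by simp
    note mixture_nn_integral[OF _ _ _ sets.top uv cdf[OF this d], of "\<lambda>r. ennreal \<bar>r\<bar>"]
    then have "(\<integral>\<^sup>+t. ennreal \<bar>blinfun_apply (f t) d\<bar> \<partial>M) =
        ennreal u * (\<integral>\<^sup>+t. ennreal \<bar>blinfun_apply (f1 t) d\<bar> \<partial>M) + ennreal v * (\<integral>\<^sup>+t. ennreal \<bar>blinfun_apply (f2 t) d\<bar> \<partial>M)"
      by (simp add: sp)
    also have "\<dots> = ennreal (u * (\<integral>t. \<bar>blinfun_apply (f1 t) d\<bar> \<partial>M) + v * (\<integral>t. \<bar>blinfun_apply (f2 t) d\<bar> \<partial>M))"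
      using uv by (simp add: nn[OF i1] nn[OF i2] ennreal_plus ennreal_mult)
    also have "\<dots> \<le> ennreal (u * (C1 * norm d) + v * (C2 * norm d))"
      using C1 C2 uv by (intro ennreal_leI add_mono mult_left_mono) auto
    finally show ?thesis by (simp add: C_def algebra_simps)
  qed
  \<comment> \<open>So far the bound is known on \<open>D\<close> only, and \<open>f\<close> is not
    yet known to be integrable at other points; hence the Fatou argument.\<close>
  have bd: "(\<integral>\<^sup>+t. ennreal \<bar>blinfun_apply (f t) x\<bar> \<partial>M) \<le> ennreal (C * norm x)" for x
  proof -
    obtain d where d: "\<And>n. d n \<in> D" "d \<longlonglongrightarrow> x" using seq_D[of x] by blast
    have "(\<lambda>n. ennreal (C * norm (d n))) \<longlonglongrightarrow> ennreal (C * norm x)"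
      using d(2) by (intro tendsto_intros)
    then show ?thesis by (rule nn_integral_weak_star_fatou[rotated 2]) (use d bdD in auto)
  qed
  have i: "integrable M (\<lambda>t. blinfun_apply (f t) x)" for x
    by (rule integrableI_bounded) (use bd[of x] in \<open>auto simp: le_less_trans[OF _ ennreal_less_top]\<close>)
  have Cf: "(\<integral>t. \<bar>blinfun_apply (f t) x\<bar> \<partial>M) \<le> C * norm x" for x
  proof -
    have "(\<integral>\<^sup>+t. ennreal \<bar>blinfun_apply (f t) x\<bar> \<partial>M) = ennreal (\<integral>t. \<bar>blinfun_apply (f t) x\<bar> \<partial>M)"
      using i[of x] by (intro nn_integral_eq_integral) auto
    then show ?thesis using bd[of x] C0 by (simp add: ennreal_le_iff)
  qed
  have eq: "(\<integral>t\<in>B. blinfun_apply (f t) x \<partial>M) = u * (\<integral>t\<in>B. blinfun_apply (f1 t) x \<partial>M) + v * (\<integral>t\<in>B. blinfun_apply (f2 t) x \<partial>M)"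
    if B: "B \<in> sets F" for B x
  proof -
    obtain d where d: "\<And>n. d n \<in> D" "d \<longlonglongrightarrow> x" using seq_D[of x] by blast
    note BM = sets_F_M[OF B]
    have "(\<lambda>n. \<integral>t\<in>B. blinfun_apply (f t) (d n) \<partial>M) \<longlonglongrightarrow> (\<integral>t\<in>B. blinfun_apply (f t) x \<partial>M)"
      by (rule gelfand_tendsto_set_integral[OF i Cf BM d(2)])
    moreover have "(\<lambda>n. u * (\<integral>t\<in>B. blinfun_apply (f1 t) (d n) \<partial>M) + v * (\<integral>t\<in>B. blinfun_apply (f2 t) (d n) \<partial>M)) \<longlonglongrightarrow>
        u * (\<integral>t\<in>B. blinfun_apply (f1 t) x \<partial>M) + v * (\<integral>t\<in>B. blinfun_apply (f2 t) x \<partial>M)"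
      by (intro tendsto_intros gelfand_tendsto_set_integral[OF i1 C1(2) BM d(2)] gelfand_tendsto_set_integral[OF i2 C2(2) BM d(2)])
    moreover have "(\<integral>t\<in>B. blinfun_apply (f t) (d n) \<partial>M) =
        u * (\<integral>t\<in>B. blinfun_apply (f1 t) (d n) \<partial>M) + v * (\<integral>t\<in>B. blinfun_apply (f2 t) (d n) \<partial>M)" for n
      by (rule mixture_integral[OF _ i1 i2 BM uv i cdf[OF B d(1)]]) simp
    ultimately show ?thesis using LIMSEQ_unique by auto
  qed
  define g where "g t = u *\<^sub>R g1 t + v *\<^sub>R g2 t" for t
  have ga: "blinfun_apply (g t) x = u * blinfun_apply (g1 t) x + v * blinfun_apply (g2 t) x" for t x
    by (simp add: g_def blinfun.add_left blinfun.scaleR_left)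
  note ce1 = f1(4)[unfolded gelfand_cond_exp_def] and ce2 = f2(4)[unfolded gelfand_cond_exp_def]
  have [measurable]: "(\<lambda>t. blinfun_apply (g1 t) x) \<in> borel_measurable G" "(\<lambda>t. blinfun_apply (g2 t) x) \<in> borel_measurable G" for x
    using ce1 ce2 by (auto intro: measurable_apply_weak_star)
  have gi1: "integrable M (\<lambda>t. blinfun_apply (g1 t) x)" and gi2: "integrable M (\<lambda>t. blinfun_apply (g2 t) x)" for x
    using ce1 ce2 by (auto simp: gelfand_integrable_def)
  have "gelfand_cond_exp M G f g"
    unfolding gelfand_cond_exp_def
  proof (intro conjI ballI)
    show "g \<in> measurable G weak_star_borel" by (rule measurable_weak_starI) (simp add: ga)
    show "gelfand_integrable M g" unfolding gelfand_integrable_def ga using gi1 gi2 by auto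
    fix B assume B: "B \<in> sets G"
    have BM: "B \<in> sets M" using sets_F_M[OF GF[OF B]] .
    have si: "set_integrable M B (\<lambda>t. blinfun_apply (g1 t) x)" "set_integrable M B (\<lambda>t. blinfun_apply (g2 t) x)" for x
      using integrable_mult_indicator[OF BM gi1[of x]] integrable_mult_indicator[OF BM gi2[of x]]
      by (simp_all add: set_integrable_def)
    show "gelfand_integral M B f = gelfand_integral M B g"
    proof
      fix x
      have "gelfand_integral M B f1 x = gelfand_integral M B g1 x" "gelfand_integral M B f2 x = gelfand_integral M B g2 x"
        using ce1 ce2 B by auto
      then show "gelfand_integral M B f x = gelfand_integral M B g x"
        using si[of x] eq[OF GF[OF B], of x] by (simp add: gelfand_integral_def ga)
    qed
  qed
  then show "(\<lambda>t. u *\<^sub>R g1 t + v *\<^sub>R g2 t) \<in> CG M G \<Phi>"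
    unfolding CG_def using f i by (auto simp: gelfand_integrable_def g_def[abs_def])
qed

end

subsection \<open>Pairing with vector-valued functions\<close>

text \<open>Simple functions reduce the pairing to evaluations at finitely many fixed points; norm
  continuity of each \<open>f t\<close> passes to the limit.\<close>

lemma measurable_pairing:
  fixes \<phi> :: "'t \<Rightarrow> 'x::{banach, second_countable_topology}"
  assumes f: "f \<in> measurable N weak_star_borel" and \<phi>: "\<phi> \<in> borel_measurable N"
  shows "(\<lambda>t. blinfun_apply (f t) (\<phi> t)) \<in> borel_measurable N"
proof -
  obtain s where s: "\<And>i. simple_function N (s i)" "\<And>t. t \<in> space N \<Longrightarrow> (\<lambda>i. s i t) \<longlonglongrightarrow> \<phi> t"
    using borel_measurable_implies_sequence_metric[OF \<phi>, of 0] by blast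
  show ?thesis
  proof (rule borel_measurable_LIMSEQ_real)
    show "(\<lambda>i. blinfun_apply (f t) (s i t)) \<longlonglongrightarrow> blinfun_apply (f t) (\<phi> t)" if "t \<in> space N" for t
      by (intro tendsto_intros s(2) that)
    fix i
    have fin: "finite (s i ` space N)" using s(1) by (rule simple_functionD)
    show "(\<lambda>t. blinfun_apply (f t) (s i t)) \<in> borel_measurable N"
    proof (rule measurable_compose_countable'[where f = "\<lambda>x t. blinfun_apply (f t) x" and g = "s i"])
      show "s i \<in> measurable N (count_space (s i ` space N))"
        unfolding measurable_def using simple_functionD(2)[OF s(1)] by auto
      show "countable (s i ` space N)" using fin by (rule countable_finite)
    qed (rule measurable_apply_weak_star[OF f])
  qed
qed

lemma abs_blinfun_le:
  fixes \<xi> :: "'x::real_normed_vector \<Rightarrow>\<^sub>L real"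
  assumes "norm \<xi> \<le> c"
  shows "\<bar>blinfun_apply \<xi> x\<bar> \<le> c * norm x"
  using norm_blinfun[of \<xi> x] mult_right_mono[OF assms norm_ge_zero[of x]] by simp

lemma integrable_pairing:
  fixes \<phi> :: "'t \<Rightarrow> 'x::{banach, second_countable_topology}"
  assumes f: "f \<in> measurable M weak_star_borel" and \<phi>: "\<phi> \<in> borel_measurable M"
    and bd: "AE t in M. norm (f t) \<le> h t" and int: "integrable M (\<lambda>t. h t * norm (\<phi> t))"
  shows "integrable M (\<lambda>t. blinfun_apply (f t) (\<phi> t))"
  using int
proof (rule Bochner_Integration.integrable_bound)
  show "AE t in M. norm (blinfun_apply (f t) (\<phi> t)) \<le> norm (h t * norm (\<phi> t))"
    using bd
  proof eventually_elim
    case (elim t)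
    then show ?case using abs_blinfun_le[OF elim, of "\<phi> t"] by simp
  qed
qed (rule measurable_pairing[OF f \<phi>])

lemma integral_pairing_le:
  fixes \<phi> :: "'t \<Rightarrow> 'x::{banach, second_countable_topology}"
  assumes f: "f \<in> measurable M weak_star_borel" and \<phi>: "\<phi> \<in> borel_measurable M"
    and bd: "AE t in M. norm (f t) \<le> h t" and int: "integrable M (\<lambda>t. h t * norm (\<phi> t))"
  shows "\<bar>\<integral>t. blinfun_apply (f t) (\<phi> t) \<partial>M\<bar> \<le> (\<integral>t. h t * norm (\<phi> t) \<partial>M)"
proof -
  have "\<bar>\<integral>t. blinfun_apply (f t) (\<phi> t) \<partial>M\<bar> \<le> (\<integral>t. \<bar>blinfun_apply (f t) (\<phi> t)\<bar> \<partial>M)"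
    using integral_norm_bound[of M "\<lambda>t. blinfun_apply (f t) (\<phi> t)"] by simp
  also have "\<dots> \<le> (\<integral>t. h t * norm (\<phi> t) \<partial>M)"
  proof (rule integral_mono_AE[OF _ int])
    show "integrable M (\<lambda>t. \<bar>blinfun_apply (f t) (\<phi> t)\<bar>)"
      using integrable_pairing[OF f \<phi> bd int] by simp
    show "AE t in M. \<bar>blinfun_apply (f t) (\<phi> t)\<bar> \<le> h t * norm (\<phi> t)"
      using bd by eventually_elim (rule abs_blinfun_le)
  qed
  finally show ?thesis .
qed

lemma gelfand_integrable_bounded:
  fixes f :: "'t \<Rightarrow> 'x::{banach, second_countable_topology} \<Rightarrow>\<^sub>L real"
  assumes f: "f \<in> measurable M weak_star_borel" and bd: "AE t in M. norm (f t) \<le> h t" and int: "integrable M h"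
  shows "integrable M (\<lambda>t. blinfun_apply (f t) x)" "(\<integral>t. \<bar>blinfun_apply (f t) x\<bar> \<partial>M) \<le> (\<integral>t. h t \<partial>M) * norm x"
proof -
  show 1: "integrable M (\<lambda>t. blinfun_apply (f t) x)"
    by (rule integrable_pairing[OF f _ bd]) (use int in auto)
  have "(\<integral>t. \<bar>blinfun_apply (f t) x\<bar> \<partial>M) \<le> (\<integral>t. h t * norm x \<partial>M)"
  proof (rule integral_mono_AE)
    show "AE t in M. \<bar>blinfun_apply (f t) x\<bar> \<le> h t * norm x"
      using bd by eventually_elim (rule abs_blinfun_le)
  qed (use 1 int in auto)
  then show "(\<integral>t. \<bar>blinfun_apply (f t) x\<bar> \<partial>M) \<le> (\<integral>t. h t \<partial>M) * norm x" by simp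
qed

text \<open>The induction for Bochner integrable functions is run on the measure with density
  \<open>w\<close> restricted to \<open>G\<close>. Integrability for that measure is integrability
  of \<open>w * norm \<phi>\<close>, the quantity that bounds a pairing, and the bound by
  \<open>2 * norm (\<phi> t)\<close> supplies a majorant in each limit step.\<close>

lemma pairing_induct [consumes 5, case_names indicator add limit]:
  fixes \<phi> :: "'t \<Rightarrow> 'x::{banach, second_countable_topology}"
  assumes G: "subalgebra M G" and w: "integrable M w" "\<And>t. 0 \<le> w t"
    and \<phi>: "\<phi> \<in> borel_measurable G" "integrable M (\<lambda>t. w t * norm (\<phi> t))"
    and base: "\<And>B x. B \<in> sets G \<Longrightarrow> P (\<lambda>t. indicat_real B t *\<^sub>R x)"
    and add: "\<And>\<phi> \<psi>. \<phi> \<in> borel_measurable G \<Longrightarrow> \<psi> \<in> borel_measurable G \<Longrightarrow>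
      integrable M (\<lambda>t. w t * norm (\<phi> t)) \<Longrightarrow> integrable M (\<lambda>t. w t * norm (\<psi> t)) \<Longrightarrow>
      P \<phi> \<Longrightarrow> P \<psi> \<Longrightarrow> P (\<lambda>t. \<phi> t + \<psi> t)"
    and limit: "\<And>\<phi> s. \<phi> \<in> borel_measurable G \<Longrightarrow> (\<And>i. s i \<in> borel_measurable G) \<Longrightarrow>
      integrable M (\<lambda>t. w t * norm (\<phi> t)) \<Longrightarrow> (\<And>i. integrable M (\<lambda>t. w t * norm (s i t))) \<Longrightarrow>
      (\<And>t. t \<in> space M \<Longrightarrow> (\<lambda>i. s i t) \<longlonglongrightarrow> \<phi> t) \<Longrightarrow>
      (\<And>i t. t \<in> space M \<Longrightarrow> norm (s i t) \<le> 2 * norm (\<phi> t)) \<Longrightarrow>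
      (\<And>i. P (s i)) \<Longrightarrow> P \<phi>"
  shows "P \<phi>"
proof -
  let ?w = "density M (\<lambda>t. ennreal (w t))"
  let ?N = "restr_to_subalg ?w G"
  have G': "subalgebra ?w G" using G by (simp add: subalgebra_def)
  have [measurable]: "w \<in> borel_measurable M" using w(1) by auto
  have iff: "integrable ?N \<psi> \<longleftrightarrow> integrable M (\<lambda>t. w t * norm (\<psi> t))" if \<psi>: "\<psi> \<in> borel_measurable G" for \<psi> :: "'t \<Rightarrow> 'x"
  proof -
    have [measurable]: "\<psi> \<in> borel_measurable M" by (rule measurable_from_subalg[OF G \<psi>])
    have "integrable ?N \<psi> \<longleftrightarrow> integrable ?w \<psi>"
      using integrable_in_subalg[OF G' \<psi>] integrable_from_subalg[OF G', of \<psi>] by blast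
    also have "\<dots> \<longleftrightarrow> integrable M (\<lambda>t. w t *\<^sub>R \<psi> t)"
      using w(2) by (intro integrable_density) auto
    also have "\<dots> \<longleftrightarrow> integrable M (\<lambda>t. norm (w t *\<^sub>R \<psi> t))"
      by (rule integrable_norm_iff[symmetric]) measurable
    finally show ?thesis using w(2) by simp
  qed
  have meas: "\<psi> \<in> borel_measurable G" if "integrable ?N \<psi>" for \<psi> :: "'t \<Rightarrow> 'x"
    by (rule measurable_in_subalg'[OF G']) (use that in auto)
  have sp: "space ?N = space M" by (simp add: space_restr_to_subalg)
  have "integrable ?N \<phi>" using iff[OF \<phi>(1)] \<phi>(2) by simp
  then show ?thesis
  proof (induction rule: integrable_induct)
    case (base A c)
    then show ?case using assms(6) sets_restr_to_subalg[OF G'] by auto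
  next
    case (add f g)
    then show ?case using assms(7)[OF meas meas] iff[OF meas] by blast
  next
    case (lim f s)
    show ?case
      by (rule limit[OF meas[OF lim(4)] meas[OF lim(1)]])
        (use lim iff[OF meas[OF lim(4)]] iff[OF meas[OF lim(1)]] sp in auto)
  qed
qed

lemma limit_integral_pairing:
  fixes \<phi> :: "'t \<Rightarrow> 'x::{banach, second_countable_topology}"
  assumes w: "integrable M (\<lambda>t. w t * norm (\<phi> t))" "\<And>t. 0 \<le> w t" "w \<in> borel_measurable M"
    and meas: "\<phi> \<in> borel_measurable M" "\<And>i. s i \<in> borel_measurable M"
    and lim: "\<And>t. t \<in> space M \<Longrightarrow> (\<lambda>i. s i t) \<longlonglongrightarrow> \<phi> t"
    and dom: "\<And>i t. t \<in> space M \<Longrightarrow> norm (s i t) \<le> 2 * norm (\<phi> t)"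
  shows "(\<lambda>i. \<integral>t. w t * norm (s i t - \<phi> t) \<partial>M) \<longlonglongrightarrow> 0"
    and "integrable M (\<lambda>t. w t * norm (s i t - \<phi> t))"
proof -
  note [measurable] = w(3) meas
  have b: "norm (w t * norm (s i t - \<phi> t)) \<le> 3 * (w t * norm (\<phi> t))" if "t \<in> space M" for i t
  proof -
    have "norm (s i t - \<phi> t) \<le> 3 * norm (\<phi> t)"
      using norm_triangle_ineq4[of "s i t" "\<phi> t"] dom[OF that, of i] by simp
    from mult_left_mono[OF this w(2)] w(2) show ?thesis by (simp add: mult.left_commute)
  qed
  have "(\<lambda>i. \<integral>t. w t * norm (s i t - \<phi> t) \<partial>M) \<longlonglongrightarrow> (\<integral>t. 0 \<partial>M)"
  proof (rule integral_dominated_convergence[where w = "\<lambda>t. 3 * (w t * norm (\<phi> t))"])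
    show "AE t in M. (\<lambda>i. w t * norm (s i t - \<phi> t)) \<longlonglongrightarrow> 0"
    proof (rule AE_I2)
      fix t assume "t \<in> space M"
      then have "(\<lambda>i. w t * norm (s i t - \<phi> t)) \<longlonglongrightarrow> w t * norm (\<phi> t - \<phi> t)" by (intro tendsto_intros lim)
      then show "(\<lambda>i. w t * norm (s i t - \<phi> t)) \<longlonglongrightarrow> 0" by simp
    qed
  qed (use w b in auto)
  then show "(\<lambda>i. \<integral>t. w t * norm (s i t - \<phi> t) \<partial>M) \<longlonglongrightarrow> 0" by simp
  show "integrable M (\<lambda>t. w t * norm (s i t - \<phi> t))"
  proof (rule Bochner_Integration.integrable_bound[where f = "\<lambda>t. 3 * (w t * norm (\<phi> t))"])
    show "AE t in M. norm (w t * norm (s i t - \<phi> t)) \<le> norm (3 * (w t * norm (\<phi> t)))"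
    proof (rule AE_I2)
      fix t assume "t \<in> space M"
      from b[OF this, of i] show "norm (w t * norm (s i t - \<phi> t)) \<le> norm (3 * (w t * norm (\<phi> t)))"
        by (rule order_trans) simp
    qed
  qed (use w in auto)
qed

lemma integral_pairing_diff_le:
  fixes \<phi> \<psi> :: "'t \<Rightarrow> 'x::{banach, second_countable_topology}"
  assumes f: "f \<in> measurable M weak_star_borel" "AE t in M. norm (f t) \<le> w t"
    and meas: "\<phi> \<in> borel_measurable M" "\<psi> \<in> borel_measurable M"
    and int: "integrable M (\<lambda>t. w t * norm (\<phi> t))" "integrable M (\<lambda>t. w t * norm (\<psi> t))" "integrable M (\<lambda>t. w t * norm (\<psi> t - \<phi> t))"
  shows "\<bar>(\<integral>t. blinfun_apply (f t) (\<psi> t) \<partial>M) - (\<integral>t. blinfun_apply (f t) (\<phi> t) \<partial>M)\<bar> \<le> (\<integral>t. w t * norm (\<psi> t - \<phi> t) \<partial>M)"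
proof -
  have "(\<integral>t. blinfun_apply (f t) (\<psi> t) \<partial>M) - (\<integral>t. blinfun_apply (f t) (\<phi> t) \<partial>M) = (\<integral>t. blinfun_apply (f t) (\<psi> t - \<phi> t) \<partial>M)"
    using integrable_pairing[OF f(1) meas(1) f(2) int(1)] integrable_pairing[OF f(1) meas(2) f(2) int(2)]
    by (simp add: blinfun.diff_right)
  then show ?thesis using integral_pairing_le[OF f(1) _ f(2) int(3)] meas by simp
qed

lemma integral_pairing_eq:
  fixes f1 f2 :: "'t \<Rightarrow> 'x::{banach, second_countable_topology} \<Rightarrow>\<^sub>L real"
  assumes G: "subalgebra M G"
    and f1: "f1 \<in> measurable M weak_star_borel" "AE t in M. norm (f1 t) \<le> h1 t"
    and f2: "f2 \<in> measurable M weak_star_borel" "AE t in M. norm (f2 t) \<le> h2 t"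
    and h: "integrable M h1" "integrable M h2" "\<And>t. 0 \<le> h1 t" "\<And>t. 0 \<le> h2 t"
    and eq: "\<And>B x. B \<in> sets G \<Longrightarrow> (\<integral>t\<in>B. blinfun_apply (f1 t) x \<partial>M) = (\<integral>t\<in>B. blinfun_apply (f2 t) x \<partial>M)"
    and \<phi>: "\<phi> \<in> borel_measurable G" "integrable M (\<lambda>t. h1 t * norm (\<phi> t))" "integrable M (\<lambda>t. h2 t * norm (\<phi> t))"
  shows "(\<integral>t. blinfun_apply (f1 t) (\<phi> t) \<partial>M) = (\<integral>t. blinfun_apply (f2 t) (\<phi> t) \<partial>M)"
proof -
  \<comment> \<open>A common weight dominates both functions, so that one induction treats them
    together.\<close>
  define w where "w t = h1 t + h2 t" for t
  have w: "integrable M w" "\<And>t. 0 \<le> w t" using h by (auto simp: w_def[abs_def])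
  have f1w: "AE t in M. norm (f1 t) \<le> w t" using f1(2) by eventually_elim (simp add: w_def add_increasing2 h)
  have f2w: "AE t in M. norm (f2 t) \<le> w t" using f2(2) by eventually_elim (simp add: w_def add_increasing h)
  have "integrable M (\<lambda>t. w t * norm (\<phi> t))" using \<phi>(2,3) by (simp add: w_def ring_distribs)
  from G w \<phi>(1) this show ?thesis
  proof (induction rule: pairing_induct)
    case (indicator B x)
    then show ?case using eq[OF indicator(1), of x] by (simp add: set_lebesgue_integral_def blinfun.scaleR_right)
  next
    case (add \<phi> \<psi>)
    note m = measurable_from_subalg[OF G add(1)] measurable_from_subalg[OF G add(2)]
    show ?case
      using integrable_pairing[OF f1(1) m(1) f1w add(3)] integrable_pairing[OF f1(1) m(2) f1w add(4)]
        integrable_pairing[OF f2(1) m(1) f2w add(3)] integrable_pairing[OF f2(1) m(2) f2w add(4)] add(5,6)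
      by (simp add: blinfun.add_right)
  next
    case (limit \<phi> s)
    note m = measurable_from_subalg[OF G limit(1)] measurable_from_subalg[OF G limit(2)]
    note L = limit_integral_pairing[OF limit(3) w(2) borel_measurable_integrable[OF w(1)] m limit(5,6)]
    have c: "(\<lambda>i. \<integral>t. blinfun_apply (f t) (s i t) \<partial>M) \<longlonglongrightarrow> (\<integral>t. blinfun_apply (f t) (\<phi> t) \<partial>M)"
      if "f \<in> measurable M weak_star_borel" "AE t in M. norm (f t) \<le> w t" for f
      using integral_pairing_diff_le[OF that m(1) m(2) limit(3,4) L(2)]
      by (intro Lim_null_comparison[OF always_eventually L(1), THEN LIM_zero_cancel]) auto
    show ?case using c[OF f1(1) f1w] c[OF f2(1) f2w] limit(7) LIMSEQ_unique by auto
  qed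
qed

subsection \<open>Gel'fand conditional expectations\<close>

lemma (in finite_measure_subalgebra) real_cond_exp_apply_bound:
  fixes f :: "'a \<Rightarrow> 'x::{banach, second_countable_topology} \<Rightarrow>\<^sub>L real"
  assumes f: "f \<in> measurable M weak_star_borel"
    and bd: "AE t in M. norm (f t) \<le> h t" and h: "integrable M h"
  shows "AE t in M. \<bar>real_cond_exp M F (\<lambda>t. blinfun_apply (f t) x) t\<bar> \<le> real_cond_exp M F h t * norm x"
proof -
  note i = gelfand_integrable_bounded(1)[OF f bd h]
  have "AE t in M. \<bar>blinfun_apply (f t) x\<bar> \<le> h t * norm x"
    using bd by eventually_elim (rule abs_blinfun_le)
  then have ub: "AE t in M. blinfun_apply (f t) x \<le> norm x * h t" "AE t in M. - norm x * h t \<le> blinfun_apply (f t) x"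
    by (eventually_elim, simp add: mult.commute abs_le_iff)+
  have ih: "integrable M (\<lambda>t. c * h t)" for c using h by simp
  show ?thesis
    using real_cond_exp_cmult[OF h, of "norm x"] real_cond_exp_cmult[OF h, of "- norm x"]
      real_cond_exp_mono[OF ub(1) i ih] real_cond_exp_mono[OF ub(2) ih i]
    by eventually_elim (simp add: abs_le_iff mult.commute)
qed

context threshold_enumeration
begin

text \<open>Each point of the countable set \<open>D\<close> contributes one null set, so the scalar
  bounds hold simultaneously. The maximum with 0 is taken since a version of the conditional
  expectation of \<open>h\<close> is nonnegative only almost everywhere.\<close>

lemma gelfand_cond_exp_bound:
  assumes P: "prob_space M" and G: "subalgebra M G" and f: "f \<in> measurable M weak_star_borel"
    and bd: "AE t in M. norm (f t) \<le> h t" and h: "integrable M h" "\<And>t. 0 \<le> h t"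
    and g: "gelfand_cond_exp M G f (g :: 't \<Rightarrow> 'x \<Rightarrow>\<^sub>L real)"
  shows "AE t in M. norm (g t) \<le> max 0 (real_cond_exp M G h t)"
proof -
  interpret prob_space M by fact
  interpret G: finite_measure_subalgebra M G by unfold_locales (rule G)
  note i = gelfand_integrable_bounded(1)[OF f bd h(1)]
  have gm: "g \<in> measurable G weak_star_borel" and gi: "\<And>x. integrable M (\<lambda>t. blinfun_apply (g t) x)"
    using g by (auto simp: gelfand_cond_exp_def gelfand_integrable_def)
  have "AE t in M. \<bar>blinfun_apply (g t) d\<bar> \<le> real_cond_exp M G h t * norm d" for d
  proof -
    have 1: "AE t in M. real_cond_exp M G (\<lambda>t. blinfun_apply (f t) d) t = blinfun_apply (g t) d"
    proof (rule G.real_cond_exp_charact[OF _ i gi measurable_apply_weak_star[OF gm]])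
      show "(\<integral>t\<in>B. blinfun_apply (f t) d \<partial>M) = (\<integral>t\<in>B. blinfun_apply (g t) d \<partial>M)" if "B \<in> sets G" for B
        using g that by (auto simp: gelfand_cond_exp_def gelfand_integral_def fun_eq_iff)
    qed
    from G.real_cond_exp_apply_bound[OF f bd h(1), of d] 1 show ?thesis by eventually_elim simp
  qed
  then have "AE t in M. \<forall>d\<in>D. \<bar>blinfun_apply (g t) d\<bar> \<le> real_cond_exp M G h t * norm d"
    using countable_D by (simp add: AE_ball_countable)
  then show ?thesis
  proof eventually_elim
    case (elim t)
    have "\<bar>blinfun_apply (g t) d\<bar> \<le> max 0 (real_cond_exp M G h t) * norm d" if "d \<in> D" for d
      using elim[rule_format, OF that] mult_right_mono[OF max.cobounded2[of "real_cond_exp M G h t" 0] norm_ge_zero[of d]]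
      by linarith
    then show ?case by (subst norm_le_iff_D) auto
  qed
qed

text \<open>Scalar conditional expectations are taken at the countably many points of
  \<open>D\<close>. Off a null set they are additive in the point and bounded through the
  conditional expectation of \<open>h\<close>, so they extend to one functional for each
  \<open>t\<close>.\<close>

lemma ex_gelfand_cond_exp:
  assumes P: "prob_space M" and G: "subalgebra M G" and f: "f \<in> measurable M weak_star_borel"
    and bd: "AE t in M. norm (f t) \<le> h t" and h: "integrable M h" "\<And>t. 0 \<le> h t"
  shows "\<exists>g. gelfand_cond_exp M G f (g :: 't \<Rightarrow> 'x \<Rightarrow>\<^sub>L real)"
proof -
  interpret prob_space M by fact
  interpret G: finite_measure_subalgebra M G by unfold_locales (rule G)
  note i = gelfand_integrable_bounded[OF f bd h(1)]
  define U where "U d = real_cond_exp M G (\<lambda>t. blinfun_apply (f t) d)" for d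
  define H where "H t = max 0 (real_cond_exp M G h t)" for t
  have Um [measurable]: "U d \<in> borel_measurable G" for d by (simp add: U_def)
  have Hm [measurable]: "H \<in> borel_measurable G" by (simp add: H_def[abs_def])
  \<comment> \<open>These are countably many conditions on \<open>G\<close>-measurable functions, so
    the good points form a set of \<open>G\<close>, and putting \<open>g\<close> to 0 elsewhere
    keeps it \<open>G\<close>-measurable.\<close>
  define good where "good t \<longleftrightarrow> (\<forall>d\<in>D. \<bar>U d t\<bar> \<le> H t * norm d) \<and> (\<forall>d\<in>D. \<forall>d'\<in>D. U (d + d') t = U d t + U d' t)" for t
  have spG: "space G = space M" using G by (simp add: subalgebra_def)
  have gset: "{t\<in>space G. good t} \<in> sets G"
    unfolding good_def by (intro sets.sets_Collect_conj sets.sets_Collect_countable_All' countable_D) measurable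
  have Ub: "AE t in M. \<bar>U d t\<bar> \<le> H t * norm d" for d
  proof -
    have "AE t in M. \<bar>U d t\<bar> \<le> real_cond_exp M G h t * norm d"
      unfolding U_def by (rule G.real_cond_exp_apply_bound[OF f bd h(1)])
    then show ?thesis
    proof eventually_elim
      case (elim t)
      have "real_cond_exp M G h t * norm d \<le> H t * norm d" by (intro mult_right_mono) (auto simp: H_def)
      then show ?case using elim by simp
    qed
  qed
  have Ua: "AE t in M. U (d + d') t = U d t + U d' t" for d d'
  proof -
    have "AE t in M. real_cond_exp M G (\<lambda>t. blinfun_apply (f t) d + blinfun_apply (f t) d') t = U d t + U d' t"
      unfolding U_def by (rule G.real_cond_exp_add[OF i(1) i(1)])
    then show ?thesis by (simp add: U_def blinfun.add_right)
  qed
  have good: "AE t in M. good t"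
    unfolding good_def using Ub Ua countable_D by (simp add: AE_ball_countable)
  have "\<exists>\<xi>. norm \<xi> \<le> H t \<and> (\<forall>d\<in>D. blinfun_apply \<xi> d = U d t)" if "good t" for t
    using that unfolding good_def by (intro additive_extension) (auto simp: H_def)
  then obtain \<xi> where \<xi>: "\<And>t. good t \<Longrightarrow> norm (\<xi> t) \<le> H t \<and> (\<forall>d\<in>D. blinfun_apply (\<xi> t) d = U d t)" by metis
  define g where "g t = (if good t then \<xi> t else 0)" for t
  have gm: "g \<in> measurable G weak_star_borel"
  proof (rule measurable_weak_starI)
    fix d assume d: "d \<in> D"
    have "(\<lambda>t. if good t then U d t else 0) \<in> borel_measurable G"
      using gset by (intro measurable_If) (auto simp: pred_def)
    also have "(\<lambda>t. if good t then U d t else 0) = (\<lambda>t. blinfun_apply (g t) d)"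
      using \<xi> d by (auto simp: g_def)
    finally show "(\<lambda>t. blinfun_apply (g t) d) \<in> borel_measurable G" .
  qed
  have gM: "g \<in> measurable M weak_star_borel" by (rule measurable_from_subalg[OF G gm])
  have gb: "AE t in M. norm (g t) \<le> H t" using good by eventually_elim (use \<xi> in \<open>simp add: g_def\<close>)
  have Hi: "integrable M H" unfolding H_def[abs_def] using G.real_cond_exp_int(1)[OF h(1)] by simp
  note gi = gelfand_integrable_bounded[OF gM gb Hi]
  have "(\<integral>t\<in>B. blinfun_apply (f t) x \<partial>M) = (\<integral>t\<in>B. blinfun_apply (g t) x \<partial>M)" if B: "B \<in> sets G" for B x
  proof -
    have BM: "B \<in> sets M" using B G by (auto simp: subalgebra_def)
    obtain d where d: "\<And>n. d n \<in> D" "d \<longlonglongrightarrow> x" using seq_D[of x] by blast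
    have "(\<integral>t\<in>B. blinfun_apply (f t) (d n) \<partial>M) = (\<integral>t\<in>B. blinfun_apply (g t) (d n) \<partial>M)" for n
    proof -
      have "(\<integral>t\<in>B. blinfun_apply (f t) (d n) \<partial>M) = (\<integral>t\<in>B. U (d n) t \<partial>M)"
        unfolding U_def by (rule G.real_cond_exp_intA[OF i(1) B])
      also have "\<dots> = (\<integral>t\<in>B. blinfun_apply (g t) (d n) \<partial>M)"
      proof (rule set_lebesgue_integral_cong_AE[OF BM])
        show "U (d n) \<in> borel_measurable M" by (rule measurable_from_subalg[OF G Um])
        show "(\<lambda>t. blinfun_apply (g t) (d n)) \<in> borel_measurable M" by (rule measurable_apply_weak_star[OF gM])
        show "AE t\<in>B in M. U (d n) t = blinfun_apply (g t) (d n)"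
          using good by eventually_elim (use \<xi> d(1) in \<open>simp add: g_def\<close>)
      qed
      finally show ?thesis .
    qed
    with gelfand_tendsto_set_integral[OF i BM d(2)] gelfand_tendsto_set_integral[OF gi BM d(2)]
    show ?thesis using LIMSEQ_unique by auto
  qed
  then have "gelfand_cond_exp M G f g"
    unfolding gelfand_cond_exp_def gelfand_integral_def gelfand_integrable_def using gm gi(1) by auto
  then show ?thesis by blast
qed

lemma gelfand_cond_exp_pairing:
  assumes P: "prob_space M" and G: "subalgebra M G" and f: "f \<in> measurable M weak_star_borel"
    and bd: "AE t in M. norm (f t) \<le> h t" and h: "integrable M h" "\<And>t. 0 \<le> h t"
    and g: "gelfand_cond_exp M G f (g :: 't \<Rightarrow> 'x \<Rightarrow>\<^sub>L real)"
    and \<phi>: "\<phi> \<in> borel_measurable G" "integrable M (\<lambda>t. h t * norm (\<phi> t))"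
  shows "integrable M (\<lambda>t. blinfun_apply (g t) (\<phi> t))"
    and "(\<integral>t. blinfun_apply (g t) (\<phi> t) \<partial>M) = (\<integral>t. blinfun_apply (f t) (\<phi> t) \<partial>M)"
proof -
  interpret prob_space M by fact
  interpret G: finite_measure_subalgebra M G by unfold_locales (rule G)
  let ?H = "\<lambda>t. max 0 (real_cond_exp M G h t)"
  have gM: "g \<in> measurable M weak_star_borel"
    by (rule measurable_from_subalg[OF G]) (use g in \<open>simp add: gelfand_cond_exp_def\<close>)
  \<comment> \<open>\<open>norm \<phi>\<close> is \<open>G\<close>-measurable and can be moved
    inside the conditional expectation, so integrability follows from that of
    \<open>h * norm \<phi>\<close>.\<close>
  have "integrable M (\<lambda>t. norm (\<phi> t) * real_cond_exp M G h t)"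
    using \<phi> h by (intro G.real_cond_exp_intg(1)) (auto simp: mult.commute)
  from integrable_max[OF integrable_zero this] have iH: "integrable M (\<lambda>t. ?H t * norm (\<phi> t))"
    by (rule back_subst[of "integrable M"]) (auto simp: max_def mult_le_0_iff mult.commute zero_le_mult_iff)
  have Hi: "integrable M ?H" using G.real_cond_exp_int(1)[OF h(1)] by simp
  note gb = gelfand_cond_exp_bound[OF P G f bd h g]
  show "integrable M (\<lambda>t. blinfun_apply (g t) (\<phi> t))"
    by (rule integrable_pairing[OF gM measurable_from_subalg[OF G \<phi>(1)] gb iH])
  show "(\<integral>t. blinfun_apply (g t) (\<phi> t) \<partial>M) = (\<integral>t. blinfun_apply (f t) (\<phi> t) \<partial>M)"
  proof (rule integral_pairing_eq[OF G gM gb f bd Hi h(1) _ h(2) _ \<phi>(1) iH \<phi>(2)])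
    show "(\<integral>t\<in>B. blinfun_apply (g t) x \<partial>M) = (\<integral>t\<in>B. blinfun_apply (f t) x \<partial>M)" if "B \<in> sets G" for B x
      using g that by (auto simp: gelfand_cond_exp_def gelfand_integral_def fun_eq_iff)
  qed simp
qed

end

subsection \<open>Dependence of integrals on the weights\<close>

text \<open>The number of thresholds \<open>j / N - N\<close> below \<open>r\<close> recovers \<open>r\<close> up to \<open>1 / N\<close> and truncation at \<open>\<plusminus>N\<close>.\<close>

lemma staircase_approx:
  fixes r :: real and N :: nat
  assumes N: "1 \<le> N"
    and lo: "\<And>j. r < real j / real N - real N \<Longrightarrow> b j"
    and hi: "\<And>j. b j \<Longrightarrow> r \<le> real j / real N - real N"
  shows "\<bar>r - ((\<Sum>j<2*N*N. if b j then 0 else 1 / real N) - real N)\<bar> \<le> 1 / real N + max 0 (\<bar>r\<bar> - real N)"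
proof -
  define S where "S = {j. j < 2*N*N \<and> \<not> b j}"
  \<comment> \<open>In this scale, threshold \<open>j\<close> is at most \<open>r\<close> exactly if
    \<open>j \<le> y\<close>. So, apart from ties and the cap \<open>2*N*N\<close>, \<open>S\<close>
    consists of the indices up to \<open>y\<close>.\<close>
  define y where "y = real N * (r + real N)"
  have N0: "0 < real N" using N by simp
  have "(\<Sum>j<2*N*N. if b j then 0 else 1 / real N) = (\<Sum>j\<in>S. 1 / real N)"
    unfolding S_def by (rule sum.mono_neutral_cong_right) auto
  then have T: "(\<Sum>j<2*N*N. if b j then 0 else 1 / real N) = real (card S) / real N" by simp
  have finS: "finite S" unfolding S_def by simp
  have conv: "real j / real N - real N \<le> r \<longleftrightarrow> real j \<le> y" "real j / real N - real N < r \<longleftrightarrow> real j < y" for j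
    using N0 by (simp_all add: y_def field_simps)
  have Sy: "real j \<le> y" if "j \<in> S" for j
    using lo[of j] that conv(1)[of j] by (auto simp: S_def not_less)
  have yS: "j \<in> S" if "j < 2*N*N" "real j < y" for j
    using hi[of j] that conv(2)[of j] by (auto simp: S_def)
  show ?thesis
  proof (cases "y < 0")
    case True
    then have "S = {}" using Sy by force
    moreover have "r + real N < 0" using True N0 by (simp add: y_def mult_less_0_iff)
    ultimately show ?thesis unfolding T using N0 by simp
  next
    case False
    then have y0: "0 \<le> y" by simp
    have "S \<subseteq> {..nat \<lfloor>y\<rfloor>}" using Sy y0 by (auto simp: le_nat_iff le_floor_iff)
    then have "card S \<le> nat \<lfloor>y\<rfloor> + 1" using card_mono[of "{..nat \<lfloor>y\<rfloor>}" S] by simp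
    then have up: "real (card S) \<le> y + 1" using y0 of_int_floor_le[of y] by linarith
    \<comment> \<open>The cap \<open>2*N*N\<close> corresponds to \<open>r = N\<close>; beyond it
      the truncation term takes over the error.\<close>
    define K where "K = min (2*N*N) (nat \<lceil>y\<rceil>)"
    have "{..<K} \<subseteq> S"
    proof
      fix j assume "j \<in> {..<K}"
      then have "j < 2*N*N" "j < nat \<lceil>y\<rceil>" by (auto simp: K_def)
      then show "j \<in> S" by (intro yS) linarith+
    qed
    then have "K \<le> card S" using card_mono[OF finS, of "{..<K}"] by simp
    moreover have "real (2*N*N) \<le> real K \<or> y \<le> real K"
      using real_nat_ceiling_ge[of y] by (simp add: K_def min_def)
    then have "min (real (2*N*N)) y \<le> real K" by (simp only: min_le_iff_disj)
    ultimately have low: "min (real (2*N*N)) y \<le> real (card S)" by linarith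
    have "y / real N = r + real N" using N0 by (simp add: y_def)
    then have up': "real (card S) / real N - real N \<le> r + 1 / real N"
      using divide_right_mono[OF up, of "real N"] by (simp add: add_divide_distrib)
    have "min (real (2*N*N)) y / real N = min (2 * real N) (r + real N)"
      using N0 \<open>y / real N = r + real N\<close> by (simp add: min_def field_simps)
    then have low': "min (real N) r \<le> real (card S) / real N - real N"
      using divide_right_mono[OF low, of "real N"] by (simp add: min_def split: if_splits)
    have "0 < 1 / real N" using N0 by simp
    then show ?thesis unfolding T using up' low' by linarith
  qed
qed

lemma continuous_on_uniform_bound:
  fixes l :: "'a::topological_space \<Rightarrow> real"
  assumes "\<And>n. continuous_on W (f n)" and "\<And>n x. x \<in> W \<Longrightarrow> \<bar>f n x - l x\<bar> \<le> c n" and "c \<longlonglongrightarrow> 0"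
  shows "continuous_on W l"
proof (rule uniform_limit_theorem[of _ f])
  show "uniform_limit W f l sequentially"
  proof (rule uniform_limitI)
    fix \<epsilon> :: real assume "0 < \<epsilon>"
    then have "\<forall>\<^sub>F n in sequentially. c n < \<epsilon>" using assms(3) by (auto dest: order_tendstoD(2))
    then show "\<forall>\<^sub>F n in sequentially. \<forall>x\<in>W. dist (f n x) (l x) < \<epsilon>"
    proof eventually_elim
      case (elim n)
      then show ?case using assms(2)[of _ n] by (fastforce simp: dist_real_def intro: le_less_trans)
    qed
  qed
qed (use assms(1) in auto)

lemma tail_tendsto_0:
  fixes h :: "'t \<Rightarrow> real"
  assumes "prob_space M" "integrable M h" "\<And>t. 0 \<le> h t"
  shows "(\<lambda>N. \<integral>t. 1 / real (Suc N) + max 0 (h t - real (Suc N)) \<partial>M) \<longlonglongrightarrow> 0"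
proof -
  interpret prob_space M by fact
  have [measurable]: "h \<in> borel_measurable M" using assms(2) by auto
  have "(\<lambda>N. \<integral>t. 1 / real (Suc N) + max 0 (h t - real (Suc N)) \<partial>M) \<longlonglongrightarrow> (\<integral>t. 0 \<partial>M)"
  proof (rule integral_dominated_convergence[where w = "\<lambda>t. 1 + h t"])
    show "AE t in M. (\<lambda>N. 1 / real (Suc N) + max 0 (h t - real (Suc N))) \<longlonglongrightarrow> 0"
    proof (rule AE_I2)
      fix t
      obtain k :: nat where k: "h t \<le> real k" using real_arch_simple by blast
      have "\<forall>\<^sub>F N in sequentially. max 0 (h t - real (Suc N)) = 0"
        using k by (intro eventually_sequentiallyI[of k]) auto
      then have "(\<lambda>N. max 0 (h t - real (Suc N))) \<longlonglongrightarrow> 0" by (rule tendsto_eventually)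
      moreover have "(\<lambda>N. 1 / real (Suc N)) \<longlonglongrightarrow> 0" by (intro LIMSEQ_Suc lim_1_over_n)
      ultimately show "(\<lambda>N. 1 / real (Suc N) + max 0 (h t - real (Suc N))) \<longlonglongrightarrow> 0"
        using tendsto_add by fastforce
    qed
    show "AE t in M. norm (1 / real (Suc N) + max 0 (h t - real (Suc N))) \<le> 1 + h t" for N
    proof (rule AE_I2)
      fix t
      have "1 / real (Suc N) \<le> 1" "max 0 (h t - real (Suc N)) \<le> h t" using assms(3)[of t] by auto
      moreover have "0 \<le> 1 / real (Suc N) + max 0 (h t - real (Suc N))" by simp
      ultimately show "norm (1 / real (Suc N) + max 0 (h t - real (Suc N))) \<le> 1 + h t"
        unfolding real_norm_def by linarith
    qed
  qed (use assms(2) in auto)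
  then show ?thesis by simp
qed

section \<open>Staircase sums and continuity in the weights\<close>

context weighted_tree
begin

definition threshold_idx :: "'x \<Rightarrow> real \<Rightarrow> nat" where
  "threshold_idx d q = (SOME n. e n = (d, q))"

lemma threshold_idx: "d \<in> D \<Longrightarrow> q \<in> \<rat> \<Longrightarrow> e (threshold_idx d q) = (d, q)"
  unfolding threshold_idx_def by (erule (1) threshold_index) (rule someI)

text \<open>The thresholds \<open>j / N - N\<close> with \<open>j < 2*N*N\<close> run through [-N,
  N) in steps of 1/N; counting the tests not answered \<open>True\<close> approximates the value,
  and here this count is integrated over \<open>B\<close>. Only finitely many coordinates of
  \<open>m\<close> enter.\<close>

definition staircase :: "(bool list \<times> 't set \<Rightarrow> real) \<Rightarrow> nat \<Rightarrow> 'x \<Rightarrow> 't set \<Rightarrow> real" where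
  "staircase m N d B =
     (\<Sum>j<2*N*N. (prob B - level m (threshold_idx d (real j / real N - real N)) B) / real N) - real N * prob B"

text \<open>The error bound involves \<open>h\<close>, \<open>d\<close> and \<open>N\<close>, but
  neither \<open>f\<close> nor \<open>m\<close>. This uniformity yields both uniqueness and
  continuity of integrals as functions of the weights.\<close>

lemma staircase_estimate:
  assumes f: "realizes f m" "f \<in> measurable M weak_star_borel" "AE t in M. norm (f t) \<le> h t"
    and h: "integrable M h" and d: "d \<in> D" and B: "B \<in> sets F" and N: "1 \<le> N"
  shows "\<bar>(\<integral>t\<in>B. blinfun_apply (f t) d \<partial>M) - staircase m N d B\<bar> \<le> (\<integral>t. 1 / real N + max 0 (h t * norm d - real N) \<partial>M)"
proof -
  obtain L where L: "\<And>n. L n \<in> sets M"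
    "AE t in M. \<forall>n. (blinfun_apply (f t) (fst (e n)) < snd (e n) \<longrightarrow> t \<in> L n) \<and>
        (t \<in> L n \<longrightarrow> blinfun_apply (f t) (fst (e n)) \<le> snd (e n))"
    "\<And>n B. B \<in> sets F \<Longrightarrow> prob (L n \<inter> B) = level m n B"
    using realizes_level[OF f(1)] by blast
  define n where "n j = threshold_idx d (real j / real N - real N)" for j :: nat
  have en: "e (n j) = (d, real j / real N - real N)" for j unfolding n_def by (intro threshold_idx d) simp
  note BM = sets_F_M[OF B]
  define T where "T t = (\<Sum>j<2*N*N. if t \<in> L (n j) then 0 else 1 / real N) - real N" for t
  have close: "AE t in M. \<bar>blinfun_apply (f t) d - T t\<bar> \<le> 1 / real N + max 0 (h t * norm d - real N)"
    using L(2) f(3)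
  proof eventually_elim
    case (elim t)
    have "\<bar>blinfun_apply (f t) d - T t\<bar> \<le> 1 / real N + max 0 (\<bar>blinfun_apply (f t) d\<bar> - real N)"
      unfolding T_def using elim(1)[rule_format, of "n _"] by (intro staircase_approx N) (simp_all add: en)
    also have "\<dots> \<le> 1 / real N + max 0 (h t * norm d - real N)"
      using abs_blinfun_le[OF elim(2), of d] by (intro add_left_mono max.mono) auto
    finally show ?case .
  qed
  have ifd: "integrable M (\<lambda>t. blinfun_apply (f t) d)" by (rule gelfand_integrable_bounded(1)[OF f(2,3) h])
  have [measurable]: "L j \<in> sets M" for j by (rule L(1))
  have ij: "integrable M (\<lambda>t. if t \<in> L j then 0 else 1 / real N)" for j
    by (rule integrable_const_bound[where B = "1 / real N"]) auto
  have iT: "integrable M T" unfolding T_def[abs_def] using ij by auto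
  have "(\<integral>t\<in>B. T t \<partial>M) = staircase m N d B"
  proof -
    have 1: "(\<integral>t\<in>B. (if t \<in> L (n j) then 0 else 1 / real N) \<partial>M) = (prob B - level m (n j) B) / real N" for j
    proof -
      have "(\<integral>t\<in>B. (if t \<in> L (n j) then 0 else 1 / real N) \<partial>M) = (\<integral>t. indicat_real (B - L (n j) \<inter> B) t * (1 / real N) \<partial>M)"
        unfolding set_lebesgue_integral_def by (intro Bochner_Integration.integral_cong) (auto simp: indicator_def)
      also have "\<dots> = prob (B - L (n j) \<inter> B) / real N" using BM by simp
      also have "prob (B - L (n j) \<inter> B) = prob B - prob (L (n j) \<inter> B)"
        using BM by (intro finite_measure_Diff) auto
      finally show ?thesis using L(3)[OF B] by simp
    qed
    have si: "set_integrable M B (\<lambda>t. if t \<in> L (n j) then 0 else 1 / real N)" for j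
      using integrable_mult_indicator[OF BM ij] by (simp add: set_integrable_def)
    have sc: "set_integrable M B (\<lambda>t. real N)"
      using integrable_mult_indicator[OF BM integrable_const[of "real N"]] by (simp add: set_integrable_def)
    have "(\<integral>t\<in>B. T t \<partial>M) = (\<integral>t\<in>B. (\<Sum>j<2*N*N. if t \<in> L (n j) then 0 else 1 / real N) \<partial>M) - (\<integral>t\<in>B. real N \<partial>M)"
      unfolding T_def
    proof (rule set_integral_diff(2)[OF _ sc])
      show "set_integrable M B (\<lambda>t. \<Sum>j<2*N*N. if t \<in> L (n j) then 0 else 1 / real N)"
        unfolding set_integrable_def scaleR_sum_right
        by (intro Bochner_Integration.integrable_sum si[unfolded set_integrable_def])
    qed
    also have "(\<integral>t\<in>B. (\<Sum>j<2*N*N. if t \<in> L (n j) then 0 else 1 / real N) \<partial>M) =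
        (\<Sum>j<2*N*N. \<integral>t\<in>B. (if t \<in> L (n j) then 0 else 1 / real N) \<partial>M)"
      unfolding set_lebesgue_integral_def scaleR_sum_right
      using si by (intro Bochner_Integration.integral_sum) (simp add: set_integrable_def)
    also have "\<dots> = (\<Sum>j<2*N*N. (prob B - level m (n j) B) / real N)" by (simp only: 1)
    also have "(\<integral>t\<in>B. real N \<partial>M) = real N * prob B"
      using BM by (simp add: set_lebesgue_integral_def)
    finally show ?thesis by (simp only: staircase_def n_def)
  qed
  moreover have "(\<integral>t\<in>B. blinfun_apply (f t) d \<partial>M) - (\<integral>t\<in>B. T t \<partial>M) = (\<integral>t\<in>B. blinfun_apply (f t) d - T t \<partial>M)"
    using integrable_mult_indicator[OF BM ifd] integrable_mult_indicator[OF BM iT]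
    by (simp add: set_integrable_def)
  moreover have "\<bar>\<integral>t\<in>B. blinfun_apply (f t) d - T t \<partial>M\<bar> \<le> (\<integral>t. 1 / real N + max 0 (h t * norm d - real N) \<partial>M)"
  proof -
    have i: "integrable M (\<lambda>t. indicator B t *\<^sub>R (blinfun_apply (f t) d - T t))"
      using ifd iT BM by (intro integrable_mult_indicator) auto
    have "\<bar>\<integral>t\<in>B. blinfun_apply (f t) d - T t \<partial>M\<bar> \<le> (\<integral>t. norm (indicator B t *\<^sub>R (blinfun_apply (f t) d - T t)) \<partial>M)"
      unfolding set_lebesgue_integral_def real_norm_def[symmetric] by (rule integral_norm_bound)
    also have "\<dots> \<le> (\<integral>t. 1 / real N + max 0 (h t * norm d - real N) \<partial>M)"
    proof (rule integral_mono_AE)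
      show "AE t in M. norm (indicator B t *\<^sub>R (blinfun_apply (f t) d - T t)) \<le> 1 / real N + max 0 (h t * norm d - real N)"
        using close
      proof eventually_elim
        case (elim t)
        have "0 \<le> 1 / real N + max 0 (h t * norm d - real N)" by simp
        with elim show ?case by (cases "t \<in> B") auto
      qed
    qed (use i h in auto)
    finally show ?thesis .
  qed
  ultimately show ?thesis by simp
qed

lemma staircase_error:
  assumes "integrable M h" "\<And>t. 0 \<le> h t"
  shows "(\<lambda>N. \<integral>t. 1 / real (Suc N) + max 0 (h t * norm (x::'x) - real (Suc N)) \<partial>M) \<longlonglongrightarrow> 0"
  using assms by (intro tail_tendsto_0[OF prob_space_axioms]) simp_all

text \<open>Two realizations are equally close to one and the same staircase, so the weights alone
  determine integrals over sets of \<open>F\<close> at points of \<open>D\<close>, and by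
  approximation all pairings.\<close>

lemma realizes_unique:
  assumes f1: "realizes f1 m" "f1 \<in> measurable M weak_star_borel" "AE t in M. norm (f1 t) \<le> h t"
    and f2: "realizes f2 m" "f2 \<in> measurable M weak_star_borel" "AE t in M. norm (f2 t) \<le> h t"
    and h: "integrable M h" "\<And>t. 0 \<le> h t"
    and \<phi>: "\<phi> \<in> borel_measurable F" "integrable M (\<lambda>t. h t * norm (\<phi> t))"
  shows "(\<integral>t. blinfun_apply (f1 t) (\<phi> t) \<partial>M) = (\<integral>t. blinfun_apply (f2 t) (\<phi> t) \<partial>M)"
proof (rule integral_pairing_eq[OF subalg f1(2,3) f2(2,3) h(1) h(1) h(2) h(2) _ \<phi>(1) \<phi>(2) \<phi>(2)])
  fix B x assume B: "B \<in> sets F"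
  note BM = sets_F_M[OF B]
  have eqD: "(\<integral>t\<in>B. blinfun_apply (f1 t) d \<partial>M) = (\<integral>t\<in>B. blinfun_apply (f2 t) d \<partial>M)" if d: "d \<in> D" for d
  proof -
    let ?a = "(\<integral>t\<in>B. blinfun_apply (f1 t) d \<partial>M)" and ?b = "(\<integral>t\<in>B. blinfun_apply (f2 t) d \<partial>M)"
    let ?e = "\<lambda>N. \<integral>t. 1 / real (Suc N) + max 0 (h t * norm d - real (Suc N)) \<partial>M"
    have bound: "\<bar>?a - ?b\<bar> \<le> 2 * ?e N" for N
      using staircase_estimate[OF f1 h(1) d B, of "Suc N"] staircase_estimate[OF f2 h(1) d B, of "Suc N"] by simp
    have lim: "(\<lambda>N. 2 * ?e N) \<longlonglongrightarrow> 2 * 0" by (intro tendsto_intros staircase_error h)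
    have "\<bar>?a - ?b\<bar> \<le> 2 * 0" by (rule LIMSEQ_le_const[OF lim]) (use bound in blast)
    then show ?thesis by simp
  qed
  obtain d where d: "\<And>n. d n \<in> D" "d \<longlonglongrightarrow> x" using seq_D[of x] by blast
  note l1 = gelfand_tendsto_set_integral[OF gelfand_integrable_bounded[OF f1(2,3) h(1)] BM d(2)]
  note l2 = gelfand_tendsto_set_integral[OF gelfand_integrable_bounded[OF f2(2,3) h(1)] BM d(2)]
  show "(\<integral>t\<in>B. blinfun_apply (f1 t) x \<partial>M) = (\<integral>t\<in>B. blinfun_apply (f2 t) x \<partial>M)"
    using l1 l2 unfolding eqD[OF d(1)] by (rule LIMSEQ_unique)
qed

lemma continuous_on_level: "continuous_on W (\<lambda>m. level m n B)"
  unfolding level_def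
  by (intro continuous_on_sum) (rule continuous_on_subset[OF continuous_on_product_coordinates subset_UNIV])

text \<open>Staircases are continuous in \<open>m\<close> and approximate uniformly on
  \<open>W\<close>. Further uniform limits lead from points of \<open>D\<close> to arbitrary points
  and then to general \<open>\<phi>\<close>.\<close>

lemma continuous_on_pairing:
  fixes k :: "(bool list \<times> 't set \<Rightarrow> real) \<Rightarrow> 't \<Rightarrow> 'x \<Rightarrow>\<^sub>L real"
  assumes k: "\<And>m. m \<in> W \<Longrightarrow> realizes (k m) m" "\<And>m. m \<in> W \<Longrightarrow> k m \<in> measurable M weak_star_borel"
      "\<And>m. m \<in> W \<Longrightarrow> AE t in M. norm (k m t) \<le> h t"
    and h: "integrable M h" "\<And>t. 0 \<le> h t"
    and \<phi>: "\<phi> \<in> borel_measurable F" "integrable M (\<lambda>t. h t * norm (\<phi> t))"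
  shows "continuous_on W (\<lambda>m. \<integral>t. blinfun_apply (k m t) (\<phi> t) \<partial>M)"
  using subalg h \<phi>
proof (induction rule: pairing_induct)
  case (indicator B x)
  note BM = sets_F_M[OF indicator]
  have D: "continuous_on W (\<lambda>m. \<integral>t\<in>B. blinfun_apply (k m t) d \<partial>M)" if d: "d \<in> D" for d
  proof (rule continuous_on_uniform_bound)
    show "continuous_on W (\<lambda>m. staircase m (Suc N) d B)" for N
      unfolding staircase_def by (intro continuous_intros continuous_on_level) auto
    show "\<bar>staircase m (Suc N) d B - (\<integral>t\<in>B. blinfun_apply (k m t) d \<partial>M)\<bar>
        \<le> (\<integral>t. 1 / real (Suc N) + max 0 (h t * norm d - real (Suc N)) \<partial>M)" if "m \<in> W" for N m
      using staircase_estimate[OF k(1)[OF that] k(2)[OF that] k(3)[OF that] h(1) d indicator, of "Suc N"]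
      by (simp add: abs_minus_commute)
  qed (rule staircase_error[OF h])
  obtain d where d: "\<And>n. d n \<in> D" "d \<longlonglongrightarrow> x" using seq_D[of x] by blast
  have "continuous_on W (\<lambda>m. \<integral>t\<in>B. blinfun_apply (k m t) x \<partial>M)"
  proof (rule continuous_on_uniform_bound[OF D[OF d(1)]])
    fix n m assume m: "m \<in> W"
    note i = gelfand_integrable_bounded[OF k(2)[OF m] k(3)[OF m] h(1)]
    have si: "set_integrable M B (\<lambda>t. blinfun_apply (k m t) y)" for y
      using integrable_mult_indicator[OF BM i(1)[of y]] by (simp add: set_integrable_def)
    have "(\<integral>t\<in>B. blinfun_apply (k m t) (d n) \<partial>M) - (\<integral>t\<in>B. blinfun_apply (k m t) x \<partial>M) = (\<integral>t\<in>B. blinfun_apply (k m t) (d n - x) \<partial>M)"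
      using si by (simp add: blinfun.diff_right)
    also have "\<bar>\<dots>\<bar> \<le> (\<integral>t. \<bar>blinfun_apply (k m t) (d n - x)\<bar> \<partial>M)"
      unfolding set_lebesgue_integral_def real_norm_def[symmetric]
      using i(1)[of "d n - x"] si[of "d n - x", unfolded set_integrable_def]
      by (intro order_trans[OF integral_norm_bound] integral_mono) (auto simp: indicator_def)
    also have "\<dots> \<le> (\<integral>t. h t \<partial>M) * norm (d n - x)" by (rule i(2))
    finally show "\<bar>(\<integral>t\<in>B. blinfun_apply (k m t) (d n) \<partial>M) - (\<integral>t\<in>B. blinfun_apply (k m t) x \<partial>M)\<bar> \<le> (\<integral>t. h t \<partial>M) * norm (d n - x)" .
  next
    have "(\<lambda>n. (\<integral>t. h t \<partial>M) * norm (d n - x)) \<longlonglongrightarrow> (\<integral>t. h t \<partial>M) * norm (x - x)" by (intro tendsto_intros d(2))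
    then show "(\<lambda>n. (\<integral>t. h t \<partial>M) * norm (d n - x)) \<longlonglongrightarrow> 0" by simp
  qed
  then show ?case by (simp add: set_lebesgue_integral_def blinfun.scaleR_right)
next
  case (add \<phi> \<psi>)
  note ms = measurable_from_subalg[OF subalg add(1)] measurable_from_subalg[OF subalg add(2)]
  have "(\<integral>t. blinfun_apply (k m t) (\<phi> t + \<psi> t) \<partial>M) = (\<integral>t. blinfun_apply (k m t) (\<phi> t) \<partial>M) + (\<integral>t. blinfun_apply (k m t) (\<psi> t) \<partial>M)"
    if m: "m \<in> W" for m
    using integrable_pairing[OF k(2)[OF m] ms(1) k(3)[OF m] add(3)] integrable_pairing[OF k(2)[OF m] ms(2) k(3)[OF m] add(4)]
    by (simp add: blinfun.add_right)
  with continuous_on_add[OF add(5,6)] show ?case by (subst continuous_on_cong[OF refl]) auto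
next
  case (limit \<phi> s)
  note ms = measurable_from_subalg[OF subalg limit(1)] measurable_from_subalg[OF subalg limit(2)]
  note L = limit_integral_pairing[OF limit(3) h(2) borel_measurable_integrable[OF h(1)] ms limit(5,6)]
  show ?case
    by (rule continuous_on_uniform_bound[OF limit(7) _ L(1)])
      (rule integral_pairing_diff_le[OF k(2) k(3) ms limit(3,4) L(2)])
qed

end

subsection \<open>Integrable bounds and \<open>L_q\<close>\<close>

lemma Lq_spaceD:
  assumes "\<phi> \<in> Lq_space M G q" "subalgebra M G"
  shows "\<phi> \<in> borel_measurable G" "\<phi> \<in> borel_measurable M" "integrable M (\<lambda>t. norm (\<phi> t) powr q)"
proof -
  show G: "\<phi> \<in> borel_measurable G" "integrable M (\<lambda>t. norm (\<phi> t) powr q)"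
    using assms(1) by (simp_all add: Lq_space_def)
  show "\<phi> \<in> borel_measurable M" by (rule measurable_from_subalg[OF assms(2) G(1)])
qed

lemma Lq_space_scaleR: "\<phi> \<in> Lq_space M G q \<Longrightarrow> (\<lambda>t. c *\<^sub>R \<phi> t) \<in> Lq_space M G q"
  by (simp add: Lq_space_def powr_mult borel_measurable_scaleR)

lemma powr_add_le:
  fixes a b q :: real
  assumes "0 \<le> a" "0 \<le> b" "0 < q"
  shows "(a + b) powr q \<le> 2 powr q * (a powr q + b powr q)"
proof -
  have "(a + b) powr q \<le> (2 * max a b) powr q" using assms by (intro powr_mono2) auto
  also have "\<dots> = 2 powr q * max a b powr q" using assms by (simp add: powr_mult)
  also have "\<dots> \<le> 2 powr q * (a powr q + b powr q)" by (intro mult_left_mono) (auto simp: max_def)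
  finally show ?thesis .
qed

lemma Lq_space_add:
  assumes G: "subalgebra M G" and q: "0 < q" and \<phi>: "\<phi> \<in> Lq_space M G q" and \<psi>: "\<psi> \<in> Lq_space M G q"
  shows "(\<lambda>t. \<phi> t + \<psi> t) \<in> Lq_space M G q"
proof -
  note [measurable] = Lq_spaceD(2)[OF \<phi> G] Lq_spaceD(2)[OF \<psi> G]
  have "integrable M (\<lambda>t. norm (\<phi> t + \<psi> t) powr q)"
  proof (rule Bochner_Integration.integrable_bound)
    show "integrable M (\<lambda>t. 2 powr q * (norm (\<phi> t) powr q + norm (\<psi> t) powr q))"
      using Lq_spaceD(3)[OF \<phi> G] Lq_spaceD(3)[OF \<psi> G] by simp
    show "AE t in M. norm (norm (\<phi> t + \<psi> t) powr q) \<le> norm (2 powr q * (norm (\<phi> t) powr q + norm (\<psi> t) powr q))"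
    proof (rule AE_I2)
      fix t
      have "norm (\<phi> t + \<psi> t) powr q \<le> (norm (\<phi> t) + norm (\<psi> t)) powr q"
        using q by (intro powr_mono2 norm_triangle_ineq) auto
      also have "\<dots> \<le> 2 powr q * (norm (\<phi> t) powr q + norm (\<psi> t) powr q)" using q by (intro powr_add_le) auto
      finally show "norm (norm (\<phi> t + \<psi> t) powr q) \<le> norm (2 powr q * (norm (\<phi> t) powr q + norm (\<psi> t) powr q))" by simp
    qed
  qed measurable
  then show ?thesis using \<phi> \<psi> by (auto simp: Lq_space_def)
qed

lemma Lq_space_sum:
  assumes G: "subalgebra M G" and q: "0 < q" and I: "finite I" "\<And>i. i \<in> I \<Longrightarrow> \<phi> i \<in> Lq_space M G q"
  shows "(\<lambda>t. \<Sum>i\<in>I. \<phi> i t) \<in> Lq_space M G q"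
  using I
proof (induction rule: finite_induct)
  case empty
  then show ?case by (simp add: Lq_space_def)
next
  case (insert i I)
  then show ?case using Lq_space_add[OF G q, of "\<phi> i" "\<lambda>t. \<Sum>i\<in>I. \<phi> i t"] by simp
qed

lemma Holder_inequality:
  fixes a b :: "'t \<Rightarrow> real"
  assumes r: "1 < r" "1 < q" "1 / r + 1 / q = 1"
    and ab: "a \<in> borel_measurable M" "b \<in> borel_measurable M" "\<And>t. 0 \<le> a t" "\<And>t. 0 \<le> b t"
    and int: "integrable M (\<lambda>t. a t powr r)" "integrable M (\<lambda>t. b t powr q)"
  shows "integrable M (\<lambda>t. a t * b t)"
    and "(\<integral>t. a t * b t \<partial>M) \<le> (\<integral>t. a t powr r \<partial>M) powr (1 / r) * (\<integral>t. b t powr q \<partial>M) powr (1 / q)"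
proof -
  note [measurable] = ab(1,2)
  have young: "x * y \<le> x powr r / r + y powr q / q" if "0 \<le> x" "0 \<le> y" for x y
    by (rule Youngs_inequality[OF r that])
  show i: "integrable M (\<lambda>t. a t * b t)"
  proof (rule Bochner_Integration.integrable_bound)
    show "integrable M (\<lambda>t. a t powr r / r + b t powr q / q)" using int by simp
    show "AE t in M. norm (a t * b t) \<le> norm (a t powr r / r + b t powr q / q)"
    proof (rule AE_I2)
      fix t
      have "0 \<le> a t * b t" using ab by simp
      then show "norm (a t * b t) \<le> norm (a t powr r / r + b t powr q / q)" using young[OF ab(3,4), of t t] by simp
    qed
  qed measurable
  define A where "A = (\<integral>t. a t powr r \<partial>M)"
  define B where "B = (\<integral>t. b t powr q \<partial>M)"
  have A0: "0 \<le> A" and B0: "0 \<le> B" by (simp_all add: A_def B_def)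
  have null: "(\<integral>t. a t * b t \<partial>M) = 0" if "A = 0 \<or> B = 0"
  proof -
    have "AE t in M. a t = 0 \<or> b t = 0"
      using that
    proof
      assume "A = 0"
      then have "AE t in M. a t powr r = 0"
        using integral_nonneg_eq_0_iff_AE[OF int(1)] by (simp add: A_def)
      then show ?thesis by eventually_elim simp
    next
      assume "B = 0"
      then have "AE t in M. b t powr q = 0"
        using integral_nonneg_eq_0_iff_AE[OF int(2)] by (simp add: B_def)
      then show ?thesis by eventually_elim simp
    qed
    then have "AE t in M. a t * b t = 0" by eventually_elim auto
    then show ?thesis by (rule integral_eq_zero_AE)
  qed
  have "(\<integral>t. a t * b t \<partial>M) \<le> A powr (1 / r) * B powr (1 / q)"
  proof (cases "A = 0 \<or> B = 0")
    case True
    then show ?thesis using null by simp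
  next
    case False
    then have pos: "0 < A" "0 < B" using A0 B0 by auto
    \<comment> \<open>Scaling both factors to norm 1 lets Young's inequality integrate to
      \<open>1 / r + 1 / q = 1\<close>.\<close>
    define \<alpha> where "\<alpha> = A powr (1 / r)"
    define \<beta> where "\<beta> = B powr (1 / q)"
    have \<alpha>: "0 < \<alpha>" "\<alpha> powr r = A" using pos r by (auto simp: \<alpha>_def powr_powr)
    have \<beta>: "0 < \<beta>" "\<beta> powr q = B" using pos r by (auto simp: \<beta>_def powr_powr)
    have "(\<integral>t. (a t / \<alpha>) * (b t / \<beta>) \<partial>M) \<le> (\<integral>t. a t powr r / A / r + b t powr q / B / q \<partial>M)"
    proof (rule integral_mono)
      show "integrable M (\<lambda>t. a t / \<alpha> * (b t / \<beta>))" using i by simp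
      show "integrable M (\<lambda>t. a t powr r / A / r + b t powr q / B / q)" using int by simp
      show "a t / \<alpha> * (b t / \<beta>) \<le> a t powr r / A / r + b t powr q / B / q" for t
        using young[of "a t / \<alpha>" "b t / \<beta>"] ab(3,4)[of t] \<alpha> \<beta> by (simp add: powr_divide)
    qed
    also have "\<dots> = A / A / r + B / B / q" using int by (simp add: A_def B_def)
    also have "\<dots> = 1" using pos r(3) by simp
    also have "(\<integral>t. (a t / \<alpha>) * (b t / \<beta>) \<partial>M) = (\<integral>t. a t * b t \<partial>M) / (\<alpha> * \<beta>)" by simp
    finally have "(\<integral>t. a t * b t \<partial>M) \<le> \<alpha> * \<beta>" using \<alpha> \<beta> by (simp add: divide_le_eq)
    then show ?thesis by (simp add: \<alpha>_def \<beta>_def)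
  qed
  then show "(\<integral>t. a t * b t \<partial>M) \<le> (\<integral>t. a t powr r \<partial>M) powr (1 / r) * (\<integral>t. b t powr q \<partial>M) powr (1 / q)"
    by (simp add: A_def B_def)
qed

text \<open>One weight \<open>h\<close> and one constant \<open>K\<close> absorb the distinction
  between finite and infinite \<open>p\<close>. For finite \<open>p\<close> they come from
  H\<o>lder's inequality; for infinite \<open>p\<close> a single constant serves as both.\<close>

lemma integrably_bounded_conjugate:
  fixes \<Phi> :: "'t \<Rightarrow> ('x::{banach, second_countable_topology} \<Rightarrow>\<^sub>L real) set"
  assumes P: "prob_space M" and p: "1 < p" and q: "1 / p + 1 / ereal q = 1" and bd: "integrably_bounded M p \<Phi>"
  shows "\<exists>h K. 1 \<le> q \<and> 0 \<le> K \<and> integrable M h \<and> (\<forall>t. 0 \<le> h t) \<and> (AE t in M. \<forall>\<xi>\<in>\<Phi> t. norm \<xi> \<le> h t) \<and>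
    (\<forall>\<phi> :: 't \<Rightarrow> 'x. \<phi> \<in> borel_measurable M \<longrightarrow> integrable M (\<lambda>t. norm (\<phi> t) powr q) \<longrightarrow>
       integrable M (\<lambda>t. h t * norm (\<phi> t)) \<and> (\<integral>t. h t * norm (\<phi> t) \<partial>M) \<le> K * Lq_norm M q \<phi>)"
proof -
  interpret prob_space M by fact
  obtain h0 where h0: "h0 \<in> borel_measurable M"
      "if p = \<infinity> then \<exists>c. AE t in M. \<bar>h0 t\<bar> \<le> c else integrable M (\<lambda>t. h0 t powr real_of_ereal p)"
      "AE t in M. (SUP \<xi>\<in>\<Phi> t. ereal (norm \<xi>)) \<le> ereal (h0 t)"
    using bd unfolding integrably_bounded_def by blast
  have dom: "AE t in M. \<forall>\<xi>\<in>\<Phi> t. norm \<xi> \<le> h0 t"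
    using h0(3) by eventually_elim (simp add: SUP_le_iff)
  \<comment> \<open>In the extended reals 1/0 is infinite, which the conjugacy equation excludes;
    with \<open>q\<close> nonzero the reciprocal is that of the real number.\<close>
  have q_nz: "q \<noteq> 0"
  proof
    assume "q = 0"
    then have "1 / ereal q = \<infinity>" by (simp add: divide_ereal_def)
    moreover have "1 / p \<ge> 0" using p by (cases p) (auto simp: divide_ereal_def one_ereal_def)
    ultimately have "1 / p + 1 / ereal q = \<infinity>" by (cases "1 / p") auto
    then show False using q by simp
  qed
  then have q_div: "1 / ereal q = ereal (1 / q)" by (simp add: divide_ereal_def one_ereal_def inverse_eq_divide)
  show ?thesis
  proof (cases "p = \<infinity>")
    case True
    then have "ereal (1 / q) = 1" using q q_div by (simp add: divide_ereal_def)
    then have q1: "q = 1" using q_nz by (simp add: one_ereal_def)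
    obtain c where c: "AE t in M. \<bar>h0 t\<bar> \<le> c" using h0(2) True by auto
    define K where "K = max 0 c"
    have "AE t in M. \<forall>\<xi>\<in>\<Phi> t. norm \<xi> \<le> K"
      using dom c by eventually_elim (force simp: K_def)
    then show ?thesis
      using q1 by (intro exI[of _ "\<lambda>_. K"] exI[of _ K]) (auto simp: K_def Lq_norm_def)
  next
    case False
    then obtain r where r: "p = ereal r" "1 < r" using p by (cases p) auto
    then have "1 / p = ereal (1 / r)" by (simp add: divide_ereal_def one_ereal_def inverse_eq_divide)
    then have rq: "1 / r + 1 / q = 1" using q q_div by (simp add: one_ereal_def)
    then have "1 / q = 1 - 1 / r" by simp
    moreover have "0 < 1 - 1 / r" "1 - 1 / r < 1" using r(2) by auto
    ultimately have "0 < 1 / q" "1 / q < 1" by auto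
    then have "0 < q" by (simp add: zero_less_divide_iff)
    with \<open>1 / q < 1\<close> have q1: "1 < q" by (simp add: divide_less_eq)
    define h where "h t = max 0 (h0 t)" for t
    have hm: "h \<in> borel_measurable M" unfolding h_def[abs_def] using h0(1) by measurable
    have ihr: "integrable M (\<lambda>t. h t powr r)"
    proof (rule Bochner_Integration.integrable_bound)
      show "integrable M (\<lambda>t. h0 t powr r)" using h0(2) False r by simp
      show "AE t in M. norm (h t powr r) \<le> norm (h0 t powr r)" by (intro AE_I2) (simp add: h_def max_def)
      show "(\<lambda>t. h t powr r) \<in> borel_measurable M" using hm by measurable
    qed
    define K where "K = (\<integral>t. h t powr r \<partial>M) powr (1 / r)"
    have "integrable M (\<lambda>t. h t * 1)"
      by (rule Holder_inequality(1)[OF r(2) q1 rq hm _ _ _ ihr]) (auto simp: h_def)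
    then have "integrable M h" by simp
    moreover have "AE t in M. \<forall>\<xi>\<in>\<Phi> t. norm \<xi> \<le> h t" using dom by eventually_elim (auto simp: h_def)
    moreover have "integrable M (\<lambda>t. h t * norm (\<phi> t)) \<and> (\<integral>t. h t * norm (\<phi> t) \<partial>M) \<le> K * Lq_norm M q \<phi>"
      if "\<phi> \<in> borel_measurable M" "integrable M (\<lambda>t. norm (\<phi> t) powr q)" for \<phi> :: "'t \<Rightarrow> 'x"
      using Holder_inequality[OF r(2) q1 rq hm _ _ _ ihr that(2)] that(1) by (auto simp: h_def K_def Lq_norm_def)
    ultimately show ?thesis using q1 by (intro exI[of _ h] exI[of _ K]) (auto simp: h_def K_def)
  qed
qed

subsection \<open>Closed convex hulls\<close>

lemma subset_weak_star_closed_hull: "A \<subseteq> weak_star_closed_hull A"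
  unfolding weak_star_closed_hull_def
  by (rule order_trans[OF hull_subset closure_of_subset]) (simp add: strong_operator_topology_topspace)

lemma weak_star_closed_hull_le:
  assumes "\<And>\<xi>. \<xi> \<in> A \<Longrightarrow> blinfun_apply \<xi> x \<le> c" and "\<xi> \<in> weak_star_closed_hull A"
  shows "blinfun_apply \<xi> x \<le> c"
proof -
  have "convex {\<xi>. blinfun_apply \<xi> x \<le> c}"
    by (auto simp: convex_def blinfun.add_left blinfun.scaleR_left intro: convex_bound_le)
  then have "convex hull A \<subseteq> {\<xi>. blinfun_apply \<xi> x \<le> c}" using assms(1) by (intro hull_minimal) auto
  then have "weak_star_closed_hull A \<subseteq> {\<xi>. blinfun_apply \<xi> x \<le> c}"
    unfolding weak_star_closed_hull_def by (intro closure_of_minimal closedin_weak_star_le)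
  then show ?thesis using assms(2) by auto
qed

lemma norm_weak_star_closed_hull_le:
  assumes "\<And>\<xi>. \<xi> \<in> A \<Longrightarrow> norm \<xi> \<le> c" "0 \<le> c" and \<xi>: "\<xi> \<in> weak_star_closed_hull A"
  shows "norm \<xi> \<le> c"
proof (rule norm_blinfun_bound)
  have *: "blinfun_apply \<eta> x \<le> c * norm x" if "\<eta> \<in> A" for \<eta> x
    using abs_blinfun_le[OF assms(1)[OF that], of x] by simp
  fix x
  have "blinfun_apply \<xi> x \<le> c * norm x" "blinfun_apply \<xi> (- x) \<le> c * norm (- x)"
    by (rule weak_star_closed_hull_le[OF _ \<xi>], rule *, assumption)+
  then show "norm (blinfun_apply \<xi> x) \<le> c * norm x" by (simp add: blinfun.minus_right abs_le_iff)
qed fact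

context threshold_enumeration
begin

lemma ex_tcell: "\<exists>s. length s = n \<and> \<xi> \<in> tcell s"
proof (induction n)
  case (Suc n)
  then obtain s where s: "length s = n" "\<xi> \<in> tcell s" by blast
  let ?b = "blinfun_apply \<xi> (fst (e (length s))) \<le> snd (e (length s))"
  have "\<xi> \<in> tcell (?b # s)" using s by auto
  then show ?case using s(1) by (intro exI[of _ "?b # s"]) simp
qed simp

lemma tcell_tbox_side:
  assumes "e n = (d, q)"
  shows "\<xi> \<in> tcell s \<Longrightarrow> \<eta> \<in> tbox s \<Longrightarrow> n < length s \<Longrightarrow>
    (blinfun_apply \<xi> d < q \<longrightarrow> blinfun_apply \<eta> d \<le> q) \<and> (q < blinfun_apply \<xi> d \<longrightarrow> q \<le> blinfun_apply \<eta> d)"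
proof (induction s)
  case (Cons b s)
  show ?case
  proof (cases "n = length s")
    case True
    then show ?thesis using Cons.prems assms by (auto split: if_splits)
  next
    case False
    then show ?thesis using Cons by auto
  qed
qed simp

text \<open>A deep enough cell of \<open>\<xi>\<close> traps \<open>\<xi>\<close> and the chosen
  point \<open>c s\<close> between two rationals close to the value of \<open>\<xi>\<close> at
  \<open>d\<close>, a point of \<open>D\<close> near \<open>y\<close>. Boundedness controls the
  change from \<open>y\<close> to \<open>d\<close>. So the chosen points are dense in
  \<open>\<Phi>\<close> as seen by any single test point.\<close>

lemma tbox_approximation:
  assumes c: "\<And>s. \<Phi> \<inter> tbox s \<noteq> {} \<Longrightarrow> c s \<in> tbox s" "\<And>s. c s \<in> \<Phi>"
    and h: "\<And>\<xi>. \<xi> \<in> \<Phi> \<Longrightarrow> norm \<xi> \<le> h" and \<xi>: "\<xi> \<in> \<Phi>" and \<delta>: "0 < \<delta>"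
  shows "\<exists>s. \<bar>blinfun_apply (c s) y - blinfun_apply \<xi> y\<bar> < \<delta>"
proof -
  have h0: "0 \<le> h" using h[OF \<xi>] norm_ge_zero[of \<xi>] by linarith
  have "0 < \<delta> / (4 * (h + 1))" using \<delta> h0 by simp
  then obtain d where d: "d \<in> D" "norm (y - d) < \<delta> / (4 * (h + 1))" using approx_D by blast
  have near: "\<bar>blinfun_apply \<eta> y - blinfun_apply \<eta> d\<bar> \<le> \<delta> / 4" if "\<eta> \<in> \<Phi>" for \<eta>
  proof -
    have "\<bar>blinfun_apply \<eta> (y - d)\<bar> \<le> h * norm (y - d)" by (rule abs_blinfun_le[OF h[OF that]])
    also have "\<dots> \<le> (h + 1) * (\<delta> / (4 * (h + 1)))" using h0 d(2) by (intro mult_mono) auto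
    also have "\<dots> = \<delta> / 4" using h0 by (simp add: field_simps)
    finally show ?thesis by (simp add: blinfun.diff_right)
  qed
  define r where "r = blinfun_apply \<xi> d"
  have "\<exists>q\<in>\<rat>. r - \<delta> / 4 < q \<and> q < r" using \<delta> by (intro Rats_dense_in_real) simp
  then obtain q1 where q1: "q1 \<in> \<rat>" "r - \<delta> / 4 < q1" "q1 < r" by blast
  have "\<exists>q\<in>\<rat>. r < q \<and> q < r + \<delta> / 4" using \<delta> by (intro Rats_dense_in_real) simp
  then obtain q2 where q2: "q2 \<in> \<rat>" "r < q2" "q2 < r + \<delta> / 4" by blast
  obtain n1 where n1: "e n1 = (d, q1)" by (rule threshold_index[OF d(1) q1(1)])
  obtain n2 where n2: "e n2 = (d, q2)" by (rule threshold_index[OF d(1) q2(1)])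
  \<comment> \<open>The test with index \<open>n\<close> is decided at depth \<open>n + 1\<close>,
    so this depth settles both tests.\<close>
  obtain s where s: "length s = Suc (max n1 n2)" "\<xi> \<in> tcell s" using ex_tcell by blast
  have "\<Phi> \<inter> tbox s \<noteq> {}" using s(2) tcell_subset_tbox \<xi> by blast
  then have cs: "c s \<in> tbox s" by (rule c(1))
  have "q1 \<le> blinfun_apply (c s) d" using tcell_tbox_side[OF n1 s(2) cs] s(1) q1(3) by (simp add: r_def)
  moreover have "blinfun_apply (c s) d \<le> q2" using tcell_tbox_side[OF n2 s(2) cs] s(1) q2(2) by (simp add: r_def)
  ultimately have "\<bar>blinfun_apply (c s) d - blinfun_apply \<xi> d\<bar> < \<delta> / 4"
    using q1 q2 unfolding r_def by linarith
  then have "\<bar>blinfun_apply (c s) y - blinfun_apply \<xi> y\<bar> < \<delta>"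
    using near[OF c(2)[of s]] near[OF \<xi>] \<delta> by linarith
  then show ?thesis by blast
qed

end

lemma (in weighted_tree) weights_supportI:
  assumes m: "m \<in> weights \<Gamma>"
    and "\<And>s B. B \<in> sets F \<Longrightarrow> B \<subseteq> {t. \<Phi> t \<inter> tbox s = {}} \<Longrightarrow> m (s, B) = 0"
  shows "m \<in> weights \<Phi>"
  using weightsD(1-5)[OF m] assms(2) by (intro weightsI)

subsection \<open>The set of conditional expectations as an image of the weights\<close>

text \<open>\<open>\<Gamma>\<close> is the ambient bound: the correspondence itself for compactness
  and for the closed hull, the dominating correspondence for upper hemicontinuity. The exponent
  \<open>p\<close> survives only through \<open>h\<close>, \<open>K\<close> and the two inequalities
  with \<open>q\<close>.\<close>

locale bounded_correspondence = nowhere_equivalent_tree M F D e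
  for M F :: "'t measure" and D :: "'x::{banach, second_countable_topology} set" and e +
  fixes G :: "'t measure" and q K :: real and h :: "'t \<Rightarrow> real" and \<Gamma> :: "'t \<Rightarrow> ('x \<Rightarrow>\<^sub>L real) set"
  assumes subG: "subalgebra F G"
    and meas_\<Gamma>: "measurable_correspondence F \<Gamma>"
    and cpt_\<Gamma>: "AE t in M. compactin weak_star (\<Gamma> t)"
    and ne_\<Gamma>: "\<And>t. t \<in> space M \<Longrightarrow> \<Gamma> t \<noteq> {}"
    and q_ge: "1 \<le> q"
    and int_h: "integrable M h" and h_nonneg: "\<And>t. 0 \<le> h t"
    and h_bound: "AE t in M. \<forall>\<xi>\<in>\<Gamma> t. norm \<xi> \<le> h t"
    and Lq_int: "\<And>\<phi> :: 't \<Rightarrow> 'x. \<phi> \<in> borel_measurable M \<Longrightarrow> integrable M (\<lambda>t. norm (\<phi> t) powr q) \<Longrightarrow>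
      integrable M (\<lambda>t. h t * norm (\<phi> t))"
    and Lq_bound: "\<And>\<phi> :: 't \<Rightarrow> 'x. \<phi> \<in> borel_measurable M \<Longrightarrow> integrable M (\<lambda>t. norm (\<phi> t) powr q) \<Longrightarrow>
      (\<integral>t. h t * norm (\<phi> t) \<partial>M) \<le> K * Lq_norm M q \<phi>"
begin

lemma subG_M: "subalgebra M G"
  using subG subalg unfolding subalgebra_def by (metis subset_trans)

abbreviation Lq :: "('t \<Rightarrow> 'x) set" where
  "Lq \<equiv> Lq_space M G q"

lemma LqD:
  assumes "\<phi> \<in> Lq"
  shows "\<phi> \<in> borel_measurable G" "\<phi> \<in> borel_measurable F" "\<phi> \<in> borel_measurable M"
    "integrable M (\<lambda>t. h t * norm (\<phi> t))" "(\<integral>t. h t * norm (\<phi> t) \<partial>M) \<le> K * Lq_norm M q \<phi>"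
proof -
  note D = Lq_spaceD[OF assms subG_M]
  show "\<phi> \<in> borel_measurable G" "\<phi> \<in> borel_measurable M" by (fact D)+
  show "\<phi> \<in> borel_measurable F" by (rule measurable_from_subalg[OF subG D(1)])
  show "integrable M (\<lambda>t. h t * norm (\<phi> t))" by (rule Lq_int[OF D(2,3)])
  show "(\<integral>t. h t * norm (\<phi> t) \<partial>M) \<le> K * Lq_norm M q \<phi>" by (rule Lq_bound[OF D(2,3)])
qed

lemma selection_bound:
  assumes "AE t in M. f t \<in> \<Gamma> t"
  shows "AE t in M. norm (f t) \<le> h t"
  using h_bound assms by eventually_elim blast

text \<open>Choosing within \<open>\<Gamma>\<close>, also for the weights of smaller
  correspondences, gives a single map on one compact set. Which realization is chosen does not
  affect the pairings, by \<open>realizes_unique\<close>.\<close>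

definition sel :: "(bool list \<times> 't set \<Rightarrow> real) \<Rightarrow> 't \<Rightarrow> 'x \<Rightarrow>\<^sub>L real" where
  "sel m = (SOME f. f \<in> measurable M weak_star_borel \<and> (AE t in M. f t \<in> \<Gamma> t) \<and> realizes f m)"

lemma sel:
  assumes "m \<in> weights \<Gamma>"
  shows "sel m \<in> measurable M weak_star_borel" "AE t in M. sel m t \<in> \<Gamma> t" "realizes (sel m) m"
    "AE t in M. norm (sel m t) \<le> h t"
proof -
  have "\<exists>f. f \<in> measurable M weak_star_borel \<and> (AE t in M. f t \<in> \<Gamma> t) \<and> realizes f m"
    using realization[OF assms meas_\<Gamma> cpt_\<Gamma>] by blast
  note * = someI_ex[OF this, folded sel_def]
  show "sel m \<in> measurable M weak_star_borel" by (rule conjunct1[OF *])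
  show "realizes (sel m) m" by (rule conjunct2[OF conjunct2[OF *]])
  show 2: "AE t in M. sel m t \<in> \<Gamma> t" by (rule conjunct1[OF conjunct2[OF *]])
  show "AE t in M. norm (sel m t) \<le> h t" by (rule selection_bound[OF 2])
qed

definition functional :: "(bool list \<times> 't set \<Rightarrow> real) \<Rightarrow> ('t \<Rightarrow> 'x) \<Rightarrow> real" where
  "functional m = (\<lambda>\<phi>\<in>Lq. \<integral>t. blinfun_apply (sel m t) (\<phi> t) \<partial>M)"

lemma functional_eq:
  assumes m: "m \<in> weights \<Gamma>" and f: "f \<in> measurable M weak_star_borel" "AE t in M. f t \<in> \<Gamma> t" "realizes f m"
    and \<phi>: "\<phi> \<in> Lq"
  shows "functional m \<phi> = (\<integral>t. blinfun_apply (f t) (\<phi> t) \<partial>M)"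
  using realizes_unique[OF sel(3,1,4)[OF m] f(3,1) selection_bound[OF f(2)] int_h h_nonneg LqD(2,4)[OF \<phi>]] \<phi>
  by (simp add: functional_def)

lemma Lq_functional_eq:
  assumes m: "m \<in> weights \<Gamma>" and f: "f \<in> measurable M weak_star_borel" "AE t in M. f t \<in> \<Gamma> t" "realizes f m"
    and g: "gelfand_cond_exp M G f g"
  shows "Lq_functional M G q g = functional m"
proof
  fix \<phi>
  show "Lq_functional M G q g \<phi> = functional m \<phi>"
  proof (cases "\<phi> \<in> Lq")
    case True
    have "(\<integral>t. blinfun_apply (g t) (\<phi> t) \<partial>M) = (\<integral>t. blinfun_apply (f t) (\<phi> t) \<partial>M)"
      by (rule gelfand_cond_exp_pairing(2)[OF prob_space_axioms subG_M f(1) selection_bound[OF f(2)] int_h h_nonneg g LqD(1,4)[OF True]])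
    then show ?thesis using functional_eq[OF m f True] True by (simp add: Lq_functional_def)
  qed (simp add: Lq_functional_def functional_def)
qed

text \<open>A selection passes to its masses; masses pass to a realization, whose conditional
  expectation exists thanks to \<open>h\<close>. The functionals agree because pairing with a
  \<open>G\<close>-measurable function does not distinguish a function from its conditional
  expectation.\<close>

lemma image_CG:
  assumes sub: "AE t in M. \<Phi> t \<subseteq> \<Gamma> t" and meas: "measurable_correspondence F \<Phi>"
    and cpt: "AE t in M. compactin weak_star (\<Phi> t)"
  shows "Lq_functional M G q ` CG M G \<Phi> = functional ` weights \<Phi>"
proof (intro equalityI subsetI)
  have W: "m \<in> weights \<Gamma>" if "m \<in> weights \<Phi>" for m using weights_mono[OF sub meas] that by blast
  have \<Gamma>: "AE t in M. f t \<in> \<Gamma> t" if "AE t in M. f t \<in> \<Phi> t" for f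
    using that sub by eventually_elim blast
  fix \<Lambda>
  {
    assume "\<Lambda> \<in> Lq_functional M G q ` CG M G \<Phi>"
    then obtain g f where *: "\<Lambda> = Lq_functional M G q g" "f \<in> measurable M weak_star_borel" "AE t in M. f t \<in> \<Phi> t" "gelfand_cond_exp M G f g"
      unfolding CG_def by blast
    obtain m where m: "m \<in> weights \<Phi>" "realizes f m" using weights_of_selection[OF *(2,3)] by blast
    have "\<Lambda> = functional m" unfolding *(1) by (rule Lq_functional_eq[OF W[OF m(1)] *(2) \<Gamma>[OF *(3)] m(2) *(4)])
    then show "\<Lambda> \<in> functional ` weights \<Phi>" using m(1) by blast
  next
    assume "\<Lambda> \<in> functional ` weights \<Phi>"
    then obtain m where m: "\<Lambda> = functional m" "m \<in> weights \<Phi>" by blast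
    obtain f where f: "f \<in> measurable M weak_star_borel" "AE t in M. f t \<in> \<Phi> t" "realizes f m"
      using realization[OF m(2) meas cpt] by blast
    note b = selection_bound[OF \<Gamma>[OF f(2)]]
    obtain g where g: "gelfand_cond_exp M G f g"
      using ex_gelfand_cond_exp[OF prob_space_axioms subG_M f(1) b int_h h_nonneg] by blast
    have "gelfand_integrable M f"
      unfolding gelfand_integrable_def using gelfand_integrable_bounded(1)[OF f(1) b int_h] by blast
    then have "g \<in> CG M G \<Phi>" unfolding CG_def using f g by blast
    moreover have "Lq_functional M G q g = \<Lambda>"
      unfolding m(1) by (rule Lq_functional_eq[OF W[OF m(2)] f(1) \<Gamma>[OF f(2)] f(3) g])
    ultimately show "\<Lambda> \<in> Lq_functional M G q ` CG M G \<Phi>" by blast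
  }
qed

lemma functional_linear:
  assumes m: "m \<in> weights \<Gamma>"
  shows "\<phi> \<in> Lq \<Longrightarrow> \<psi> \<in> Lq \<Longrightarrow> functional m (\<lambda>t. \<phi> t + \<psi> t) = functional m \<phi> + functional m \<psi>"
    and "\<phi> \<in> Lq \<Longrightarrow> functional m (\<lambda>t. c *\<^sub>R \<phi> t) = c * functional m \<phi>"
    and "\<phi> \<in> Lq \<Longrightarrow> \<bar>functional m \<phi>\<bar> \<le> K * Lq_norm M q \<phi>"
proof -
  have i: "integrable M (\<lambda>t. blinfun_apply (sel m t) (\<phi> t))" if "\<phi> \<in> Lq" for \<phi>
    by (rule integrable_pairing[OF sel(1)[OF m] LqD(3)[OF that] sel(4)[OF m] LqD(4)[OF that]])
  show "functional m (\<lambda>t. \<phi> t + \<psi> t) = functional m \<phi> + functional m \<psi>" if "\<phi> \<in> Lq" "\<psi> \<in> Lq"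
  proof -
    have "(\<lambda>t. \<phi> t + \<psi> t) \<in> Lq" by (rule Lq_space_add[OF subG_M _ that]) (use q_ge in simp)
    then show ?thesis using that i[OF that(1)] i[OF that(2)]
      by (simp add: functional_def blinfun.add_right)
  qed
  show "functional m (\<lambda>t. c *\<^sub>R \<phi> t) = c * functional m \<phi>" if "\<phi> \<in> Lq"
    using that Lq_space_scaleR[OF that, of c] by (simp add: functional_def blinfun.scaleR_right)
  show "\<bar>functional m \<phi>\<bar> \<le> K * Lq_norm M q \<phi>" if "\<phi> \<in> Lq"
    using order_trans[OF integral_pairing_le[OF sel(1)[OF m] LqD(3)[OF that] sel(4)[OF m] LqD(4)[OF that]] LqD(5)[OF that]] that
    by (simp add: functional_def)
qed

lemma functional_in_dual: "m \<in> weights \<Gamma> \<Longrightarrow> functional m \<in> Lq_dual M G q"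
proof -
  assume m: "m \<in> weights \<Gamma>"
  show "functional m \<in> Lq_dual M G q"
    unfolding Lq_dual_def
  proof (intro CollectI conjI ballI allI exI)
    show "functional m \<in> extensional Lq" by (simp add: functional_def)
  qed (rule functional_linear[OF m]; assumption)+
qed

lemma continuous_on_functional:
  assumes "\<phi> \<in> Lq"
  shows "continuous_on (weights \<Gamma>) (\<lambda>m. functional m \<phi>)"
proof -
  have "continuous_on (weights \<Gamma>) (\<lambda>m. \<integral>t. blinfun_apply (sel m t) (\<phi> t) \<partial>M)"
    by (rule continuous_on_pairing[OF sel(3) sel(1) sel(4) int_h h_nonneg LqD(2,4)[OF assms]])
  then show ?thesis using assms by (simp add: functional_def)
qed

section \<open>Weak* compactness and upper hemicontinuity\<close>

lemma continuous_map_functional: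
  "continuous_map (top_of_set (weights \<Gamma>)) (Lq_dual_weak_star M G q) functional"
proof -
  have "functional ` weights \<Gamma> \<subseteq> extensional Lq"
    by (rule image_subsetI) (simp add: functional_def)
  moreover have "continuous_map (top_of_set (weights \<Gamma>)) euclideanreal (\<lambda>m. functional m \<phi>)" if "\<phi> \<in> Lq" for \<phi>
    using continuous_on_functional[OF that] by simp
  ultimately have "continuous_map (top_of_set (weights \<Gamma>)) (product_topology (\<lambda>_. euclideanreal) Lq) functional"
    unfolding continuous_map_componentwise by simp
  then show ?thesis
    unfolding Lq_dual_weak_star_def by (rule continuous_map_into_subtopology) (rule Pi_I, rule functional_in_dual, simp)
qed

lemma compactin_CG:
  assumes sub: "AE t in M. \<Phi> t \<subseteq> \<Gamma> t" and meas: "measurable_correspondence F \<Phi>"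
    and cpt: "AE t in M. compactin weak_star (\<Phi> t)"
  shows "compactin (Lq_dual_weak_star M G q) (Lq_functional M G q ` CG M G \<Phi>)"
  unfolding image_CG[OF assms]
proof (rule image_compactin[OF _ continuous_map_functional])
  show "compactin (top_of_set (weights \<Gamma>)) (weights \<Phi>)"
    unfolding compactin_subtopology using compact_weights[of \<Phi>] weights_mono[OF sub meas] by simp
qed

lemma CG_nonempty:
  assumes sub: "AE t in M. \<Phi> t \<subseteq> \<Gamma> t" and meas: "measurable_correspondence F \<Phi>"
    and cpt: "AE t in M. compactin weak_star (\<Phi> t)" and ne: "\<And>t. t \<in> space M \<Longrightarrow> \<Phi> t \<noteq> {}"
  shows "weights \<Phi> \<noteq> {}"
proof -
  obtain f where "f \<in> measurable M weak_star_borel" "AE t in M. f t \<in> \<Phi> t"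
    using ex_selection[OF meas cpt ne] by blast
  from weights_of_selection[OF this] show ?thesis by blast
qed

text \<open>
  A cluster point of weights \<open>m_n\<close> carried by \<open>\<Phi>(\<cdot>, y_n)\<close> with \<open>y_n \<rightarrow> y0\<close> is carried
  by \<open>\<Phi>(\<cdot>, y0)\<close>: if \<open>\<Phi>(t, y0)\<close> misses a closed box, so does \<open>\<Phi>(t, y_n)\<close> for large \<open>n\<close>.
\<close>

lemma upper_hemicontinuous_CG:
  fixes \<Phi> :: "'t \<times> 'y::metric_space \<Rightarrow> ('x \<Rightarrow>\<^sub>L real) set"
  assumes ne: "\<And>t y. t \<in> space M \<Longrightarrow> \<Phi> (t, y) \<noteq> {}"
    and cl: "\<And>y. AE t in M. closedin weak_star (\<Phi> (t, y))"
    and sub: "\<And>y. AE t in M. \<Phi> (t, y) \<subseteq> \<Gamma> t"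
    and meas: "\<And>y. measurable_correspondence F (\<lambda>t. \<Phi> (t, y))"
    and uhc: "\<And>t. t \<in> space M \<Longrightarrow> upper_hemicontinuous euclidean weak_star (\<lambda>y. \<Phi> (t, y))"
  shows "upper_hemicontinuous euclidean (Lq_dual_weak_star M G q) (\<lambda>y. Lq_functional M G q ` CG M G (\<lambda>t. \<Phi> (t, y)))"
proof -
  let ?T = "Lq_dual_weak_star M G q"
  have cpt: "AE t in M. compactin weak_star (\<Phi> (t, y))" for y
    using cl[of y] sub[of y] cpt_\<Gamma> by eventually_elim (rule closed_compactin)
  note img = image_CG[OF sub meas cpt]
  note mono = weights_mono[OF sub meas]
  have top: "functional ` weights \<Gamma> \<subseteq> topspace ?T"
    using continuous_map_image_subset_topspace[OF continuous_map_functional] by simp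
  have "correspondence (topspace euclidean) (topspace ?T) (\<lambda>y. functional ` weights (\<lambda>t. \<Phi> (t, y)))"
    unfolding correspondence_def
  proof (intro ballI conjI)
    fix y
    show "functional ` weights (\<lambda>t. \<Phi> (t, y)) \<noteq> {}" using CG_nonempty[OF sub meas cpt ne, of y] by simp
    show "functional ` weights (\<lambda>t. \<Phi> (t, y)) \<subseteq> topspace ?T" by (rule order_trans[OF image_mono[OF mono] top])
  qed
  moreover have "\<exists>U. openin euclidean U \<and> y0 \<in> U \<and> (\<forall>y\<in>U. functional ` weights (\<lambda>t. \<Phi> (t, y)) \<subseteq> V)"
    if V: "openin ?T V" "functional ` weights (\<lambda>t. \<Phi> (t, y0)) \<subseteq> V" for y0 V
  proof (rule ccontr)
    assume no: "\<not> ?thesis"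
    have "\<exists>y m. dist y y0 < 1 / real (Suc n) \<and> m \<in> weights (\<lambda>t. \<Phi> (t, y)) \<and> functional m \<notin> V" for n
    proof -
      have "openin euclidean (ball y0 (1 / real (Suc n)))" "y0 \<in> ball y0 (1 / real (Suc n))" by auto
      then have "\<not> (\<forall>y\<in>ball y0 (1 / real (Suc n)). functional ` weights (\<lambda>t. \<Phi> (t, y)) \<subseteq> V)" using no by blast
      then obtain y k where "y \<in> ball y0 (1 / real (Suc n))" "k \<in> weights (\<lambda>t. \<Phi> (t, y))" "functional k \<notin> V"
        by blast
      then show ?thesis by (intro exI[of _ y] exI[of _ k]) (simp add: dist_commute)
    qed
    then obtain y m where ym: "\<And>n. dist (y n) y0 < 1 / real (Suc n)" "\<And>n. m n \<in> weights (\<lambda>t. \<Phi> (t, y n))" "\<And>n. functional (m n) \<notin> V"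
      by metis
    have lim0: "(\<lambda>n. 1 / real (Suc n)) \<longlonglongrightarrow> 0" by (intro LIMSEQ_Suc lim_1_over_n)
    have "dist (y n) y0 \<le> dist (1 / real (Suc n)) 0" for n using ym(1)[of n] by (simp add: dist_real_def)
    then have lim: "y \<longlonglongrightarrow> y0" by (intro metric_tendsto_imp_tendsto[OF lim0] always_eventually allI)
    define C where "C = {m \<in> weights \<Gamma>. functional m \<notin> V}"
    have "closedin ?T (topspace ?T - V)" using V(1) by auto
    then have "closedin (top_of_set (weights \<Gamma>)) {m \<in> topspace (top_of_set (weights \<Gamma>)). functional m \<in> topspace ?T - V}"
      by (rule closedin_continuous_map_preimage[OF continuous_map_functional])
    also have "{m \<in> topspace (top_of_set (weights \<Gamma>)). functional m \<in> topspace ?T - V} = C"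
      using top by (auto simp: C_def)
    finally have "compact C" by (rule closedin_compact[OF compact_weights])
    moreover have "m n \<in> C" for n using ym(3)[of n] subsetD[OF mono ym(2)] by (simp add: C_def)
    then have "eventually (\<lambda>x. x \<in> C) (filtermap m sequentially)" by (simp add: eventually_filtermap)
    moreover have "filtermap m sequentially \<noteq> bot" by (simp add: filtermap_bot_iff)
    \<comment> \<open>Compactness of the product provides a cluster point of the sequence viewed as
      a filter; no convergent subsequence is extracted.\<close>
    ultimately obtain x where x: "x \<in> C" "inf (nhds x) (filtermap m sequentially) \<noteq> bot"
      unfolding compact_filter by blast
    \<comment> \<open>A cluster point inherits every coordinate that is eventually 0, and the
      support clause in \<open>weights\<close> is a statement about vanishing coordinates.\<close>
    have zero: "x p = 0" if ev: "eventually (\<lambda>n. m n p = 0) sequentially" for p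
    proof (rule ccontr)
      assume "x p \<noteq> 0"
      have "open {k :: bool list \<times> 't set \<Rightarrow> real. k p \<noteq> 0}"
        by (intro open_Collect_neq continuous_on_product_coordinates continuous_on_const)
      then have "eventually (\<lambda>k. k p \<noteq> 0) (nhds x)"
        using \<open>x p \<noteq> 0\<close> eventually_nhds_in_open[of "{k. k p \<noteq> 0}" x] by simp
      moreover have "eventually (\<lambda>k. k p = 0) (filtermap m sequentially)" using ev by (simp add: eventually_filtermap)
      ultimately have "eventually (\<lambda>k. False) (inf (nhds x) (filtermap m sequentially))"
        unfolding eventually_inf by (intro exI[of _ "\<lambda>k. k p \<noteq> 0"] exI[of _ "\<lambda>k. k p = 0"]) simp
      then show False using x(2) by (simp add: trivial_limit_def)
    qed
    have xW: "x \<in> weights \<Gamma>" using x(1) by (simp add: C_def)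
    have "x \<in> weights (\<lambda>t. \<Phi> (t, y0))"
    proof (rule weights_supportI[OF xW])
      fix s B assume B: "B \<in> sets F" "B \<subseteq> {t. \<Phi> (t, y0) \<inter> tbox s = {}}"
      let ?N = "\<lambda>n. {t\<in>space M. \<Phi> (t, y n) \<inter> tbox s = {}}"
      \<comment> \<open>\<open>B' n\<close> collects the points of \<open>B\<close> whose values
        miss the box from index \<open>n\<close> on. The mass of the cluster point vanishes there,
        and on the shrinking remainder it is at most the probability, which tends to 0.\<close>
      define B' where "B' n = B \<inter> (\<Inter>k\<in>{n..}. ?N k)" for n
      have NF: "?N k \<in> sets F" for k by (rule measurable_correspondence_box(2)[OF meas])
      have B'F: "B' n \<in> sets F" for n
        unfolding B'_def using NF by (intro sets.Int B(1) sets.countable_INT') auto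
      have "x (s, B' n) = 0" for n
      proof (rule zero, rule eventually_sequentiallyI[of n])
        fix k assume "n \<le> k"
        then have "B' n \<subseteq> {t. \<Phi> (t, y k) \<inter> tbox s = {}}" by (auto simp: B'_def)
        then show "m k (s, B' n) = 0" by (rule weightsD(6)[OF ym(2) B'F])
      qed
      moreover have "x (s, B) = x (s, B' n) + x (s, B - B' n)" for n
      proof -
        have "B = B' n \<union> (B - B' n)" by (auto simp: B'_def)
        then show ?thesis using weightsD(5)[OF xW B'F[of n], of "B - B' n" s] B(1) B'F[of n] by auto
      qed
      ultimately have le: "x (s, B) \<le> prob (B - B' n)" for n
        using weights_le_prob[OF xW, of "B - B' n" s] B(1) B'F[of n] by simp
      have "(\<lambda>n. prob (B - B' n)) \<longlonglongrightarrow> prob (\<Inter>n. B - B' n)"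
      proof (rule finite_Lim_measure_decseq)
        show "range (\<lambda>n. B - B' n) \<subseteq> sets M" using sets_F_M[OF B(1)] sets_F_M[OF B'F] by auto
        show "decseq (\<lambda>n. B - B' n)" unfolding decseq_def B'_def by fastforce
      qed
      moreover have "(\<Inter>n. B - B' n) = {}"
      proof (rule ccontr)
        assume "(\<Inter>n. B - B' n) \<noteq> {}"
        then obtain t where t: "\<And>n. t \<in> B - B' n" by blast
        have tM: "t \<in> space M" using t[of 0] sets.sets_into_space[OF sets_F_M[OF B(1)]] by blast
        have "openin weak_star (topspace weak_star - tbox s)" using closedin_tbox by blast
        moreover have "\<Phi> (t, y0) \<subseteq> topspace weak_star - tbox s"
          using t[of 0] B(2) by (auto simp: strong_operator_topology_topspace)
        ultimately have "\<exists>U. openin euclidean U \<and> y0 \<in> U \<and> (\<forall>y\<in>U. \<Phi> (t, y) \<subseteq> topspace weak_star - tbox s)"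
          using uhc[OF tM, unfolded upper_hemicontinuous_def, THEN conjunct2, rule_format, of y0] by simp
        then obtain U where U: "open U" "y0 \<in> U" "\<forall>y\<in>U. \<Phi> (t, y) \<subseteq> topspace weak_star - tbox s"
          by auto
        then have "eventually (\<lambda>n. y n \<in> U) sequentially" using lim by (auto simp: tendsto_def)
        then obtain n where "\<And>k. n \<le> k \<Longrightarrow> y k \<in> U" by (auto simp: eventually_sequentially)
        then have "t \<in> B' n" using U(3) tM t[of 0] by (fastforce simp: B'_def)
        then show False using t[of n] by blast
      qed
      ultimately have "(\<lambda>n. prob (B - B' n)) \<longlonglongrightarrow> 0" by (simp only: measure_empty)
      then have "x (s, B) \<le> 0" by (rule LIMSEQ_le_const) (use le in blast)
      then show "x (s, B) = 0" using weightsD(1)[OF xW, of s B] by simp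
    qed
    then have "functional x \<in> V" using V(2) by blast
    then show False using x(1) by (simp add: C_def)
  qed
  ultimately show ?thesis unfolding upper_hemicontinuous_def img by auto
qed

section \<open>Attaining the closed convex hull\<close>

lemma functional_sum:
  assumes m: "m \<in> weights \<Gamma>" and I: "finite I" "\<And>i. i \<in> I \<Longrightarrow> \<phi> i \<in> Lq"
  shows "functional m (\<lambda>t. \<Sum>i\<in>I. a i *\<^sub>R \<phi> i t) = (\<Sum>i\<in>I. a i * functional m (\<phi> i))"
  using I
proof (induction rule: finite_induct)
  case empty
  then show ?case using functional_linear(2)[OF m, of "\<lambda>_. 0" 0] by (simp add: Lq_space_def)
next
  case (insert i I)
  have 1: "(\<lambda>t. a i *\<^sub>R \<phi> i t) \<in> Lq" using insert by (intro Lq_space_scaleR) auto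
  have 2: "(\<lambda>t. \<Sum>i\<in>I. a i *\<^sub>R \<phi> i t) \<in> Lq"
    using insert q_ge by (intro Lq_space_sum[OF subG_M]) (auto intro: Lq_space_scaleR)
  show ?case using insert functional_linear(1)[OF m 1 2] functional_linear(2)[OF m, of "\<phi> i" "a i"] by simp
qed

text \<open>Convexity is transferred from the set of conditional expectations through
  \<open>image_CG\<close>, so the resulting \<open>m\<close> is not claimed to be the mixture of
  \<open>m1\<close> and \<open>m2\<close>; only its functional is.\<close>

lemma functional_convex:
  assumes "m1 \<in> weights \<Gamma>" "m2 \<in> weights \<Gamma>" "0 \<le> u" "0 \<le> v" "u + v = 1"
  shows "\<exists>m\<in>weights \<Gamma>. \<forall>\<phi>\<in>Lq. functional m \<phi> = u * functional m1 \<phi> + v * functional m2 \<phi>"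
proof -
  note img = image_CG[OF _ meas_\<Gamma> cpt_\<Gamma>, simplified]
  have "functional m1 \<in> Lq_functional M G q ` CG M G \<Gamma>" "functional m2 \<in> Lq_functional M G q ` CG M G \<Gamma>"
    using img assms(1,2) by blast+
  then obtain g1 g2 where g: "g1 \<in> CG M G \<Gamma>" "g2 \<in> CG M G \<Gamma>" "functional m1 = Lq_functional M G q g1" "functional m2 = Lq_functional M G q g2"
    by blast
  have "(\<lambda>t. u *\<^sub>R g1 t + v *\<^sub>R g2 t) \<in> CG M G \<Gamma>"
    using convex_CG[OF subG meas_\<Gamma> cpt_\<Gamma>] g(1,2) assms(3-5) unfolding convex_function_set_def by blast
  then have "Lq_functional M G q (\<lambda>t. u *\<^sub>R g1 t + v *\<^sub>R g2 t) \<in> functional ` weights \<Gamma>" using img by blast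
  then obtain m where m: "m \<in> weights \<Gamma>" "functional m = Lq_functional M G q (\<lambda>t. u *\<^sub>R g1 t + v *\<^sub>R g2 t)" by auto
  have i: "integrable M (\<lambda>t. blinfun_apply (g t) (\<phi> t))" if "g \<in> CG M G \<Gamma>" "\<phi> \<in> Lq" for g \<phi>
  proof -
    obtain f where f: "f \<in> measurable M weak_star_borel" "AE t in M. f t \<in> \<Gamma> t" "gelfand_cond_exp M G f g"
      using \<open>g \<in> CG M G \<Gamma>\<close> unfolding CG_def by blast
    show ?thesis
      by (rule gelfand_cond_exp_pairing(1)[OF prob_space_axioms subG_M f(1) selection_bound[OF f(2)] int_h h_nonneg f(3) LqD(1,4)[OF that(2)]])
  qed
  have "functional m \<phi> = u * functional m1 \<phi> + v * functional m2 \<phi>" if "\<phi> \<in> Lq" for \<phi>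
    unfolding m(2) g(3,4) using i[OF g(1) that] i[OF g(2) that] that
    by (simp add: Lq_functional_def blinfun.add_left blinfun.scaleR_left)
  then show ?thesis using m(1) by blast
qed

text \<open>A selection nearly maximizing \<open>\<xi> \<mapsto> \<xi>(\<eta>(t))\<close> is pasted from the countably many dense selections.\<close>

lemma near_maximal_selection:
  assumes f: "f \<in> measurable M weak_star_borel" "AE t in M. f t \<in> weak_star_closed_hull (\<Gamma> t)"
    and \<eta>: "\<eta> \<in> Lq" and \<epsilon>: "0 < \<epsilon>"
  shows "\<exists>k\<in>measurable M weak_star_borel. (AE t in M. k t \<in> \<Gamma> t) \<and>
    (\<integral>t. blinfun_apply (f t) (\<eta> t) \<partial>M) - \<epsilon> \<le> (\<integral>t. blinfun_apply (k t) (\<eta> t) \<partial>M)"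
proof -
  have "\<forall>s. \<exists>c. c \<in> measurable M weak_star_borel \<and> (AE t in M. c t \<in> \<Gamma> t) \<and> (AE t in M. \<Gamma> t \<inter> tbox s \<noteq> {} \<longrightarrow> c t \<in> tbox s)"
    using dense_selections[OF meas_\<Gamma> cpt_\<Gamma> ne_\<Gamma>] by blast
  from choice[OF this] obtain c where c0: "\<forall>s. c s \<in> measurable M weak_star_borel \<and> (AE t in M. c s t \<in> \<Gamma> t) \<and>
      (AE t in M. \<Gamma> t \<inter> tbox s \<noteq> {} \<longrightarrow> c s t \<in> tbox s)" by blast
  have c: "c s \<in> measurable M weak_star_borel" "AE t in M. c s t \<in> \<Gamma> t"
      "AE t in M. \<Gamma> t \<inter> tbox s \<noteq> {} \<longrightarrow> c s t \<in> tbox s" for s using spec[OF c0, of s] by simp_all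
  have fb: "AE t in M. norm (f t) \<le> h t"
    using f(2) h_bound
  proof eventually_elim
    case (elim t)
    show ?case by (rule norm_weak_star_closed_hull_le[OF _ h_nonneg elim(1)]) (use elim(2) in blast)
  qed
  \<comment> \<open>\<open>from_nat\<close> enumerates the paths, so this asks whether the dense
    selection number \<open>n\<close> falls short of \<open>f\<close> by less than \<epsilon> at
    \<open>t\<close>.\<close>
  define P where "P n t \<longleftrightarrow> blinfun_apply (f t) (\<eta> t) - \<epsilon> < blinfun_apply (c (from_nat n) t) (\<eta> t)" for n :: nat and t
  have [measurable]: "(\<lambda>t. blinfun_apply (f t) (\<eta> t)) \<in> borel_measurable M" "(\<lambda>t. blinfun_apply (c s t) (\<eta> t)) \<in> borel_measurable M" for s
    using measurable_pairing[OF f(1) LqD(3)[OF \<eta>]] measurable_pairing[OF c(1) LqD(3)[OF \<eta>]] by auto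
  \<comment> \<open>The first successful index is measurable. Should there be none,
    \<open>LEAST\<close> still returns some index, so \<open>k t\<close> is always the value of one
    of the dense selections.\<close>
  define j where "j t = (LEAST n. P n t)" for t
  have jm: "j \<in> measurable M (count_space UNIV)" unfolding j_def[abs_def] P_def by measurable
  define k where "k t = c (from_nat (j t)) t" for t
  have km: "k \<in> measurable M weak_star_borel"
  proof (rule measurable_weak_starI)
    fix d
    show "(\<lambda>t. blinfun_apply (k t) d) \<in> borel_measurable M"
      unfolding k_def
      by (rule measurable_compose_countable[OF measurable_apply_weak_star[OF c(1)] jm])
  qed
  have c2: "AE t in M. \<forall>s. c s t \<in> \<Gamma> t" using c(2) by (simp add: AE_all_countable)
  have c3: "AE t in M. \<forall>s. \<Gamma> t \<inter> tbox s \<noteq> {} \<longrightarrow> c s t \<in> tbox s" using c(3) by (simp add: AE_all_countable)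
  have ksel: "AE t in M. k t \<in> \<Gamma> t" using c2 by eventually_elim (simp add: k_def)
  have "AE t in M. blinfun_apply (f t) (\<eta> t) - \<epsilon> \<le> blinfun_apply (k t) (\<eta> t)"
    using c2 c3 f(2) h_bound
  proof eventually_elim
    case (elim t)
    have "\<exists>n. P n t"
    proof (rule ccontr)
      assume "\<not> (\<exists>n. P n t)"
      then have le: "blinfun_apply (c s t) (\<eta> t) \<le> blinfun_apply (f t) (\<eta> t) - \<epsilon>" for s
        by (metis P_def from_nat_to_nat not_less)
      \<comment> \<open>If no dense selection came close, all of \<open>\<Gamma> t\<close>, and
        hence its closed convex hull, would lie in a half-space that misses
        \<open>f t\<close>.\<close>
      have "blinfun_apply \<xi> (\<eta> t) \<le> blinfun_apply (f t) (\<eta> t) - \<epsilon>" if "\<xi> \<in> \<Gamma> t" for \<xi>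
      proof (rule field_le_epsilon)
        fix \<delta> :: real assume "0 < \<delta>"
        have "\<exists>s. \<bar>blinfun_apply (c s t) (\<eta> t) - blinfun_apply \<xi> (\<eta> t)\<bar> < \<delta>"
          by (rule tbox_approximation[where \<Phi> = "\<Gamma> t" and h = "h t"]) (use elim that \<open>0 < \<delta>\<close> in auto)
        then obtain s where "\<bar>blinfun_apply (c s t) (\<eta> t) - blinfun_apply \<xi> (\<eta> t)\<bar> < \<delta>" by blast
        then show "blinfun_apply \<xi> (\<eta> t) \<le> blinfun_apply (f t) (\<eta> t) - \<epsilon> + \<delta>" using le[of s] by linarith
      qed
      then have "blinfun_apply (f t) (\<eta> t) \<le> blinfun_apply (f t) (\<eta> t) - \<epsilon>"
        by (rule weak_star_closed_hull_le[OF _ elim(3)])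
      then show False using \<epsilon> by simp
    qed
    then have "P (j t) t" unfolding j_def by (rule LeastI_ex)
    then show ?case by (simp add: P_def k_def)
  qed
  then have "(\<integral>t. blinfun_apply (f t) (\<eta> t) - \<epsilon> \<partial>M) \<le> (\<integral>t. blinfun_apply (k t) (\<eta> t) \<partial>M)"
    using integrable_pairing[OF f(1) LqD(3)[OF \<eta>] fb LqD(4)[OF \<eta>]]
      integrable_pairing[OF km LqD(3)[OF \<eta>] selection_bound[OF ksel] LqD(4)[OF \<eta>]]
    by (intro integral_mono_AE) auto
  then have "(\<integral>t. blinfun_apply (f t) (\<eta> t) \<partial>M) - \<epsilon> \<le> (\<integral>t. blinfun_apply (k t) (\<eta> t) \<partial>M)"
    using integrable_pairing[OF f(1) LqD(3)[OF \<eta>] fb LqD(4)[OF \<eta>]] by (simp add: prob_space)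
  then show ?thesis using km ksel by blast
qed

text \<open>
  The values of \<open>functional\<close> form a compact convex set.  A functional outside it is separated from
  it by a single \<open>\<eta> \<in> Lq\<close>, found by minimizing a sum of squares over finitely many test functions.
\<close>

lemma functional_separation:
  assumes no: "\<And>m. m \<in> weights \<Gamma> \<Longrightarrow> \<exists>\<phi>\<in>Lq. functional m \<phi> \<noteq> \<Lambda> \<phi>"
  shows "\<exists>I a \<delta>. finite I \<and> I \<subseteq> Lq \<and> 0 < \<delta> \<and>
    (\<forall>m\<in>weights \<Gamma>. (\<Sum>\<phi>\<in>I. a \<phi> * functional m \<phi>) + \<delta> \<le> (\<Sum>\<phi>\<in>I. a \<phi> * \<Lambda> \<phi>))"
proof -
  define C where "C \<phi> = {m \<in> weights \<Gamma>. functional m \<phi> = \<Lambda> \<phi>}" for \<phi>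
  have clC: "closed (C \<phi>)" if "\<phi> \<in> Lq" for \<phi>
    unfolding C_def
    by (rule continuous_closed_preimage_constant[OF continuous_on_functional[OF that] closed_weights])
  \<comment> \<open>The closed sets \<open>C \<phi>\<close> have no common point in the compact set
    of weights, so finitely many of them already have none. This makes the separation a
    finite-dimensional problem.\<close>
  have "\<exists>I. finite I \<and> I \<subseteq> Lq \<and> weights \<Gamma> \<inter> \<Inter>(C ` I) = {}"
  proof (rule ccontr)
    assume no_fin: "\<not> ?thesis"
    have "weights \<Gamma> \<inter> \<Inter>(C ` Lq) \<noteq> {}"
    proof (rule compact_imp_fip[OF compact_weights])
      show "closed T" if "T \<in> C ` Lq" for T using that clC by blast
      show "weights \<Gamma> \<inter> \<Inter>\<F> \<noteq> {}" if fin: "finite \<F>" "\<F> \<subseteq> C ` Lq" for \<F>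
      proof -
        obtain I where "finite I" "I \<subseteq> Lq" "\<F> = C ` I" using finite_subset_image[OF fin] by blast
        then show ?thesis using no_fin by blast
      qed
    qed
    then obtain m where "m \<in> weights \<Gamma>" "\<And>\<phi>. \<phi> \<in> Lq \<Longrightarrow> functional m \<phi> = \<Lambda> \<phi>" unfolding C_def by blast
    then show False using no by blast
  qed
  then obtain I where I: "finite I" "I \<subseteq> Lq" "weights \<Gamma> \<inter> \<Inter>(C ` I) = {}" by blast
  define d where "d m = (\<Sum>\<phi>\<in>I. (\<Lambda> \<phi> - functional m \<phi>)\<^sup>2)" for m
  have "continuous_on (weights \<Gamma>) d"
    unfolding d_def using I(2) by (intro continuous_intros continuous_on_functional) blast
  from continuous_attains_inf[OF compact_weights CG_nonempty[OF _ meas_\<Gamma> cpt_\<Gamma> ne_\<Gamma>] this]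
  obtain m0 where m0: "m0 \<in> weights \<Gamma>" "\<And>m. m \<in> weights \<Gamma> \<Longrightarrow> d m0 \<le> d m" by auto
  \<comment> \<open>The coefficients are the residual at the best approximation, and the gap will be
    its squared length \<open>d m0\<close>.\<close>
  define a where "a \<phi> = \<Lambda> \<phi> - functional m0 \<phi>" for \<phi>
  have d0: "d m0 = (\<Sum>\<phi>\<in>I. a \<phi> * a \<phi>)" by (simp add: d_def a_def power2_eq_square)
  have "0 < d m0"
  proof -
    obtain \<phi> where "\<phi> \<in> I" "m0 \<notin> C \<phi>" using I(3) m0(1) by blast
    then have "a \<phi> \<noteq> 0" using m0(1) by (simp add: C_def a_def)
    then show ?thesis unfolding d0 using \<open>\<phi> \<in> I\<close> I(1)
      by (intro sum_pos2[of I \<phi>]) (auto simp: zero_less_mult_iff)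
  qed
  moreover have "(\<Sum>\<phi>\<in>I. a \<phi> * functional m \<phi>) + d m0 \<le> (\<Sum>\<phi>\<in>I. a \<phi> * \<Lambda> \<phi>)" if m: "m \<in> weights \<Gamma>" for m
  proof -
    define b where "b \<phi> = functional m \<phi> - functional m0 \<phi>" for \<phi>
    define S where "S = (\<Sum>\<phi>\<in>I. a \<phi> * b \<phi>)"
    define Q where "Q = (\<Sum>\<phi>\<in>I. b \<phi> * b \<phi>)"
    \<comment> \<open>Moving a fraction \<open>s\<close> from \<open>m0\<close> towards
      \<open>m\<close> cannot lower \<open>d\<close>; expanding the square and dividing by
      \<open>s\<close> gives this. Letting \<open>s\<close> tend to 0 yields
      \<open>S \<le> 0\<close>, the obtuse angle of a nearest-point projection.\<close>
    have ineq: "2 * S \<le> s * Q" if s: "0 < s" "s \<le> 1" for s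
    proof -
      obtain m' where m': "m' \<in> weights \<Gamma>" "\<forall>\<phi>\<in>Lq. functional m' \<phi> = (1 - s) * functional m0 \<phi> + s * functional m \<phi>"
        using functional_convex[OF m0(1) m, of "1 - s" s] s by auto
      have "d m' = (\<Sum>\<phi>\<in>I. (a \<phi> - s * b \<phi>)\<^sup>2)"
        unfolding d_def
      proof (rule sum.cong[OF refl])
        fix \<phi> assume "\<phi> \<in> I"
        then have "functional m' \<phi> = (1 - s) * functional m0 \<phi> + s * functional m \<phi>" using m'(2) I(2) by blast
        then have "\<Lambda> \<phi> - functional m' \<phi> = a \<phi> - s * b \<phi>" by (simp add: a_def b_def algebra_simps)
        then show "(\<Lambda> \<phi> - functional m' \<phi>)\<^sup>2 = (a \<phi> - s * b \<phi>)\<^sup>2" by simp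
      qed
      also have "\<dots> = (\<Sum>\<phi>\<in>I. a \<phi> * a \<phi> - (2 * s) * (a \<phi> * b \<phi>) + (s * s) * (b \<phi> * b \<phi>))"
        by (rule sum.cong) (simp_all add: power2_eq_square algebra_simps)
      also have "\<dots> = d m0 - 2 * s * S + s * s * Q"
        by (simp add: d0 S_def Q_def sum.distrib sum_subtractf flip: sum_distrib_left)
      finally have "s * (2 * S) \<le> s * (s * Q)" using m0(2)[OF m'(1)] by (simp add: algebra_simps)
      then show ?thesis using s(1) by simp
    qed
    have "2 * S \<le> 0"
    proof (rule LIMSEQ_le_const)
      have "(\<lambda>n. 1 / real (Suc n) * Q) \<longlonglongrightarrow> 0 * Q" by (intro tendsto_intros LIMSEQ_Suc lim_1_over_n)
      then show "(\<lambda>n. 1 / real (Suc n) * Q) \<longlonglongrightarrow> 0" by simp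
      show "\<exists>N. \<forall>n\<ge>N. 2 * S \<le> 1 / real (Suc n) * Q"
      proof (intro exI allI impI)
        fix n :: nat
        show "2 * S \<le> 1 / real (Suc n) * Q" by (rule ineq) auto
      qed
    qed
    moreover have "(\<Sum>\<phi>\<in>I. a \<phi> * \<Lambda> \<phi>) = (\<Sum>\<phi>\<in>I. a \<phi> * functional m \<phi>) + d m0 - S"
      unfolding d0 S_def sum.distrib[symmetric] sum_subtractf[symmetric]
      by (rule sum.cong) (simp_all add: a_def b_def algebra_simps)
    ultimately show ?thesis by simp
  qed
  ultimately show ?thesis using I(1,2) by blast
qed

text \<open>It suffices to find weights carried by \<open>\<Gamma>\<close> whose functional on
  \<open>L_q\<close> equals that of the hull selection \<open>f\<close>: then the given
  \<open>g\<close> is also a conditional expectation of their realization. If there were none, the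
  separating direction \<open>\<eta>\<close> would contradict a nearly maximal selection of
  \<open>\<Gamma>\<close>.\<close>

lemma CG_closed_hull: "CG M G \<Gamma> = CG M G (\<lambda>t. weak_star_closed_hull (\<Gamma> t))"
proof (intro equalityI subsetI)
  fix g assume "g \<in> CG M G \<Gamma>"
  then obtain f where f: "f \<in> measurable M weak_star_borel" "gelfand_integrable M f" "AE t in M. f t \<in> \<Gamma> t" "gelfand_cond_exp M G f g"
    unfolding CG_def by blast
  have "AE t in M. f t \<in> weak_star_closed_hull (\<Gamma> t)"
    using f(3) by eventually_elim (rule subsetD[OF subset_weak_star_closed_hull])
  then show "g \<in> CG M G (\<lambda>t. weak_star_closed_hull (\<Gamma> t))" unfolding CG_def using f by blast
next
  fix g assume "g \<in> CG M G (\<lambda>t. weak_star_closed_hull (\<Gamma> t))"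
  then obtain f where f: "f \<in> measurable M weak_star_borel" "AE t in M. f t \<in> weak_star_closed_hull (\<Gamma> t)" "gelfand_cond_exp M G f g"
    unfolding CG_def by blast
  have fb: "AE t in M. norm (f t) \<le> h t"
    using f(2) h_bound
  proof eventually_elim
    case (elim t)
    show ?case by (rule norm_weak_star_closed_hull_le[OF _ h_nonneg elim(1)]) (use elim(2) in blast)
  qed
  define \<Lambda> where "\<Lambda> \<phi> = (\<integral>t. blinfun_apply (f t) (\<phi> t) \<partial>M)" for \<phi>
  have i: "integrable M (\<lambda>t. blinfun_apply (f t) (\<phi> t))" if "\<phi> \<in> Lq" for \<phi>
    by (rule integrable_pairing[OF f(1) LqD(3)[OF that] fb LqD(4)[OF that]])
  have "\<exists>m\<in>weights \<Gamma>. \<forall>\<phi>\<in>Lq. functional m \<phi> = \<Lambda> \<phi>"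
  proof (rule ccontr)
    assume "\<not> ?thesis"
    then have "\<And>m. m \<in> weights \<Gamma> \<Longrightarrow> \<exists>\<phi>\<in>Lq. functional m \<phi> \<noteq> \<Lambda> \<phi>" by blast
    from functional_separation[OF this] obtain I a \<delta> where I: "finite I" "I \<subseteq> Lq" "0 < \<delta>"
      "\<And>m. m \<in> weights \<Gamma> \<Longrightarrow> (\<Sum>\<phi>\<in>I. a \<phi> * functional m \<phi>) + \<delta> \<le> (\<Sum>\<phi>\<in>I. a \<phi> * \<Lambda> \<phi>)" by blast
    define \<eta> where "\<eta> t = (\<Sum>\<phi>\<in>I. a \<phi> *\<^sub>R \<phi> t)" for t
    have \<eta>: "\<eta> \<in> Lq" unfolding \<eta>_def[abs_def]
      using I(1,2) q_ge by (intro Lq_space_sum[OF subG_M]) (auto intro: Lq_space_scaleR)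
    have "0 < \<delta> / 2" using I(3) by simp
    from near_maximal_selection[OF f(1,2) \<eta> this] obtain k where k: "k \<in> measurable M weak_star_borel" "AE t in M. k t \<in> \<Gamma> t"
      "\<Lambda> \<eta> - \<delta> / 2 \<le> (\<integral>t. blinfun_apply (k t) (\<eta> t) \<partial>M)" unfolding \<Lambda>_def by blast
    obtain m where m: "m \<in> weights \<Gamma>" "realizes k m" using weights_of_selection[OF k(1,2)] by blast
    have "\<Lambda> \<eta> = (\<Sum>\<phi>\<in>I. a \<phi> * \<Lambda> \<phi>)"
      unfolding \<Lambda>_def \<eta>_def using I(2) i by (simp add: blinfun.sum_right blinfun.scaleR_right subset_iff)
    moreover have "(\<integral>t. blinfun_apply (k t) (\<eta> t) \<partial>M) = functional m \<eta>" using functional_eq[OF m(1) k(1,2) m(2) \<eta>] by simp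
    moreover have "functional m \<eta> = (\<Sum>\<phi>\<in>I. a \<phi> * functional m \<phi>)"
      unfolding \<eta>_def[abs_def] using functional_sum[OF m(1) I(1), of "\<lambda>\<phi>. \<phi>" a] I(2) by blast
    ultimately show False using k(3) I(4)[OF m(1)] I(3) by linarith
  qed
  then obtain m where m: "m \<in> weights \<Gamma>" "\<And>\<phi>. \<phi> \<in> Lq \<Longrightarrow> functional m \<phi> = \<Lambda> \<phi>" by blast
  note s = sel[OF m(1)]
  have si: "integrable M (\<lambda>t. blinfun_apply (sel m t) x)" for x
    by (rule gelfand_integrable_bounded(1)[OF s(1,4) int_h])
  \<comment> \<open>Functions that are a fixed point \<open>x\<close> on \<open>B\<close> and 0
    elsewhere belong to \<open>L_q\<close>; testing with them recovers the Gel'fand integrals over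
    sets of \<open>G\<close>.\<close>
  have eq: "(\<integral>t\<in>B. blinfun_apply (sel m t) x \<partial>M) = (\<integral>t\<in>B. blinfun_apply (f t) x \<partial>M)" if B: "B \<in> sets G" for B x
  proof -
    let ?\<phi> = "\<lambda>t. indicat_real B t *\<^sub>R x"
    have BM: "B \<in> sets M" using B subG_M by (auto simp: subalgebra_def)
    have "norm (?\<phi> t) powr q = indicat_real B t * norm x powr q" for t by (simp add: indicator_def)
    then have \<phi>: "?\<phi> \<in> Lq"
      using B BM by (auto simp: Lq_space_def emeasure_eq_measure intro!: borel_measurable_scaleR borel_measurable_indicator integrable_scaleR_left)
    then have "functional m ?\<phi> = \<Lambda> ?\<phi>" by (rule m(2))
    then show ?thesis using \<phi>
      by (simp add: functional_def \<Lambda>_def blinfun.scaleR_right set_lebesgue_integral_def)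
  qed
  have "gelfand_cond_exp M G (sel m) g"
    using f(3) unfolding gelfand_cond_exp_def gelfand_integral_def eq by (simp add: eq)
  moreover have "gelfand_integrable M (sel m)" using si by (simp add: gelfand_integrable_def)
  ultimately show "g \<in> CG M G \<Gamma>" unfolding CG_def using s(1,2) by blast
qed

end

section \<open>Conjugate exponents and assembly of the four claims\<close>

lemma bounded_correspondenceI:
  fixes M F G :: "'t measure" and \<Gamma> :: "'t \<Rightarrow> ('x::{banach, second_countable_topology} \<Rightarrow>\<^sub>L real) set"
  assumes "nowhere_equivalent_tree M F D e" and G: "subalgebra F G"
    and p: "1 < p" "1 / p + 1 / ereal q = 1"
    and \<Gamma>: "correspondence (space M) UNIV \<Gamma>" "measurable_correspondence F \<Gamma>"
      "integrably_bounded M p \<Gamma>" "weak_star_compact_valued M \<Gamma>"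
  shows "\<exists>K h. bounded_correspondence M F D e G q K h \<Gamma>"
proof -
  interpret nowhere_equivalent_tree M F D e by fact
  obtain h K where h: "1 \<le> q" "integrable M h" "\<forall>t. 0 \<le> h t" "AE t in M. \<forall>\<xi>\<in>\<Gamma> t. norm \<xi> \<le> h t"
    "\<forall>\<phi> :: 't \<Rightarrow> 'x. \<phi> \<in> borel_measurable M \<longrightarrow> integrable M (\<lambda>t. norm (\<phi> t) powr q) \<longrightarrow>
       integrable M (\<lambda>t. h t * norm (\<phi> t)) \<and> (\<integral>t. h t * norm (\<phi> t) \<partial>M) \<le> K * Lq_norm M q \<phi>"
    using integrably_bounded_conjugate[OF prob_space_axioms p \<Gamma>(3)] by blast
  have "bounded_correspondence M F D e G q K h \<Gamma>"
  proof
    show "subalgebra F G" "measurable_correspondence F \<Gamma>" "1 \<le> q" "integrable M h" by (fact G \<Gamma> h)+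
    show "AE t in M. \<forall>\<xi>\<in>\<Gamma> t. norm \<xi> \<le> h t" by (fact h)
    show "AE t in M. compactin weak_star (\<Gamma> t)" using \<Gamma>(4) by (simp add: weak_star_compact_valued_def)
    show "\<Gamma> t \<noteq> {}" if "t \<in> space M" for t using \<Gamma>(1) that by (simp add: correspondence_def)
    show "0 \<le> h t" for t using h(3) by simp
    fix \<phi> :: "'t \<Rightarrow> 'x"
    assume \<phi>: "\<phi> \<in> borel_measurable M" "integrable M (\<lambda>t. norm (\<phi> t) powr q)"
    show "integrable M (\<lambda>t. h t * norm (\<phi> t))" "(\<integral>t. h t * norm (\<phi> t) \<partial>M) \<le> K * Lq_norm M q \<phi>"
      using h(5) \<phi> by simp_all
  qed
  then show ?thesis by blast
qed

text \<open>The claim on closed hulls does not mention \<open>q\<close>, but its proof separates by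
  a function in \<open>L_q\<close>, so an exponent has to be supplied: \<open>r / (r - 1)\<close>
  for finite \<open>p = r\<close>, and 1 for infinite \<open>p\<close>.\<close>

lemma ex_conjugate_exponent:
  assumes "1 < p"
  shows "\<exists>q::real. 1 / p + 1 / ereal q = 1"
proof (cases p)
  case (real r)
  then have r: "1 < r" using assms by simp
  then have "1 / ereal r + 1 / ereal (r / (r - 1)) = ereal (1 / r + (r - 1) / r)"
    by (simp add: divide_ereal_def one_ereal_def inverse_eq_divide)
  also have "1 / r + (r - 1) / r = 1" using r by (simp add: field_simps)
  finally have "1 / p + 1 / ereal (r / (r - 1)) = 1" unfolding real one_ereal_def .
  then show ?thesis by (rule exI)
next
  case PInf
  then have "1 / p + 1 / ereal 1 = 1" by (simp add: divide_ereal_def one_ereal_def)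
  then show ?thesis by (rule exI)
next
  case MInf
  then show ?thesis using assms by simp
qed

theorem theorem2:
  fixes M F :: "'t measure"
  assumes "prob_space M" and "complete_measure M" and "atomless M"
    and "subalgebra M F" and "countably_generated F"
    and "nowhere_equivalent M F"
  shows "\<forall>G :: 't measure. subalgebra F G \<longrightarrow>
    (\<forall>\<Phi> :: 't \<Rightarrow> ('x::{banach, second_countable_topology} \<Rightarrow>\<^sub>L real) set.
        correspondence (space M) UNIV \<Phi> \<and> measurable_correspondence F \<Phi> \<and>
        weak_star_compact_valued M \<Phi> \<longrightarrow>
        convex_function_set (CG M G \<Phi>)) \<and>
    (\<forall>(p :: ereal) (q :: real) (\<Phi> :: 't \<Rightarrow> ('x \<Rightarrow>\<^sub>L real) set).
        1 < p \<and> 1 / p + 1 / ereal q = 1 \<and>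
        correspondence (space M) UNIV \<Phi> \<and> measurable_correspondence F \<Phi> \<and>
        integrably_bounded M p \<Phi> \<and> weak_star_compact_valued M \<Phi> \<longrightarrow>
        compactin (Lq_dual_weak_star M G q) (Lq_functional M G q ` CG M G \<Phi>)) \<and>
    (\<forall>(p :: ereal) (\<Phi> :: 't \<Rightarrow> ('x \<Rightarrow>\<^sub>L real) set).
        1 < p \<and>
        correspondence (space M) UNIV \<Phi> \<and> measurable_correspondence F \<Phi> \<and>
        integrably_bounded M p \<Phi> \<and> weak_star_compact_valued M \<Phi> \<longrightarrow>
        CG M G \<Phi> = CG M G (\<lambda>t. weak_star_closed_hull (\<Phi> t))) \<and>
    (\<forall>(p :: ereal) (q :: real) (\<Gamma> :: 't \<Rightarrow> ('x \<Rightarrow>\<^sub>L real) set)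
       (\<Phi> :: 't \<times> 'y::metric_space \<Rightarrow> ('x \<Rightarrow>\<^sub>L real) set).
        1 < p \<and> 1 / p + 1 / ereal q = 1 \<and>
        correspondence (space M) UNIV \<Gamma> \<and> measurable_correspondence F \<Gamma> \<and>
        integrably_bounded M p \<Gamma> \<and> weak_star_compact_valued M \<Gamma> \<and>
        correspondence (space M \<times> UNIV) UNIV \<Phi> \<and>
        (\<forall>y. weak_star_closed_valued M (\<lambda>t. \<Phi> (t, y))) \<and>
        (\<forall>y. AE t in M. \<Phi> (t, y) \<subseteq> \<Gamma> t) \<and>
        (\<forall>y. measurable_correspondence F (\<lambda>t. \<Phi> (t, y))) \<and>
        (\<forall>t\<in>space M. upper_hemicontinuous euclidean weak_star (\<lambda>y. \<Phi> (t, y))) \<longrightarrow>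
        upper_hemicontinuous euclidean (Lq_dual_weak_star M G q)
          (\<lambda>y. Lq_functional M G q ` CG M G (\<lambda>t. \<Phi> (t, y))))"
proof -
  obtain D :: "'x set" and e where "threshold_enumeration D e" using ex_threshold_enumeration by blast
  then have tree: "nowhere_equivalent_tree M F D e"
    using assms(1,4,6)
    by (simp add: nowhere_equivalent_tree_def nowhere_equivalent_space_def nowhere_equivalent_space_axioms_def
        prob_subalgebra_def prob_subalgebra_axioms_def)
  show ?thesis
  proof (intro allI impI conjI; (elim conjE)?)
    fix G :: "'t measure" and \<Phi> :: "'t \<Rightarrow> ('x \<Rightarrow>\<^sub>L real) set"
    assume "subalgebra F G" "measurable_correspondence F \<Phi>" "weak_star_compact_valued M \<Phi>"
    then show "convex_function_set (CG M G \<Phi>)"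
      using nowhere_equivalent_tree.convex_CG[OF tree] by (simp add: weak_star_compact_valued_def)
  next
    fix G :: "'t measure" and \<Phi> :: "'t \<Rightarrow> ('x \<Rightarrow>\<^sub>L real) set" and p q
    assume G: "subalgebra F G" and p: "1 < p" "1 / p + 1 / ereal q = 1" and \<Phi>: "correspondence (space M) UNIV \<Phi>"
      "measurable_correspondence F \<Phi>" "integrably_bounded M p \<Phi>" "weak_star_compact_valued M \<Phi>"
    obtain K h where "bounded_correspondence M F D e G q K h \<Phi>"
      using bounded_correspondenceI[OF tree G p \<Phi>] by blast
    then interpret bounded_correspondence M F D e G q K h \<Phi> .
    show "compactin (Lq_dual_weak_star M G q) (Lq_functional M G q ` CG M G \<Phi>)"
      by (rule compactin_CG[OF _ meas_\<Gamma> cpt_\<Gamma>]) simp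
  next
    fix G :: "'t measure" and \<Phi> :: "'t \<Rightarrow> ('x \<Rightarrow>\<^sub>L real) set" and p :: ereal
    assume G: "subalgebra F G" and p: "1 < p" and \<Phi>: "correspondence (space M) UNIV \<Phi>"
      "measurable_correspondence F \<Phi>" "integrably_bounded M p \<Phi>" "weak_star_compact_valued M \<Phi>"
    obtain q where q: "1 / p + 1 / ereal q = 1" using ex_conjugate_exponent[OF p] by blast
    obtain K h where "bounded_correspondence M F D e G q K h \<Phi>"
      using bounded_correspondenceI[OF tree G p q \<Phi>] by blast
    then interpret bounded_correspondence M F D e G q K h \<Phi> .
    show "CG M G \<Phi> = CG M G (\<lambda>t. weak_star_closed_hull (\<Phi> t))" by (rule CG_closed_hull)
  next
    fix G :: "'t measure" and \<Gamma> :: "'t \<Rightarrow> ('x \<Rightarrow>\<^sub>L real) set" and p q and \<Phi> :: "'t \<times> 'y \<Rightarrow> ('x \<Rightarrow>\<^sub>L real) set"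
    assume G: "subalgebra F G" and p: "1 < p" "1 / p + 1 / ereal q = 1" and \<Gamma>: "correspondence (space M) UNIV \<Gamma>"
      "measurable_correspondence F \<Gamma>" "integrably_bounded M p \<Gamma>" "weak_star_compact_valued M \<Gamma>"
      and \<Phi>: "correspondence (space M \<times> UNIV) UNIV \<Phi>" "\<forall>y. weak_star_closed_valued M (\<lambda>t. \<Phi> (t, y))"
        "\<forall>y. AE t in M. \<Phi> (t, y) \<subseteq> \<Gamma> t" "\<forall>y. measurable_correspondence F (\<lambda>t. \<Phi> (t, y))"
        "\<forall>t\<in>space M. upper_hemicontinuous euclidean weak_star (\<lambda>y. \<Phi> (t, y))"
    obtain K h where "bounded_correspondence M F D e G q K h \<Gamma>"
      using bounded_correspondenceI[OF tree G p \<Gamma>] by blast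
    then interpret bounded_correspondence M F D e G q K h \<Gamma> .
    show "upper_hemicontinuous euclidean (Lq_dual_weak_star M G q) (\<lambda>y. Lq_functional M G q ` CG M G (\<lambda>t. \<Phi> (t, y)))"
    proof (rule upper_hemicontinuous_CG)
      show "\<Phi> (t, y) \<noteq> {}" if "t \<in> space M" for t y using \<Phi>(1) that by (simp add: correspondence_def)
      show "AE t in M. closedin weak_star (\<Phi> (t, y))" for y
        using \<Phi>(2) by (simp add: weak_star_closed_valued_def)
    qed (use \<Phi>(3-5) in auto)
  qed
qed

end
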